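(* Let $M$ be either $S^2$ or $\mathbb{R}\mathrm{P}^2$, let $Z\subseteq M$ be compact, and for $i=1,\dots,N$ let $\Psi_i\colon Z\to TM$ be continuous with $\Psi_i(z)\in T_zM$ for every $z\in Z$. Suppose there is an absolutely continuous $x\colon[0,\infty)\to Z$ with $\dot x(t)=\sum_{i=1}^N u_i(t)\Psi_i(x(t))$ for a.e. $t$, for some Lebesgue measurable $u_1,\dots,u_N\colon[0,\infty)\to[0,1]$ with $\sum_{i=1}^N u_i(t)=1$ a.e. Then there exist periodic measurable functions $v_1,\dots,v_N\colon[0,\infty)\to[0,1]$ with $\sum_{i=1}^N v_i(t)=1$ a.e., and a periodic absolutely continuous function $y$ from $[0,\infty)$ into the $\omega$-limit set $\bigcap_{T\ge0}\overline{x([T,\infty))}$ of $x$, such that $\dot y(t)=\sum_{i=1}^N v_i(t)\Psi_i(y(t))$ for a.e. $t$. *)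

theory Defs
  imports "HOL-Analysis.Analysis"
begin

definition absolutely_continuous_on :: "real set \<Rightarrow> (real \<Rightarrow> 'a::real_normed_vector) \<Rightarrow> bool" where
  "absolutely_continuous_on S f \<longleftrightarrow>
     (\<forall>\<epsilon>>0. \<exists>\<delta>>0. \<forall>(n::nat) (a::nat \<Rightarrow> real) (b::nat \<Rightarrow> real).
        (\<forall>k<n. a k \<le> b k \<and> {a k..b k} \<subseteq> S) \<and>
        (\<forall>j<n. \<forall>k<n. j \<noteq> k \<longrightarrow> {a j<..<b j} \<inter> {a k<..<b k} = {}) \<and>
        (\<Sum>k<n. b k - a k) < \<delta>
        \<longrightarrow> (\<Sum>k<n. norm (f (b k) - f (a k))) < \<epsilon>)"

definition abs_cont_halfline :: "(real \<Rightarrow> 'a::real_normed_vector) \<Rightarrow> bool" where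
  "abs_cont_halfline f \<longleftrightarrow> (\<forall>T\<ge>0. absolutely_continuous_on {0..T} f)"

definition periodic_halfline :: "(real \<Rightarrow> 'a) \<Rightarrow> bool" where
  "periodic_halfline f \<longleftrightarrow> (\<exists>p>0. \<forall>t\<ge>0. f (t + p) = f t)"

definition omega_limit :: "(real \<Rightarrow> 'a::topological_space) \<Rightarrow> 'a set" where
  "omega_limit x = (\<Inter>T\<in>{0..}. closure (x ` {T..}))"

definition control_fun :: "(real \<Rightarrow> real) \<Rightarrow> bool" where
  "control_fun u \<longleftrightarrow> u \<in> borel_measurable (restrict_space lebesgue {0..})
                       \<and> (\<forall>t\<ge>0. 0 \<le> u t \<and> u t \<le> 1)"

definition periodic_limit_property :: "'a::euclidean_space set \<Rightarrow> ('a \<Rightarrow> 'a set) \<Rightarrow> bool" where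
  "periodic_limit_property M TM \<longleftrightarrow>
    (\<forall>(Z::'a set) (N::nat) (\<Psi>::nat \<Rightarrow> 'a \<Rightarrow> 'a) (x::real \<Rightarrow> 'a) (u::nat \<Rightarrow> real \<Rightarrow> real).
       Z \<subseteq> M \<and> compact Z \<and>
       (\<forall>i\<in>{1..N}. continuous_on Z (\<Psi> i) \<and> (\<forall>z\<in>Z. \<Psi> i z \<in> TM z)) \<and>
       (\<forall>t\<ge>0. x t \<in> Z) \<and> abs_cont_halfline x \<and>
       (\<forall>i\<in>{1..N}. control_fun (u i)) \<and>
       (AE t in lebesgue. t \<ge> 0 \<longrightarrow> (\<Sum>i=1..N. u i t) = 1) \<and>
       (AE t in lebesgue. t \<ge> 0 \<longrightarrow>
          (x has_vector_derivative (\<Sum>i=1..N. u i t *\<^sub>R \<Psi> i (x t))) (at t within {0..}))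
     \<longrightarrow>
       (\<exists>(v::nat \<Rightarrow> real \<Rightarrow> real) (y::real \<Rightarrow> 'a).
          (\<forall>i\<in>{1..N}. control_fun (v i) \<and> periodic_halfline (v i)) \<and>
          (AE t in lebesgue. t \<ge> 0 \<longrightarrow> (\<Sum>i=1..N. v i t) = 1) \<and>
          periodic_halfline y \<and> abs_cont_halfline y \<and>
          (\<forall>t\<ge>0. y t \<in> omega_limit x) \<and>
          (AE t in lebesgue. t \<ge> 0 \<longrightarrow>
             (y has_vector_derivative (\<Sum>i=1..N. v i t *\<^sub>R \<Psi> i (y t))) (at t within {0..}))))"

definition S2 :: "(real^3) set" where
  "S2 = sphere 0 1"

definition T_S2 :: "real^3 \<Rightarrow> (real^3) set" where
  "T_S2 z = {v. v \<bullet> z = 0}"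

text \<open>RP^2 as the Veronese surface {x x^T | |x| = 1} in the space of 3x3 real matrices
  (a smooth embedding of RP^2); the tangent space at x x^T is {x v^T + v x^T | v \<bottom> x}.\<close>
definition outer_vec :: "real^3 \<Rightarrow> real^3 \<Rightarrow> real^3^3" where
  "outer_vec a b = (\<chi> i j. a $ i * b $ j)"

definition RP2 :: "(real^3^3) set" where
  "RP2 = {outer_vec x x | x. norm x = 1}"

definition T_RP2 :: "real^3^3 \<Rightarrow> (real^3^3) set" where
  "T_RP2 P = {outer_vec x v + outer_vec v x | x v. norm x = 1 \<and> P = outer_vec x x \<and> v \<bullet> x = 0}"

end

(* The differential inclusion y' in conv {Psi_1(y), ..., Psi_N(y)} is treated in an integrated form,
   for which solutions form a compact set. Take a solution y1 in the omega-limit set of x, a solution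
   y2 in the omega-limit set of y1, and a point z in the omega-limit set of y2. If 0 lies in the
   convex hull at z, the constant curve z is a solution. Otherwise all solutions near z cross
   a transversal arc through z in the same direction. If y1 is injective, the Jordan curve theorem on
   the sphere makes its crossings monotone along the arc, so its omega-limit set meets the arc at most
   once; as y2 crosses the arc at arbitrarily late times, it then passes twice through one point.
   Since a solution may be restarted at any point of its graph, a solution that is not
   injective can be cut and repeated periodically. The controls of the periodic solution
   are recovered by differentiating almost everywhere and selecting convex coefficients
   measurably. The case of RP^2 follows by lifting to the double cover. *)

theory Submission
  imports Defs "HOL-Complex_Analysis.Great_Picard"
begin

section \<open>Increments of absolutely continuous functions\<close>

text \<open>The obstacle is non-uniqueness: for merely continuous fields, solutions may branch,
  merge and pass through one point with different continuations. Injectivity of the individual curve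
  therefore takes the role that uniqueness plays in the classical Poincare-Bendixson theorem, and
  its failure is no loss, since it already yields a loop. A loop found on \<open>x\<close> itself
  would lie in the range of \<open>x\<close>, not necessarily in its omega-limit set; this is why
  the alternative is applied to \<open>y1\<close> and \<open>y2\<close>, whose ranges lie inside
  that set. The integrated inclusion tests mean velocities against half spaces. Such inequalities
  pass to pointwise limits and add up under concatenation, so neither limits nor gluing involve
  controls. The controls are chosen afterwards as Borel functions of position and velocity, which
  makes them inherit the period. The detour through the sphere is forced because a one-sided closed
  curve does not separate RP^2.\<close>

lemma increment_ge_of_vector_derivative:
  fixes f :: "real \<Rightarrow> real"
  assumes "(f has_vector_derivative D) (at x within {a..b})" "c \<le> D" "0 < e"
  obtains r where "0 < r"
    "\<And>u w. \<lbrakk>u \<le> x; x \<le> w; {u..w} \<subseteq> {a..b}; {u..w} \<subseteq> ball x r\<rbrakk> \<Longrightarrow> (c - e) * (w - u) \<le> f w - f u"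
proof -
  have "(f has_derivative (\<lambda>h. h * D)) (at x within {a..b})"
    using assms(1) by (simp add: has_vector_derivative_def)
  then obtain r where r: "r > 0" and
    ineq: "\<And>y. y \<in> {a..b} \<Longrightarrow> norm (y - x) < r \<Longrightarrow> norm (f y - f x - (y - x) * D) \<le> e * norm (y - x)"
    using \<open>0 < e\<close> unfolding has_derivative_within_alt by metis
  show thesis
  proof (rule that[OF r])
    fix u w assume uw: "u \<le> x" "x \<le> w" "{u..w} \<subseteq> {a..b}" "{u..w} \<subseteq> ball x r"
    have "u \<in> {u..w}" "w \<in> {u..w}" using uw by auto
    then have m: "u \<in> {a..b}" "w \<in> {a..b}" "\<bar>u - x\<bar> < r" "\<bar>w - x\<bar> < r"
      using uw(3,4) by (auto simp: subset_eq dist_real_def abs_minus_commute)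
    have "norm (f w - f x - (w - x) * D) \<le> e * norm (w - x)"
      by (rule ineq) (use m in auto)
    then have 1: "f w - f x \<ge> (w - x) * D - e * (w - x)" using uw by (simp add: abs_le_iff)
    have "norm (f u - f x - (u - x) * D) \<le> e * norm (u - x)"
      by (rule ineq) (use m in auto)
    then have 2: "f x - f u \<ge> (x - u) * D - e * (x - u)"
      using uw by (simp add: abs_le_iff algebra_simps)
    \<comment> \<open>The two one-sided errors \<open>e * (w - x)\<close> and
      \<open>e * (x - u)\<close> add up to \<open>e * (w - u)\<close>, so intervals that merely
      contain the tag \<open>x\<close> are enough.\<close>
    have "(w - u) * c \<le> (w - u) * D" using uw assms(2) by (intro mult_left_mono) auto
    with 1 2 show "(c - e) * (w - u) \<le> f w - f u" by (simp add: algebra_simps)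
  qed
qed

text \<open>Cousin's lemma: on tags where the derivative exists the increments are bounded below,
  the remaining tags have intervals of small total length.\<close>
lemma absolutely_continuous_increment_ge:
  fixes f :: "real \<Rightarrow> real"
  assumes ac: "absolutely_continuous_on {a..b} f" and "a \<le> b"
    and der: "AE t in lebesgue. t \<in> {a..b} \<longrightarrow>
                (\<exists>D\<ge>c. (f has_vector_derivative D) (at t within {a..b}))"
  shows "c * (b - a) \<le> f b - f a"
proof (rule field_le_epsilon)
  fix e0 :: real assume "0 < e0"
  \<comment> \<open>The error budget: \<open>e\<close> for the increments over bad tags,
    \<open>\<bar>c\<bar> * e\<close> for the length they take away, \<open>e * (b - a)\<close> for
    the slack in the slopes.\<close>
  define e where "e = e0 / (2 + \<bar>c\<bar> + (b - a))"
  have e: "e > 0" using \<open>0 < e0\<close> \<open>a \<le> b\<close> by (simp add: e_def field_simps add_pos_nonneg)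
  have e_e0: "e * (2 + \<bar>c\<bar> + (b - a)) = e0"
    using \<open>a \<le> b\<close> unfolding e_def by (smt (verit) abs_ge_zero nonzero_eq_divide_eq)
  obtain d0 where d0: "d0 > 0" and
    acd: "\<forall>(n::nat) p q. (\<forall>k<n. p k \<le> q k \<and> {p k..q k} \<subseteq> {a..b}) \<and>
        (\<forall>j<n. \<forall>k<n. j \<noteq> k \<longrightarrow> {p j<..<q j} \<inter> {p k<..<q k} = {}) \<and>
        (\<Sum>k<n. q k - p k) < d0 \<longrightarrow> (\<Sum>k<n. norm (f (q k) - f (p k))) < e"
    using ac[unfolded absolutely_continuous_on_def, rule_format, OF e] by blast
  define d where "d = min d0 e"
  have d: "d > 0" using d0 e by (simp add: d_def)
  define E where "E = {t\<in>{a..b}. \<not> (\<exists>D\<ge>c. (f has_vector_derivative D) (at t within {a..b}))}"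
  obtain N where "N \<in> null_sets lebesgue" "E \<subseteq> N"
    using der unfolding eventually_ae_filter E_def by auto
  then have nE: "E \<in> null_sets lebesgue"
    using null_sets_completion_subset by blast
  obtain U where U: "open U" "E \<subseteq> U" "(U - E) \<in> lmeasurable" "emeasure lebesgue (U - E) < ennreal d"
    using sets_lebesgue_outer_open[of E d] nE d by auto
  have eU: "emeasure lebesgue U < ennreal d"
  proof -
    have "U \<in> sets lebesgue" using U(1) by auto
    then have "emeasure lebesgue (U - E) = emeasure lebesgue U"
      using nE by (simp add: emeasure_Diff_null_set)
    then show ?thesis using U by simp
  qed
  have lU: "U \<in> lmeasurable"
  proof (rule fmeasurableI)
    show "emeasure lebesgue U < \<infinity>" using eU ennreal_less_top order.strict_trans by (metis infinity_ennreal_def)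
  qed (use U(1) in auto)
  \<comment> \<open>\<open>Q x r\<close> describes the radii that suit the gauge at
    \<open>x\<close>: a bad tag keeps its interval inside the small open set \<open>U\<close>, and
    at a good tag every interval around it has slope at least \<open>c - e\<close>.\<close>
  define Q where "Q x r \<longleftrightarrow> (x \<in> E \<longrightarrow> ball x r \<subseteq> U) \<and> (x \<in> {a..b} - E \<longrightarrow>
       (\<forall>u w. u \<le> x \<longrightarrow> x \<le> w \<longrightarrow> {u..w} \<subseteq> {a..b} \<longrightarrow> {u..w} \<subseteq> ball x r \<longrightarrow> (c - e) * (w - u) \<le> f w - f u))" for x r
  have "\<exists>r. r > 0 \<and> Q x r" for x
  proof (cases "x \<in> E")
    case True
    then have "x \<in> U" using U by blast
    then obtain r where "r > 0" "ball x r \<subseteq> U" using U(1) openE by blast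
    then show ?thesis using True by (auto simp: Q_def)
  next
    case False
    show ?thesis
    proof (cases "x \<in> {a..b}")
      case True
      then obtain D where "D \<ge> c" "(f has_vector_derivative D) (at x within {a..b})"
        using False by (auto simp: E_def)
      then obtain r where "0 < r" "\<And>u w. \<lbrakk>u \<le> x; x \<le> w; {u..w} \<subseteq> {a..b}; {u..w} \<subseteq> ball x r\<rbrakk> \<Longrightarrow> (c - e) * (w - u) \<le> f w - f u"
        using increment_ge_of_vector_derivative[OF _ _ e, of f D x a b c] by blast
      then show ?thesis unfolding Q_def using False by blast
    qed (use False in \<open>auto simp: Q_def intro!: exI[of _ 1]\<close>)
  qed
  define r where "r x = (SOME r. r > 0 \<and> Q x r)" for x
  have rQ: "r x > 0 \<and> Q x (r x)" for x unfolding r_def by (rule someI_ex) fact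
  have r: "\<And>x. r x > 0" "\<And>x. x \<in> E \<Longrightarrow> ball x (r x) \<subseteq> U"
    "\<And>x u w. \<lbrakk>x \<in> {a..b} - E; u \<le> x; x \<le> w; {u..w} \<subseteq> {a..b}; {u..w} \<subseteq> ball x (r x)\<rbrakk>
       \<Longrightarrow> (c - e) * (w - u) \<le> f w - f u"
    using rQ unfolding Q_def by blast+
  obtain p where p: "p tagged_division_of {a..b}" "(\<lambda>x. ball x (r x)) fine p"
    using fine_division_exists_real[of "\<lambda>x. ball x (r x)"] r(1) by (auto simp: gauge_def)
  note pD = tagged_division_ofD[OF p(1)]
  define P1 where "P1 = {xk\<in>p. fst xk \<in> E}"
  define P2 where "P2 = {xk\<in>p. fst xk \<notin> E}"
  have fin: "finite P1" "finite P2" "finite p" and P12: "p = P1 \<union> P2" "P1 \<inter> P2 = {}"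
    using pD(1) by (auto simp: P1_def P2_def)
  have itv: "\<exists>u w. K = {u..w} \<and> u \<le> x \<and> x \<le> w" if "(x,K) \<in> p" for x K
    using pD(2,4)[OF that] by auto
  have fine: "K \<subseteq> ball x (r x)" if "(x,K) \<in> p" for x K
    using p(2) that by (auto simp: fine_def)
  \<comment> \<open>Absolute continuity speaks of indexed families of intervals, so the bad part of
    the division is enumerated.\<close>
  obtain h where h: "bij_betw h {..<card P1} P1"
    using ex_bij_betw_nat_finite[OF fin(1)] by (auto simp: atLeast0LessThan)
  let ?p = "\<lambda>k. Inf (snd (h k))" and ?q = "\<lambda>k. Sup (snd (h k))"
  have hk: "\<exists>x. (x, {?p k..?q k}) = h k \<and> (x, {?p k..?q k}) \<in> P1 \<and> ?p k \<le> x \<and> x \<le> ?q k" if k: "k < card P1" for k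
  proof -
    obtain x K where xK: "h k = (x,K)" by fastforce
    then have "(x,K) \<in> P1" using h k by (metis bij_betw_apply lessThan_iff)
    moreover then obtain u w where "K = {u..w}" "u \<le> x" "x \<le> w" using itv[of x K] unfolding P1_def by blast
    ultimately show ?thesis using xK by auto
  qed
  have pq: "?p k \<le> ?q k" if "k < card P1" for k
    using hk[OF that] by (metis order.trans)
  have disj: "{?p j<..<?q j} \<inter> {?p k<..<?q k} = {}" if jk: "j < card P1" "k < card P1" "j \<noteq> k" for j k
  proof -
    have "h j \<noteq> h k" using jk h by (auto simp: bij_betw_def inj_on_def)
    moreover obtain x1 x2 where x: "(x1, {?p j..?q j}) = h j" "(x1, {?p j..?q j}) \<in> P1"
      "(x2, {?p k..?q k}) = h k"  "(x2, {?p k..?q k}) \<in> P1" using hk[OF jk(1)] hk[OF jk(2)] by blast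
    ultimately have "interior {?p j..?q j} \<inter> interior {?p k..?q k} = {}"
      using pD(5)[of x1 "{?p j..?q j}" x2 "{?p k..?q k}"] by (auto simp: P1_def)
    then show ?thesis by (simp add: interior_atLeastAtMost_real)
  qed
  have len: "(\<Sum>k<card P1. ?q k - ?p k) < d"
  proof -
    have "(\<Sum>k<card P1. ?q k - ?p k) = (\<Sum>k<card P1. measure lebesgue {?p k<..<?q k})"
      using pq by (intro sum.cong) auto
    also have "\<dots> = measure lebesgue (\<Union>k\<in>{..<card P1}. {?p k<..<?q k})"
      by (subst measure_finite_Union) (use disj in \<open>auto simp: disjoint_family_on_def pq\<close>)
    also have "\<dots> \<le> measure lebesgue U"
    proof (rule measure_mono_fmeasurable)
      show "(\<Union>k\<in>{..<card P1}. {?p k<..<?q k}) \<subseteq> U"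
      proof clarify
        fix k y assume k: "k < card P1" and y: "y \<in> {?p k<..<?q k}"
        then obtain x where "(x, {?p k..?q k}) \<in> P1" using hk[of k] by blast
        then show "y \<in> U" using fine[of x "{?p k..?q k}"] r(2)[of x] y by (auto simp: P1_def subset_eq)
      qed
      show "U \<in> lmeasurable" by (rule lU)
    qed auto
    also have "\<dots> < d" using eU d by (simp add: emeasure_eq_measure2[OF lU] ennreal_less_iff)
    finally show ?thesis .
  qed
  have small: "(\<Sum>k<card P1. norm (f (?q k) - f (?p k))) < e"
  proof (rule acd[rule_format], intro conjI)
    show "\<forall>k<card P1. ?p k \<le> ?q k \<and> {?p k..?q k} \<subseteq> {a..b}"
    proof (intro allI impI)
      fix k assume "k < card P1"
      then obtain x where x: "(x, {?p k..?q k}) \<in> P1" "?p k \<le> x" "x \<le> ?q k" using hk[of k] by blast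
      then show "?p k \<le> ?q k \<and> {?p k..?q k} \<subseteq> {a..b}" using pD(3)[of x "{?p k..?q k}"] by (auto simp: P1_def)
    qed
  qed (use disj len in \<open>auto simp: d_def\<close>)
  have tr: "(\<Sum>xk\<in>P1. g xk) = (\<Sum>k<card P1. g (h k))" for g :: "_ \<Rightarrow> real"
    using sum.reindex_bij_betw[OF h, of g] by simp
  have S1: "(\<Sum>(x,K)\<in>P1. f (Sup K) - f (Inf K)) \<ge> - e"
  proof -
    have "(\<Sum>(x,K)\<in>P1. f (Sup K) - f (Inf K)) = (\<Sum>k<card P1. f (?q k) - f (?p k))"
      by (simp add: tr case_prod_beta)
    moreover have "\<bar>\<Sum>k<card P1. f (?q k) - f (?p k)\<bar> \<le> (\<Sum>k<card P1. norm (f (?q k) - f (?p k)))"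
      by (simp add: sum_abs)
    ultimately show ?thesis using small by linarith
  qed
  have L1: "(\<Sum>(x,K)\<in>P1. Sup K - Inf K) < e"
    using len by (simp add: tr case_prod_beta d_def)
  have L1': "(\<Sum>(x,K)\<in>P1. Sup K - Inf K) \<ge> 0"
    unfolding tr case_prod_beta by (rule sum_nonneg) (use pq in simp)
  have S2: "(\<Sum>(x,K)\<in>P2. f (Sup K) - f (Inf K)) \<ge> (c - e) * (\<Sum>(x,K)\<in>P2. Sup K - Inf K)"
    unfolding sum_distrib_left
  proof (rule sum_mono, clarify)
    fix x K assume xK: "(x,K) \<in> P2"
    then have xp: "(x,K) \<in> p" by (simp add: P2_def)
    then obtain u w where uw: "K = {u..w}" "u \<le> x" "x \<le> w" using itv by blast
    have "(c - e) * (w - u) \<le> f w - f u"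
      using r(3)[of x u w] uw xK fine[OF xp] pD(3)[OF xp] pD(2)[OF xp] by (auto simp: P2_def subset_eq)
    then show "(c - e) * (Sup K - Inf K) \<le> f (Sup K) - f (Inf K)" using uw by simp
  qed
  have "f b - f a = (\<Sum>(x,K)\<in>P1. f (Sup K) - f (Inf K)) + (\<Sum>(x,K)\<in>P2. f (Sup K) - f (Inf K))"
    using additive_tagged_division_1[OF \<open>a \<le> b\<close> p(1), of f] fin P12 by (simp add: sum.union_disjoint)
  moreover have "b - a = (\<Sum>(x,K)\<in>P1. Sup K - Inf K) + (\<Sum>(x,K)\<in>P2. Sup K - Inf K)"
    using additive_tagged_division_1[OF \<open>a \<le> b\<close> p(1), of "\<lambda>x. x"] fin P12 by (simp add: sum.union_disjoint)
  ultimately have F: "f b - f a \<ge> - e + (c - e) * (b - a - (\<Sum>(x,K)\<in>P1. Sup K - Inf K))"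
    (is "_ \<ge> - e + (c - e) * (b - a - ?l)") using S1 S2 by simp
  \<comment> \<open>As \<open>c\<close> may have either sign, the length \<open>?l\<close> lost to
    bad tags is charged at the rate \<open>\<bar>c\<bar>\<close>.\<close>
  have "(c - e) * ?l \<le> \<bar>c\<bar> * e"
  proof -
    have "(c - e) * ?l \<le> \<bar>c\<bar> * ?l" using L1' e by (intro mult_right_mono) auto
    also have "\<dots> \<le> \<bar>c\<bar> * e" using L1 by (intro mult_left_mono) auto
    finally show ?thesis .
  qed
  with F have "c * (b - a) \<le> f b - f a + e + \<bar>c\<bar> * e + e * (b - a)" by (simp add: algebra_simps)
  also have "\<dots> \<le> f b - f a + e0" using e_e0 e by (simp add: algebra_simps)
  finally show "c * (b - a) \<le> f b - f a + e0" .
qed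

section \<open>Weak solutions of the differential inclusion\<close>

text \<open>The derivative-free form of the differential inclusion: every half space that contains
  all \<open>\<Psi> i\<close> along a piece of \<open>y\<close> contains its mean velocity there.\<close>
definition weak_sol :: "'a::euclidean_space set \<Rightarrow> nat \<Rightarrow> (nat \<Rightarrow> 'a \<Rightarrow> 'a) \<Rightarrow> (real \<Rightarrow> 'a) \<Rightarrow> bool" where
  "weak_sol Z N \<Psi> y \<longleftrightarrow> (\<forall>t\<ge>0. y t \<in> Z) \<and>
     (\<forall>v c s t. 0 \<le> s \<and> s \<le> t \<and> (\<forall>\<tau>\<in>{s..t}. \<forall>i\<in>{1..N}. c \<le> v \<bullet> \<Psi> i (y \<tau>))
        \<longrightarrow> c * (t - s) \<le> v \<bullet> (y t - y s))"

lemma weak_solD1: "weak_sol Z N \<Psi> y \<Longrightarrow> 0 \<le> t \<Longrightarrow> y t \<in> Z"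
  by (simp add: weak_sol_def)

lemma weak_solD2:
  "\<lbrakk>weak_sol Z N \<Psi> y; 0 \<le> s; s \<le> t; \<And>\<tau> i. \<tau> \<in> {s..t} \<Longrightarrow> i \<in> {1..N} \<Longrightarrow> c \<le> v \<bullet> \<Psi> i (y \<tau>)\<rbrakk>
    \<Longrightarrow> c * (t - s) \<le> v \<bullet> (y t - y s)"
  unfolding weak_sol_def by blast

section \<open>Comparison of absolutely continuous functions\<close>

lemma absolutely_continuous_on_subset:
  assumes "absolutely_continuous_on S f" "T \<subseteq> S"
  shows "absolutely_continuous_on T f"
  unfolding absolutely_continuous_on_def
proof (intro allI impI)
  fix e :: real assume "e > 0"
  then obtain d where d: "d > 0" "\<forall>(n::nat) a b. (\<forall>k<n. a k \<le> b k \<and> {a k..b k} \<subseteq> S) \<and>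
        (\<forall>j<n. \<forall>k<n. j \<noteq> k \<longrightarrow> {a j<..<b j} \<inter> {a k<..<b k} = {}) \<and>
        (\<Sum>k<n. b k - a k) < d \<longrightarrow> (\<Sum>k<n. norm (f (b k) - f (a k))) < e"
    using assms(1) unfolding absolutely_continuous_on_def by blast
  show "\<exists>d>0. \<forall>(n::nat) a b. (\<forall>k<n. a k \<le> b k \<and> {a k..b k} \<subseteq> T) \<and>
        (\<forall>j<n. \<forall>k<n. j \<noteq> k \<longrightarrow> {a j<..<b j} \<inter> {a k<..<b k} = {}) \<and>
        (\<Sum>k<n. b k - a k) < d \<longrightarrow> (\<Sum>k<n. norm (f (b k) - f (a k))) < e"
    using d assms(2) by (intro exI[of _ d]) (meson order.trans)
qed

text \<open>In a family of total length below \<eta> every interval is itself shorter than \<eta>,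
  so comparing increments over short intervals is enough. This local form is what a lift to a double
  cover provides: there increments are comparable only between nearby times.\<close>

lemma absolutely_continuous_on_dominated:
  assumes ac: "absolutely_continuous_on S f" and "0 \<le> L" "0 < \<eta>"
    and le: "\<And>s t. \<lbrakk>s \<le> t; {s..t} \<subseteq> S; t - s < \<eta>\<rbrakk> \<Longrightarrow> norm (h t - h s) \<le> L * norm (f t - f s)"
  shows "absolutely_continuous_on S h"
  unfolding absolutely_continuous_on_def
proof (intro allI impI)
  fix e :: real assume "e > 0"
  then have "e / (L + 1) > 0" using \<open>0 \<le> L\<close> by simp
  then obtain d where d: "d > 0" "\<forall>(n::nat) a b. (\<forall>k<n. a k \<le> b k \<and> {a k..b k} \<subseteq> S) \<and>
        (\<forall>j<n. \<forall>k<n. j \<noteq> k \<longrightarrow> {a j<..<b j} \<inter> {a k<..<b k} = {}) \<and>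
        (\<Sum>k<n. b k - a k) < d \<longrightarrow> (\<Sum>k<n. norm (f (b k) - f (a k))) < e / (L + 1)"
    using ac unfolding absolutely_continuous_on_def by blast
  show "\<exists>d>0. \<forall>(n::nat) a b. (\<forall>k<n. a k \<le> b k \<and> {a k..b k} \<subseteq> S) \<and>
        (\<forall>j<n. \<forall>k<n. j \<noteq> k \<longrightarrow> {a j<..<b j} \<inter> {a k<..<b k} = {}) \<and>
        (\<Sum>k<n. b k - a k) < d \<longrightarrow> (\<Sum>k<n. norm (h (b k) - h (a k))) < e"
  proof (intro exI[of _ "min d \<eta>"] conjI allI impI)
    fix n :: nat and a b :: "nat \<Rightarrow> real"
    assume A: "(\<forall>k<n. a k \<le> b k \<and> {a k..b k} \<subseteq> S) \<and>
        (\<forall>j<n. \<forall>k<n. j \<noteq> k \<longrightarrow> {a j<..<b j} \<inter> {a k<..<b k} = {}) \<and> (\<Sum>k<n. b k - a k) < min d \<eta>"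
    then have sum_less: "(\<Sum>k<n. norm (f (b k) - f (a k))) < e / (L + 1)" by (intro d(2)[rule_format]) auto
    have short: "b k - a k < \<eta>" if "k < n" for k
    proof -
      have "b k - a k \<le> (\<Sum>k<n. b k - a k)" by (rule member_le_sum) (use A that in auto)
      then show ?thesis using A by linarith
    qed
    have "(\<Sum>k<n. norm (h (b k) - h (a k))) \<le> (\<Sum>k<n. L * norm (f (b k) - f (a k)))"
      by (rule sum_mono) (use A le short in auto)
    also have "\<dots> = L * (\<Sum>k<n. norm (f (b k) - f (a k)))" by (simp add: sum_distrib_left)
    also have "\<dots> \<le> L * (e / (L + 1))"
      using sum_less \<open>0 \<le> L\<close> by (intro mult_left_mono) auto
    also have "\<dots> < e" using \<open>0 \<le> L\<close> \<open>e > 0\<close> by (simp add: field_simps)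
    finally show "(\<Sum>k<n. norm (h (b k) - h (a k))) < e" .
  qed (use d \<open>0 < \<eta>\<close> in auto)
qed

lemma lipschitz_imp_absolutely_continuous_on:
  assumes "0 \<le> L" "\<And>s t. \<lbrakk>s \<in> S; t \<in> S\<rbrakk> \<Longrightarrow> norm (f t - f s) \<le> L * \<bar>t - s\<bar>"
  shows "absolutely_continuous_on S f"
proof (rule absolutely_continuous_on_dominated[where f = "\<lambda>t::real. t" and L = L and \<eta> = 1])
  show "absolutely_continuous_on S (\<lambda>t::real. t)"
    unfolding absolutely_continuous_on_def
  proof (intro allI impI)
    fix e :: real assume "0 < e"
    then show "\<exists>\<delta>>0. \<forall>n a b. (\<forall>k<n. a k \<le> b k \<and> {a k..b k} \<subseteq> S) \<and>
       (\<forall>j<n. \<forall>k<n. j \<noteq> k \<longrightarrow> {a j<..<b j} \<inter> {a k<..<b k} = {}) \<and>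
        (\<Sum>k<n. b k - a k) < \<delta> \<longrightarrow> (\<Sum>k<n. norm (b k - a k)) < e"
      by (intro exI[of _ e]) auto
  qed
  fix s t :: real assume "s \<le> t" "{s..t} \<subseteq> S"
  then have "s \<in> S" "t \<in> S" by auto
  then show "norm (f t - f s) \<le> L * norm (t - s)" using assms(2) by simp
qed (use assms in auto)

text \<open>The scalar function \<open>v \<bullet> x\<close> has almost everywhere a derivative that
  is a convex combination of the numbers \<open>v \<bullet> \<Psi> i (x t)\<close>, hence at least
  \<open>c\<close> on the piece considered.\<close>

lemma weak_sol_of_solution:
  assumes x: "\<And>t. t \<ge> 0 \<Longrightarrow> x t \<in> Z" and ac: "abs_cont_halfline x"
    and u: "\<And>i t. i \<in> {1..N} \<Longrightarrow> t \<ge> 0 \<Longrightarrow> 0 \<le> u i t"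
    and u1: "AE t in lebesgue. t \<ge> 0 \<longrightarrow> (\<Sum>i=1..N. u i t) = 1"
    and der: "AE t in lebesgue. t \<ge> 0 \<longrightarrow>
          (x has_vector_derivative (\<Sum>i=1..N. u i t *\<^sub>R \<Psi> i (x t))) (at t within {0..})"
  shows "weak_sol Z N \<Psi> x"
  unfolding weak_sol_def
proof (intro conjI allI impI; (elim conjE)?)
  fix v c s t assume st: "0 \<le> s" "s \<le> t" and c: "\<forall>\<tau>\<in>{s..t}. \<forall>i\<in>{1..N}. c \<le> v \<bullet> \<Psi> i (x \<tau>)"
  have "absolutely_continuous_on {0..t} x" using ac st by (auto simp: abs_cont_halfline_def)
  then have acx: "absolutely_continuous_on {s..t} x"
    by (rule absolutely_continuous_on_subset) (use st in auto)
  have "c * (t - s) \<le> v \<bullet> x t - v \<bullet> x s"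
  proof (rule absolutely_continuous_increment_ge)
    show "absolutely_continuous_on {s..t} (\<lambda>\<tau>. v \<bullet> x \<tau>)"
      by (rule absolutely_continuous_on_dominated[OF acx, of "norm v" 1])
         (auto simp: inner_diff_right[symmetric] Cauchy_Schwarz_ineq2)
    show "AE \<tau> in lebesgue. \<tau> \<in> {s..t} \<longrightarrow>
       (\<exists>D\<ge>c. ((\<lambda>\<tau>. v \<bullet> x \<tau>) has_vector_derivative D) (at \<tau> within {s..t}))"
      using u1 der
    proof eventually_elim
      case (elim \<tau>)
      show ?case
      proof
        assume \<tau>: "\<tau> \<in> {s..t}"
        then have \<tau>0: "\<tau> \<ge> 0" using st by auto
        let ?D = "v \<bullet> (\<Sum>i=1..N. u i \<tau> *\<^sub>R \<Psi> i (x \<tau>))"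
        have "(x has_vector_derivative (\<Sum>i=1..N. u i \<tau> *\<^sub>R \<Psi> i (x \<tau>))) (at \<tau> within {s..t})"
          by (rule has_vector_derivative_within_subset[where S = "{0..}"]) (use elim \<tau>0 st in auto)
        then have "((\<lambda>\<tau>. v \<bullet> x \<tau>) has_vector_derivative ?D) (at \<tau> within {s..t})"
          by (rule bounded_linear.has_vector_derivative[OF bounded_linear_inner_right])
        moreover have "c \<le> ?D"
        proof -
          have "c = (\<Sum>i=1..N. u i \<tau> * c)" using elim \<tau>0 by (simp add: sum_distrib_right[symmetric])
          also have "\<dots> \<le> (\<Sum>i=1..N. u i \<tau> * (v \<bullet> \<Psi> i (x \<tau>)))"
            by (intro sum_mono mult_left_mono) (use u c \<tau> \<tau>0 in auto)
          finally show ?thesis by (simp add: inner_sum_right)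
        qed
        ultimately show "\<exists>D\<ge>c. ((\<lambda>\<tau>. v \<bullet> x \<tau>) has_vector_derivative D) (at \<tau> within {s..t})" by blast
      qed
    qed
  qed (use st in auto)
  then show "c * (t - s) \<le> v \<bullet> (x t - x s)" by (simp add: inner_diff_right)
qed (use x in auto)

lemma weak_sol_shift:
  assumes "weak_sol Z N \<Psi> y" "0 \<le> T"
  shows "weak_sol Z N \<Psi> (\<lambda>t. y (T + t))"
  unfolding weak_sol_def
proof (intro conjI allI impI; (elim conjE)?)
  fix v c s t assume st: "0 \<le> s" "s \<le> t" and c: "\<forall>\<tau>\<in>{s..t}. \<forall>i\<in>{1..N}. c \<le> v \<bullet> \<Psi> i (y (T + \<tau>))"
  have "c * ((T + t) - (T + s)) \<le> v \<bullet> (y (T + t) - y (T + s))"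
  proof (rule weak_solD2[OF assms(1)])
    fix \<tau> i assume "\<tau> \<in> {T + s..T + t}" "i \<in> {1..N}"
    then show "c \<le> v \<bullet> \<Psi> i (y \<tau>)" using c[rule_format, of "\<tau> - T" i] by auto
  qed (use st assms in auto)
  then show "c * (t - s) \<le> v \<bullet> (y (T + t) - y (T + s))" by simp
qed (use assms in \<open>auto intro: weak_solD1\<close>)

text \<open>One constant serves all weak solutions at once; this equicontinuity underlies the
  compactness arguments.\<close>

lemma weak_sol_lipschitz:
  assumes "compact Z" "\<And>i. i \<in> {1..N} \<Longrightarrow> continuous_on Z (\<Psi> i)"
  obtains L where "L > 0"
    "\<And>y s t. \<lbrakk>weak_sol Z N \<Psi> y; 0 \<le> s; 0 \<le> t\<rbrakk> \<Longrightarrow> norm (y t - y s) \<le> L * \<bar>t - s\<bar>"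
proof -
  have "\<exists>B. \<forall>z\<in>Z. norm (\<Psi> i z) \<le> B" if "i \<in> {1..N}" for i
    using compact_imp_bounded[OF compact_continuous_image[OF assms(2)[OF that] assms(1)]]
    by (auto simp: bounded_iff)
  then obtain B where B: "\<And>i z. i \<in> {1..N} \<Longrightarrow> z \<in> Z \<Longrightarrow> norm (\<Psi> i z) \<le> B i" by metis
  \<comment> \<open>The summand 1 makes \<open>L\<close> positive, since later radii are quotients
    by it.\<close>
  define L where "L = 1 + (\<Sum>i=1..N. \<bar>B i\<bar>)"
  have L: "L > 0" unfolding L_def by (rule add_pos_nonneg) (auto intro: sum_nonneg)
  have BL: "norm (\<Psi> i z) \<le> L" if "i \<in> {1..N}" "z \<in> Z" for i z
  proof -
    have "\<bar>B i\<bar> \<le> (\<Sum>i=1..N. \<bar>B i\<bar>)" by (rule member_le_sum) (use that in auto)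
    then show ?thesis using B[OF that] by (auto simp: L_def)
  qed
  have main: "norm (y t - y s) \<le> L * (t - s)" if y: "weak_sol Z N \<Psi> y" and st: "0 \<le> s" "s \<le> t" for y s t
  proof -
    \<comment> \<open>Testing against the reversed displacement turns the lower bound into
      \<open>norm ?v * norm ?v \<le> norm ?v * (L * (t - s))\<close>.\<close>
    let ?v = "y s - y t"
    have "- (norm ?v * L) * (t - s) \<le> ?v \<bullet> (y t - y s)"
    proof (rule weak_solD2[OF y st])
      fix \<tau> i assume "\<tau> \<in> {s..t}" "i \<in> {1..N}"
      then have "norm (\<Psi> i (y \<tau>)) \<le> L" using BL weak_solD1[OF y] st by auto
      then have "norm ?v * norm (\<Psi> i (y \<tau>)) \<le> norm ?v * L" by (intro mult_left_mono) auto
      then show "- (norm ?v * L) \<le> ?v \<bullet> \<Psi> i (y \<tau>)"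
        using Cauchy_Schwarz_ineq2[of ?v "\<Psi> i (y \<tau>)"] by linarith
    qed
    also have "?v \<bullet> (y t - y s) = - (norm ?v * norm ?v)"
      by (metis inner_minus_right minus_diff_eq power2_eq_square power2_norm_eq_inner)
    finally have "norm ?v * norm ?v \<le> norm ?v * (L * (t - s))" by (simp add: algebra_simps)
    then have "norm ?v \<le> L * (t - s) \<or> norm ?v = 0" by (auto simp: mult_le_cancel_left)
    then show ?thesis using L st by (auto simp: norm_minus_commute)
  qed
  show thesis
  proof (rule that[OF L])
    fix y :: "real \<Rightarrow> 'a" and s t :: real
    assume "weak_sol Z N \<Psi> y" "0 \<le> s" "0 \<le> t"
    then show "norm (y t - y s) \<le> L * \<bar>t - s\<bar>"
      using main[of y s t] main[of y t s] by (cases "s \<le> t") (auto simp: norm_minus_commute)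
  qed
qed

section \<open>Compactness of the set of weak solutions\<close>

lemma equilipschitz_pointwise_imp_uniform:
  fixes f :: "nat \<Rightarrow> real \<Rightarrow> 'a::real_normed_vector"
  assumes "compact K" "0 \<le> L"
    and lip: "\<And>n s t. \<lbrakk>s \<in> K; t \<in> K\<rbrakk> \<Longrightarrow> norm (f n t - f n s) \<le> L * \<bar>t - s\<bar>"
    and lip': "\<And>s t. \<lbrakk>s \<in> K; t \<in> K\<rbrakk> \<Longrightarrow> norm (h t - h s) \<le> L * \<bar>t - s\<bar>"
    and lim: "\<And>t. t \<in> K \<Longrightarrow> (\<lambda>n. f n t) \<longlonglongrightarrow> h t" and "0 < e"
  shows "\<forall>\<^sub>F n in sequentially. \<forall>t\<in>K. norm (f n t - h t) < e"
proof -
  define d where "d = e / (3 * (L + 1))"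
  have d: "d > 0" "L * d \<le> e / 3" using assms by (auto simp: d_def field_simps)
  obtain F where F: "finite F" "F \<subseteq> K" "K \<subseteq> (\<Union>x\<in>F. ball x d)"
    using seq_compact_imp_totally_bounded[of K] d assms(1) by (auto simp: compact_eq_seq_compact_metric)
  have "\<forall>\<^sub>F n in sequentially. \<forall>t\<in>F. norm (f n t - h t) < e / 3"
  proof (intro eventually_ball_finite F(1) ballI)
    fix t assume "t \<in> F"
    then have "(\<lambda>n. f n t) \<longlonglongrightarrow> h t" using F lim by auto
    then show "\<forall>\<^sub>F n in sequentially. norm (f n t - h t) < e / 3"
      using \<open>0 < e\<close> tendstoD[of "\<lambda>n. f n t" "h t" sequentially "e/3"] by (simp add: dist_norm)
  qed
  then show ?thesis
  proof eventually_elim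
    case (elim n)
    show ?case
    proof
      fix t assume t: "t \<in> K"
      then obtain s where s: "s \<in> F" "\<bar>t - s\<bar> < d" using F(3) by (auto simp: dist_real_def abs_minus_commute)
      then have sK: "s \<in> K" using F by auto
      have "L * \<bar>t - s\<bar> \<le> L * d" using s \<open>0 \<le> L\<close> by (intro mult_left_mono) auto
      then have "norm (f n t - f n s) \<le> e/3" "norm (h t - h s) \<le> e/3" "norm (f n s - h s) < e/3"
        using lip[OF sK t, of n] lip'[OF sK t] d elim s by auto
      moreover have "f n t - h t = (f n t - f n s) + (f n s - h s) - (h t - h s)" by simp
      ultimately show "norm (f n t - h t) < e"
        using norm_triangle_ineq4[of "(f n t - f n s) + (f n s - h s)" "h t - h s"]
          norm_triangle_ineq[of "f n t - f n s" "f n s - h s"] by simp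
    qed
  qed
qed

text \<open>Convergence is uniform on the compact interval from \<open>s\<close> to
  \<open>t\<close>, and each \<open>\<Psi> i\<close> is uniformly continuous on \<open>Z\<close>.
  Hence a bound \<open>c\<close> along the limit holds with \<open>c - e\<close> along late members
  of the sequence, and the integrated inequality passes to the limit without any convergence of
  derivatives.\<close>

lemma weak_sol_limit:
  assumes Z: "compact Z" and \<Psi>: "\<And>i. i \<in> {1..N} \<Longrightarrow> continuous_on Z (\<Psi> i)"
    and Y: "\<And>n. weak_sol Z N \<Psi> (Y n)" and lim: "\<And>t. t \<ge> 0 \<Longrightarrow> (\<lambda>n. Y n t) \<longlonglongrightarrow> y t"
  shows "weak_sol Z N \<Psi> y"
proof -
  obtain L where L: "L > 0"
    "\<And>y s t. \<lbrakk>weak_sol Z N \<Psi> y; 0 \<le> s; 0 \<le> t\<rbrakk> \<Longrightarrow> norm (y t - y s) \<le> L * \<bar>t - s\<bar>"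
    using weak_sol_lipschitz[of Z N \<Psi>, OF Z \<Psi>] by blast
  have yZ: "y t \<in> Z" if "t \<ge> 0" for t
    by (rule closed_sequentially[OF compact_imp_closed[OF Z] _ lim[OF that]]) (use Y weak_solD1 that in blast)
  have lipy: "norm (y t - y s) \<le> L * \<bar>t - s\<bar>" if "0 \<le> s" "0 \<le> t" for s t
    by (rule Lim_norm_ubound[of sequentially "\<lambda>n. Y n t - Y n s"])
       (use that L Y lim in \<open>auto intro!: tendsto_diff\<close>)
  have "c * (t - s) \<le> v \<bullet> (y t - y s)"
    if st: "0 \<le> s" "s \<le> t" and c: "\<forall>\<tau>\<in>{s..t}. \<forall>i\<in>{1..N}. c \<le> v \<bullet> \<Psi> i (y \<tau>)" for v c s t
  proof (rule field_le_epsilon)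
    fix e0 :: real assume "e0 > 0"
    define e where "e = e0 / (t - s + 1)"
    have e: "e > 0" "e * (t - s) \<le> e0" using st \<open>e0 > 0\<close> by (auto simp: e_def field_simps)
    define e1 where "e1 = e / (norm v + 1)"
    have nv: "norm v + 1 > 0" by (simp add: add_nonneg_pos)
    have e1: "e1 > 0" "norm v * e1 \<le> e" using e nv by (auto simp: e1_def field_simps)
    have "\<exists>d>0. \<forall>z\<in>Z. \<forall>z'\<in>Z. dist z z' < d \<longrightarrow> norm (\<Psi> i z - \<Psi> i z') < e1" if "i \<in> {1..N}" for i
      using compact_uniformly_continuous[OF \<Psi>[OF that] Z] e1 unfolding uniformly_continuous_on_def dist_norm
      by (metis norm_minus_commute)
    then obtain d where d: "\<And>i. i \<in> {1..N} \<Longrightarrow> d i > 0"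
      "\<And>i z z'. \<lbrakk>i \<in> {1..N}; z \<in> Z; z' \<in> Z; dist z z' < d i\<rbrakk> \<Longrightarrow> norm (\<Psi> i z - \<Psi> i z') < e1"
      by metis
    define d' where "d' = Min (insert 1 (d ` {1..N}))"
    have d': "d' > 0" "\<And>i. i \<in> {1..N} \<Longrightarrow> d' \<le> d i" using d(1) by (auto simp: d'_def intro!: min.coboundedI2 Min_le)
    have "\<forall>\<^sub>F n in sequentially. \<forall>\<tau>\<in>{s..t}. norm (Y n \<tau> - y \<tau>) < d'"
      by (rule equilipschitz_pointwise_imp_uniform[of _ L])
         (use L(1) L(2)[OF Y] lipy lim st d' in auto)
    then have "\<forall>\<^sub>F n in sequentially. (c - e) * (t - s) \<le> v \<bullet> (Y n t - Y n s)"
    proof eventually_elim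
      case (elim n)
      show ?case
      proof (rule weak_solD2[OF Y st])
        fix \<tau> i assume \<tau>: "\<tau> \<in> {s..t}" and i: "i \<in> {1..N}"
        have "norm (\<Psi> i (Y n \<tau>) - \<Psi> i (y \<tau>)) < e1"
        proof (rule d(2)[OF i])
          show "dist (Y n \<tau>) (y \<tau>) < d i" using elim[rule_format, OF \<tau>] d'(2)[OF i] by (simp add: dist_norm)
        qed (use \<tau> st weak_solD1[OF Y] yZ in auto)
        then have "norm v * norm (\<Psi> i (Y n \<tau>) - \<Psi> i (y \<tau>)) \<le> e"
          using e1(2) by (meson less_imp_le mult_left_mono norm_ge_zero order.trans)
        then have "\<bar>v \<bullet> (\<Psi> i (Y n \<tau>) - \<Psi> i (y \<tau>))\<bar> \<le> e"
          using Cauchy_Schwarz_ineq2[of v "\<Psi> i (Y n \<tau>) - \<Psi> i (y \<tau>)"] by linarith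
        then show "c - e \<le> v \<bullet> \<Psi> i (Y n \<tau>)" using c[rule_format, OF \<tau> i] by (simp add: inner_diff_right)
      qed
    qed
    moreover have "(\<lambda>n. v \<bullet> (Y n t - Y n s)) \<longlonglongrightarrow> v \<bullet> (y t - y s)"
      using lim st by (intro tendsto_inner tendsto_diff tendsto_const) auto
    ultimately have "(c - e) * (t - s) \<le> v \<bullet> (y t - y s)" by (intro tendsto_lowerbound) auto
    then show "c * (t - s) \<le> v \<bullet> (y t - y s) + e0" using e(2) by (simp add: algebra_simps)
  qed
  then show ?thesis using yZ unfolding weak_sol_def by blast
qed

text \<open>Arzela-Ascoli on the half-line: a subsequence converges at all nonnegative rationals,
  and the common Lipschitz constant carries the Cauchy property to every time.\<close>

lemma weak_sol_compact:
  assumes Z: "compact Z" and \<Psi>: "\<And>i. i \<in> {1..N} \<Longrightarrow> continuous_on Z (\<Psi> i)"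
    and Y: "\<And>n. weak_sol Z N \<Psi> (Y n)"
  obtains k y where "strict_mono (k :: nat \<Rightarrow> nat)" "weak_sol Z N \<Psi> y"
    "\<And>t. t \<ge> 0 \<Longrightarrow> (\<lambda>n. Y (k n) t) \<longlonglongrightarrow> y t"
proof -
  obtain L where L: "L > 0"
    "\<And>y s t. \<lbrakk>weak_sol Z N \<Psi> y; 0 \<le> s; 0 \<le> t\<rbrakk> \<Longrightarrow> norm (y t - y s) \<le> L * \<bar>t - s\<bar>"
    using weak_sol_lipschitz[of Z N \<Psi>, OF Z \<Psi>] by blast
  obtain B where B: "\<And>z. z \<in> Z \<Longrightarrow> norm z \<le> B" using compact_imp_bounded[OF Z] by (auto simp: bounded_iff)
  obtain k where k: "strict_mono (k :: nat \<Rightarrow> nat)" "\<And>q. q \<in> \<rat> \<inter> {0..} \<Longrightarrow> \<exists>l. (\<lambda>n. Y (k n) q) \<longlonglongrightarrow> l"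
  proof (rule function_convergent_subsequence[of "\<rat> \<inter> {0..}" Y B])
    show "countable (\<rat> \<inter> {0..} :: real set)" using countable_rat by blast
  qed (use B weak_solD1[OF Y] in auto)
  have "convergent (\<lambda>n. Y (k n) t)" if t: "t \<ge> 0" for t
  proof -
    have "Cauchy (\<lambda>n. Y (k n) t)"
    proof (rule metric_CauchyI)
      fix e :: real assume "e > 0"
      obtain q where q: "q \<in> \<rat>" "t < q" "q < t + e / (3 * L)"
        using Rats_dense_in_real[of t "t + e / (3 * L)"] \<open>e > 0\<close> L by auto
      have "Cauchy (\<lambda>n. Y (k n) q)" using k(2)[of q] q t by (auto intro: LIMSEQ_imp_Cauchy)
      then obtain M where M: "\<And>m n. m \<ge> M \<Longrightarrow> n \<ge> M \<Longrightarrow> dist (Y (k m) q) (Y (k n) q) < e/3"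
        using \<open>e > 0\<close> unfolding Cauchy_def by (metis divide_pos_pos zero_less_numeral)
      have "dist (Y (k n) t) (Y (k n) q) < e/3" for n
      proof -
        have "norm (Y (k n) t - Y (k n) q) \<le> L * \<bar>t - q\<bar>" by (rule L(2)[OF Y]) (use t q in auto)
        also have "\<dots> < L * (e / (3 * L))" using q L by (intro mult_strict_left_mono) auto
        finally show ?thesis using L by (simp add: dist_norm)
      qed
      then show "\<exists>M. \<forall>m\<ge>M. \<forall>n\<ge>M. dist (Y (k m) t) (Y (k n) t) < e"
        using M dist_triangle_third by (metis dist_commute)
    qed
    then show ?thesis by (simp add: Cauchy_convergent_iff)
  qed
  then obtain y where y: "\<And>t. t \<ge> 0 \<Longrightarrow> (\<lambda>n. Y (k n) t) \<longlonglongrightarrow> y t"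
    unfolding convergent_def by metis
  show thesis
    by (rule that[OF k(1) weak_sol_limit[of Z N \<Psi>, OF Z \<Psi> Y y] y]) auto
qed

section \<open>Omega-limit sets and repetition of loops\<close>

lemma closed_omega_limit: "closed (omega_limit x)"
  by (auto simp: omega_limit_def)

lemma omega_limit_subset:
  assumes "closed C" "\<And>t. t \<ge> 0 \<Longrightarrow> y t \<in> C"
  shows "omega_limit y \<subseteq> C"
proof -
  have "closure (y ` {0..}) \<subseteq> C" using assms by (intro closure_minimal) auto
  then show ?thesis by (auto simp: omega_limit_def)
qed

lemma omega_limit_recurrent:
  assumes "q \<in> omega_limit y" "\<delta> > 0"
  obtains t where "t \<ge> T" "t \<ge> 0" "dist (y t) q < \<delta>"
proof -
  have "q \<in> closure (y ` {max 0 T..})" using assms(1) by (auto simp: omega_limit_def)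
  then obtain t where "t \<ge> max 0 T" "dist (y t) q < \<delta>" using assms(2) by (auto simp: closure_approachable)
  then show thesis using that by auto
qed

text \<open>Time shifts of \<open>x\<close> are again weak solutions, and a limit of them as the
  shift tends to infinity consists of limit points of \<open>x\<close>. This replaces the invariance
  of omega-limit sets under a flow: at least one solution stays in the set, while others starting
  there may leave it.\<close>

lemma weak_sol_in_omega_limit:
  assumes Z: "compact Z" and \<Psi>: "\<And>i. i \<in> {1..N} \<Longrightarrow> continuous_on Z (\<Psi> i)"
    and x: "weak_sol Z N \<Psi> x"
  obtains y where "weak_sol Z N \<Psi> y" "\<And>t. t \<ge> 0 \<Longrightarrow> y t \<in> omega_limit x"
proof -
  obtain k y where k: "strict_mono (k :: nat \<Rightarrow> nat)" and y: "weak_sol Z N \<Psi> y"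
    "\<And>t. t \<ge> 0 \<Longrightarrow> (\<lambda>n. x (real (k n) + t)) \<longlonglongrightarrow> y t"
    using weak_sol_compact[of Z N \<Psi>, OF Z \<Psi>, of "\<lambda>n t. x (real n + t)"] weak_sol_shift[OF x] by auto
  have "y t \<in> omega_limit x" if t: "t \<ge> 0" for t
    unfolding omega_limit_def
  proof
    fix T :: real
    obtain m :: nat where m: "T \<le> real m" using real_arch_simple by blast
    have "\<forall>\<^sub>F n in sequentially. x (real (k n) + t) \<in> closure (x ` {T..})"
    proof (rule eventually_sequentiallyI[of m])
      fix n assume "m \<le> n"
      also have "n \<le> k n" using k by (rule strict_mono_imp_increasing)
      finally have "T \<le> real (k n) + t" using m t by linarith
      then show "x (real (k n) + t) \<in> closure (x ` {T..})" by (intro subsetD[OF closure_subset]) auto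
    qed
    then show "y t \<in> closure (x ` {T..})" by (rule Lim_in_closed_set[rotated]) (use y(2)[OF t] in auto)
  qed
  then show thesis using that y by blast
qed

text \<open>A piece that returns to its starting point can be repeated because the half-space
  inequalities on adjacent intervals add up. Velocities on the two sides of a junction do not have
  to match.\<close>

lemma weak_sol_periodic_extension:
  assumes y: "weak_sol Z N \<Psi> y" and st: "0 \<le> s" "s < t" "y s = y t"
  obtains E p where "p > 0" "weak_sol Z N \<Psi> E" "\<And>\<tau>. \<tau> \<ge> 0 \<Longrightarrow> E (\<tau> + p) = E \<tau>" "E ` {0..} \<subseteq> y ` {0..}"
proof -
  define p where "p = t - s"
  have p: "p > 0" using st by (simp add: p_def)
  define E where "E \<tau> = y (s + (\<tau> - p * \<lfloor>\<tau> / p\<rfloor>))" for \<tau>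
  have fl: "0 \<le> \<tau> - p * \<lfloor>\<tau> / p\<rfloor>" for \<tau>
    using mult_left_mono[OF of_int_floor_le[of "\<tau> / p"], of p] p by simp
  have per: "E (\<tau> + p) = E \<tau>" for \<tau>
  proof -
    have "(\<tau> + p) / p = \<tau> / p + 1" using p by (simp add: field_simps)
    then have "\<lfloor>(\<tau> + p) / p\<rfloor> = \<lfloor>\<tau> / p\<rfloor> + 1" by simp
    then show ?thesis by (simp add: E_def algebra_simps)
  qed
  \<comment> \<open>The right end \<open>\<tau> = p\<close> is included thanks to
    \<open>y s = y t\<close>, so that the junction belongs to both adjacent pieces.\<close>
  have base: "E \<tau> = y (s + \<tau>)" if "0 \<le> \<tau>" "\<tau> \<le> p" for \<tau>
  proof (cases "\<tau> = p")
    case True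
    then show ?thesis using p st by (simp add: E_def p_def)
  next
    case False
    then have "\<lfloor>\<tau> / p\<rfloor> = 0" using that p by (intro floor_unique) (auto simp: field_simps)
    then show ?thesis by (simp add: E_def)
  qed
  \<comment> \<open>Induction on the number of periods needed to reach \<open>b\<close>: an interval
    is cut at \<open>p\<close>, its left part lies on the original solution, and its right part is
    shifted back by one period.\<close>
  have main: "0 \<le> a \<Longrightarrow> a \<le> b \<Longrightarrow> b \<le> real n * p \<Longrightarrow> (\<forall>\<tau>\<in>{a..b}. \<forall>i\<in>{1..N}. c \<le> v \<bullet> \<Psi> i (E \<tau>))
     \<Longrightarrow> c * (b - a) \<le> v \<bullet> (E b - E a)" for n a b c v
  proof (induction n arbitrary: a b)
    case 0
    then have "a = b" by simp
    then show ?case by simp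
  next
    case (Suc n)
    have left: "c * (b - a) \<le> v \<bullet> (E b - E a)"
      if "0 \<le> a" "a \<le> b" "b \<le> p" and c: "\<forall>\<tau>\<in>{a..b}. \<forall>i\<in>{1..N}. c \<le> v \<bullet> \<Psi> i (E \<tau>)" for a b
    proof -
      have "c * (b - a) \<le> v \<bullet> (y (s + b) - y (s + a))"
        by (rule weak_solD2[OF weak_sol_shift[OF y st(1)]]) (use that base in auto)
      then show ?thesis using base[of a] base[of b] that by simp
    qed
    have right: "c * (b - a) \<le> v \<bullet> (E b - E a)"
      if "p \<le> a" "a \<le> b" "b \<le> real (Suc n) * p" and c: "\<forall>\<tau>\<in>{a..b}. \<forall>i\<in>{1..N}. c \<le> v \<bullet> \<Psi> i (E \<tau>)" for a b
    proof -
      have "c * ((b - p) - (a - p)) \<le> v \<bullet> (E (b - p) - E (a - p))"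
      proof (rule Suc.IH)
        show "\<forall>\<tau>\<in>{a - p..b - p}. \<forall>i\<in>{1..N}. c \<le> v \<bullet> \<Psi> i (E \<tau>)"
        proof (intro ballI)
          fix \<tau> i assume "\<tau> \<in> {a - p..b - p}" "i \<in> {1..N}"
          then show "c \<le> v \<bullet> \<Psi> i (E \<tau>)" using c[rule_format, of "\<tau> + p" i] per[of \<tau>] by auto
        qed
      qed (use that in \<open>auto simp: algebra_simps\<close>)
      then show ?thesis using per[of "b - p"] per[of "a - p"] by simp
    qed
    consider "b \<le> p" | "p \<le> a" | "a < p" "p < b" by linarith
    then show ?case
    proof cases
      case 3
      have "c * (p - a) \<le> v \<bullet> (E p - E a)" using Suc.prems 3 by (intro left) auto
      moreover have "c * (b - p) \<le> v \<bullet> (E b - E p)" using Suc.prems 3 by (intro right) auto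
      ultimately show ?thesis by (simp add: algebra_simps)
    qed (use left right Suc.prems in auto)
  qed
  have "weak_sol Z N \<Psi> E"
    unfolding weak_sol_def
  proof (intro conjI allI impI; (elim conjE)?)
    fix \<tau> :: real assume "\<tau> \<ge> 0"
    then show "E \<tau> \<in> Z" unfolding E_def using fl[of \<tau>] st by (intro weak_solD1[OF y]) auto
  next
    fix v c a b assume "0 \<le> a" "a \<le> b" "\<forall>\<tau>\<in>{a..b}. \<forall>i\<in>{1..N}. c \<le> v \<bullet> \<Psi> i (E \<tau>)"
    moreover obtain n :: nat where "b / p \<le> real n" using real_arch_simple by blast
    ultimately show "c * (b - a) \<le> v \<bullet> (E b - E a)" using p by (intro main[of _ _ n]) (auto simp: field_simps)
  qed
  moreover have "E ` {0..} \<subseteq> y ` {0..}" using fl st by (force simp: E_def)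
  ultimately show thesis using that[of p E] p per by blast
qed

section \<open>Differentiability of Lipschitz functions almost everywhere\<close>

text \<open>Vitali's theorem selects countably many disjoint intervals of slope at most
  \<open>p\<close> that cover \<open>S\<close> up to a null set and stay in an open set barely
  larger than \<open>S\<close>. Their images have total length at most \<open>p\<close> times
  theirs, and the Lipschitz bound keeps the image of the leftover null set null.\<close>

lemma emeasure_image_le_of_small_quotients:
  fixes g :: "real \<Rightarrow> real"
  assumes mono: "strict_mono g"
    and lip: "\<And>u w. u \<le> w \<Longrightarrow> g w - g u \<le> K * (w - u)"
    and S: "S \<in> sets lebesgue" and "0 \<le> p"
    and small: "\<And>x d. \<lbrakk>x \<in> S; 0 < d\<rbrakk> \<Longrightarrow>
       \<exists>u w. u \<le> x \<and> x \<le> w \<and> u < w \<and> w - u < d \<and> g w - g u \<le> p * (w - u)"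
  shows "emeasure lebesgue (g ` S) \<le> ennreal p * emeasure lebesgue S"
proof -
  have lipn: "norm (g y - g x) \<le> \<bar>K\<bar> * norm (y - x)" for x y
  proof -
    have *: "norm (g y - g x) \<le> \<bar>K\<bar> * norm (y - x)" if "x \<le> y" for x y
    proof -
      have "norm (g y - g x) = g y - g x" using strict_mono_leD[OF mono that] by simp
      also have "\<dots> \<le> K * (y - x)" by (rule lip[OF that])
      also have "\<dots> \<le> \<bar>K\<bar> * (y - x)" using that by (intro mult_right_mono) auto
      finally show ?thesis using that by simp
    qed
    show ?thesis using *[of x y] *[of y x] by (cases "x \<le> y") (auto simp: norm_minus_commute)
  qed
  have contg: "continuous_on UNIV g"
    by (rule lipschitz_on_continuous_on[of "\<bar>K\<bar>"], rule lipschitz_onI) (use lipn in \<open>auto simp: dist_norm\<close>)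
  have bound: "emeasure lebesgue (g ` S) \<le> ennreal p * (emeasure lebesgue S + ennreal e)" if e: "e > 0" for e
  proof -
    obtain U where U: "open U" "S \<subseteq> U" "U - S \<in> lmeasurable" "emeasure lebesgue (U - S) < ennreal e"
      using sets_lebesgue_outer_open[OF S e] by blast
    \<comment> \<open>An index is a pair of centre and radius, the form in which the covering
      theorem takes closed intervals.\<close>
    define I where "I = {i::real \<times> real. 0 < snd i \<and> cball (fst i) (snd i) \<subseteq> U \<and>
        g (fst i + snd i) - g (fst i - snd i) \<le> p * (2 * snd i)}"
    obtain C where C: "countable C" "C \<subseteq> I"
      "pairwise (\<lambda>i j. disjnt (cball (fst i) (snd i)) (cball (fst j) (snd j))) C"
      "negligible (S - (\<Union>i\<in>C. cball (fst i) (snd i)))"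
    proof (rule Vitali_covering_theorem_cballs[of I snd S fst])
      fix x d :: real assume x: "x \<in> S" and d: "0 < d"
      obtain r where r: "r > 0" "ball x r \<subseteq> U" using U(1,2) x by (meson open_contains_ball subsetD)
      obtain u w where uw: "u \<le> x" "x \<le> w" "u < w" "w - u < min d r" "g w - g u \<le> p * (w - u)"
        using small[OF x, of "min d r"] r d by auto
      let ?i = "((u + w)/2, (w - u)/2)"
      have cb: "cball (fst ?i) (snd ?i) = {u..w}" by (simp add: cball_eq_atLeastAtMost field_simps)
      have 1: "fst ?i - snd ?i = u" "fst ?i + snd ?i = w" by (auto simp: field_simps)
      have "{u..w} \<subseteq> ball x r" using uw by (auto simp: dist_real_def)
      then have "cball (fst ?i) (snd ?i) \<subseteq> U" using r cb by blast
      moreover have "0 < snd ?i" "2 * snd ?i = w - u" using uw by auto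
      ultimately have "?i \<in> I" using uw(5) unfolding I_def mem_Collect_eq 1 by metis
      moreover have "x \<in> cball (fst ?i) (snd ?i)" unfolding cb using uw by simp
      moreover have "snd ?i < d" using uw by simp
      ultimately show "\<exists>i. i \<in> I \<and> x \<in> cball (fst i) (snd i) \<and> snd i < d" by blast
    qed (auto simp: I_def)
    let ?B = "\<lambda>i::real\<times>real. cball (fst i) (snd i)"
    have BI: "?B i = {fst i - snd i..fst i + snd i}" for i by (simp add: cball_eq_atLeastAtMost)
    have gB: "emeasure lebesgue (g ` ?B i) \<le> ennreal p * emeasure lebesgue (?B i)" if "i \<in> C" for i
    proof -
      have i: "0 < snd i" "g (fst i + snd i) - g (fst i - snd i) \<le> p * (2 * snd i)"
        using that C(2) by (auto simp: I_def)
      have "g ` ?B i \<subseteq> {g (fst i - snd i)..g (fst i + snd i)}"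
        unfolding BI using strict_mono_leD[OF mono] by auto
      then have "emeasure lebesgue (g ` ?B i) \<le> emeasure lebesgue {g (fst i - snd i)..g (fst i + snd i)}"
        by (intro emeasure_mono) auto
      also have "\<dots> = ennreal (g (fst i + snd i) - g (fst i - snd i))"
        using i strict_mono_leD[OF mono] by simp
      also have "\<dots> \<le> ennreal (p * (2 * snd i))" by (rule ennreal_leI) (rule i(2))
      also have "\<dots> = ennreal p * emeasure lebesgue (?B i)"
        using i(1) \<open>0 \<le> p\<close> unfolding BI by (simp add: ennreal_mult)
      finally show ?thesis .
    qed
    have disjB: "disjoint_family_on ?B C"
      using C(3) by (auto simp: disjoint_family_on_def pairwise_def disjnt_def)
    have "inj g" using mono by (simp add: strict_mono_imp_inj_on)
    then have disjg: "disjoint_family_on (\<lambda>i. g ` ?B i) C"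
      using disjB unfolding disjoint_family_on_def by (metis image_Int image_empty)
    have meas: "g ` ?B i \<in> sets lebesgue" for i
      by (intro lmeasurable_compact fmeasurableD compact_continuous_image continuous_on_subset[OF contg]) auto
    have "negligible (g ` (S - (\<Union>i\<in>C. ?B i)))"
      by (rule negligible_locally_Lipschitz_image[OF _ C(4)]) (use lipn in \<open>auto intro!: exI[of _ UNIV] exI[of _ "\<bar>K\<bar>"]\<close>)
    then have null: "g ` (S - (\<Union>i\<in>C. ?B i)) \<in> null_sets lebesgue" by (simp add: negligible_iff_null_sets)
    have "g ` S \<subseteq> g ` (S - (\<Union>i\<in>C. ?B i)) \<union> (\<Union>i\<in>C. g ` ?B i)" by blast
    moreover have mU: "(\<Union>i\<in>C. g ` ?B i) \<in> sets lebesgue" using meas C(1) by (intro sets.countable_UN') auto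
    ultimately have "emeasure lebesgue (g ` S) \<le> emeasure lebesgue (g ` (S - (\<Union>i\<in>C. ?B i)) \<union> (\<Union>i\<in>C. g ` ?B i))"
      using null by (intro emeasure_mono) auto
    also have "\<dots> = emeasure lebesgue (\<Union>i\<in>C. g ` ?B i)"
      using null mU by (simp add: emeasure_Un_null_set Un_commute)
    also have "\<dots> = (\<integral>\<^sup>+i. emeasure lebesgue (g ` ?B i) \<partial>count_space C)"
      by (rule emeasure_UN_countable) (use meas C(1) disjg in auto)
    also have "\<dots> \<le> (\<integral>\<^sup>+i. ennreal p * emeasure lebesgue (?B i) \<partial>count_space C)"
      by (rule nn_integral_mono) (use gB in auto)
    also have "\<dots> = ennreal p * (\<integral>\<^sup>+i. emeasure lebesgue (?B i) \<partial>count_space C)"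
      by (rule nn_integral_cmult) auto
    also have "(\<integral>\<^sup>+i. emeasure lebesgue (?B i) \<partial>count_space C) = emeasure lebesgue (\<Union>i\<in>C. ?B i)"
      by (rule emeasure_UN_countable[symmetric]) (use C(1) disjB in auto)
    also have "\<dots> \<le> emeasure lebesgue U"
      by (rule emeasure_mono) (use C(2) U(1) in \<open>auto simp: I_def\<close>)
    also have "\<dots> \<le> emeasure lebesgue S + emeasure lebesgue (U - S)"
      using U S by (metis Diff_partition emeasure_subadditive fmeasurableD)
    also have "\<dots> \<le> emeasure lebesgue S + ennreal e" using U(4) by (intro add_left_mono) auto
    finally show ?thesis by (simp add: mult_left_mono)
  qed
  show ?thesis
  proof (rule ennreal_le_epsilon)
    fix e :: real assume "e > 0"
    then have e': "e / (p + 1) > 0" using \<open>0 \<le> p\<close> by simp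
    have "emeasure lebesgue (g ` S) \<le> ennreal p * emeasure lebesgue S + ennreal p * ennreal (e / (p + 1))"
      using bound[OF e'] by (simp add: distrib_left)
    also have "ennreal p * ennreal (e / (p + 1)) = ennreal (p * (e / (p + 1)))"
      using \<open>0 \<le> p\<close> e' by (intro ennreal_mult[symmetric]) auto
    also have "\<dots> \<le> ennreal e"
      using \<open>0 \<le> p\<close> \<open>e > 0\<close> by (intro ennreal_leI) (simp add: field_simps)
    finally show "emeasure lebesgue (g ` S) \<le> ennreal p * emeasure lebesgue S + ennreal e"
      by (simp add: add_left_mono)
  qed
qed

text \<open>The intervals only have to contain \<open>x\<close>, possibly as an end point. This
  includes the one-sided quotients at \<open>x\<close> and still lets intervals be enlarged, which
  is what makes the set Borel.\<close>

definition short_quotient :: "(real \<Rightarrow> real) \<Rightarrow> real set \<Rightarrow> real \<Rightarrow> bool" where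
  "short_quotient g P x \<longleftrightarrow> (\<forall>d>0. \<exists>u w. u \<le> x \<and> x \<le> w \<and> u < w \<and> w - u < d \<and> (g w - g u) / (w - u) \<in> P)"

text \<open>The set is a countable intersection of unions of open intervals. That closed intervals
  may be traded for open ones rests on the continuity of \<open>g\<close> and the openness of
  \<open>P\<close>.\<close>

lemma short_quotient_borel:
  assumes cont: "continuous_on UNIV g" and P: "open P"
  shows "{x. short_quotient g P x} \<in> sets borel"
proof -
  let ?V = "\<lambda>n::nat. \<Union>{{u<..<w} |u w. u < w \<and> w - u < 1 / Suc n \<and> (g w - g u) / (w - u) \<in> P}"
  have "{x. short_quotient g P x} = (\<Inter>n. ?V n)"
  proof (intro set_eqI iffI)
    fix x assume x: "x \<in> {x. short_quotient g P x}"
    show "x \<in> (\<Inter>n. ?V n)"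
    proof
      fix n
      have "1 / real (Suc n) > 0" by simp
      then obtain u w where uw: "u \<le> x" "x \<le> w" "u < w" "w - u < 1 / Suc n" "(g w - g u) / (w - u) \<in> P"
        using x unfolding short_quotient_def by blast
      \<comment> \<open>Enlarging the interval by \<open>s\<close> on both sides makes
        \<open>x\<close> an interior point; for small \<open>s\<close> the quotient stays in
        \<open>P\<close> and the length stays below the bound.\<close>
      define \<phi> where "\<phi> s = (g (w + s) - g (u - s)) / ((w + s) - (u - s))" for s
      have "\<forall>\<^sub>F s in at_right 0. \<phi> s \<in> P"
      proof (rule topological_tendstoD[OF _ P])
        have "((\<lambda>s. g (w + s)) \<longlongrightarrow> g (w + 0)) (at_right 0)"
          by (rule continuous_on_tendsto_compose[OF cont tendsto_add[OF tendsto_const tendsto_ident_at]]) auto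
        moreover have "((\<lambda>s. g (u - s)) \<longlongrightarrow> g (u - 0)) (at_right 0)"
          by (rule continuous_on_tendsto_compose[OF cont tendsto_diff[OF tendsto_const tendsto_ident_at]]) auto
        ultimately have "(\<phi> \<longlongrightarrow> (g (w + 0) - g (u - 0)) / ((w + 0) - (u - 0))) (at_right 0)"
          unfolding \<phi>_def by (intro tendsto_intros) (use uw in auto)
        then show "(\<phi> \<longlongrightarrow> (g w - g u) / (w - u)) (at_right 0)" by simp
      qed (use uw in auto)
      moreover have "\<forall>\<^sub>F s in at_right (0::real). s < (1 / Suc n - (w - u)) / 2"
        by (rule eventually_at_rightI[of 0 "(1 / Suc n - (w - u)) / 2"]) (use uw in auto)
      moreover have "\<forall>\<^sub>F s in at_right (0::real). s > 0" by (simp add: eventually_at_right_less)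
      ultimately have "\<forall>\<^sub>F s in at_right 0. \<phi> s \<in> P \<and> s < (1 / Suc n - (w - u)) / 2 \<and> s > 0"
        by eventually_elim auto
      then obtain s where s: "\<phi> s \<in> P" "s < (1 / Suc n - (w - u)) / 2" "s > 0"
        using eventually_happens[of _ "at_right (0::real)"] by (auto simp: trivial_limit_at_right_real)
      then have "x \<in> {u - s<..<w + s}" "(w + s) - (u - s) < 1 / Suc n" "u - s < w + s" using uw by (auto simp: field_simps)
      then show "x \<in> ?V n" using s(1) unfolding \<phi>_def by blast
    qed
  next
    fix x assume x: "x \<in> (\<Inter>n. ?V n)"
    have "short_quotient g P x" unfolding short_quotient_def
    proof (intro allI impI)
      fix d :: real assume "d > 0"
      then obtain n where n: "1 / real (Suc n) < d" using nat_approx_posE by metis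
      have "x \<in> ?V n" using x by blast
      then obtain u w where "x \<in> {u<..<w}" "u < w" "w - u < 1 / Suc n" "(g w - g u) / (w - u) \<in> P"
        by blast
      then show "\<exists>u w. u \<le> x \<and> x \<le> w \<and> u < w \<and> w - u < d \<and> (g w - g u) / (w - u) \<in> P"
        using n by (intro exI[of _ u] exI[of _ w]) auto
    qed
    then show "x \<in> {x. short_quotient g P x}" by simp
  qed
  moreover have "open (?V n)" for n by (rule open_Union) auto
  ultimately show ?thesis by auto
qed

text \<open>Adding a linear function makes \<open>f\<close> an increasing bi-Lipschitz map \<open>g\<close>. On the set \<open>E\<close> of points that
  have difference quotients below \<open>p\<close> and above \<open>q\<close> at all small scales, the covering bound for \<open>g\<close> and
  for its inverse gives \<open>q |E| \<le> |g(E)| \<le> p |E|\<close>.\<close>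
lemma lipschitz_AE_differentiable:
  fixes f :: "real \<Rightarrow> real"
  assumes lipf: "\<And>s t. \<bar>f t - f s\<bar> \<le> L * \<bar>t - s\<bar>"
  shows "AE t in lebesgue. f differentiable (at t)"
proof -
  have "0 \<le> \<bar>f 1 - f 0\<bar>" by simp
  also have "\<dots> \<le> L * \<bar>1 - 0\<bar>" by (rule lipf)
  finally have L: "L \<ge> 0" by simp
  define g where "g t = f t + (L + 1) * t" for t
  have g_lo: "w - u \<le> g w - g u" and g_up: "g w - g u \<le> (2 * L + 1) * (w - u)" if "u \<le> w" for u w
    using lipf[of w u] that by (auto simp: g_def abs_le_iff algebra_simps)
  have sm: "strict_mono g"
  proof (rule strict_monoI)
    fix x y :: real assume "x < y"
    then show "g x < g y" using g_lo[of x y] by simp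
  qed
  have injg: "inj g" using sm by (simp add: strict_mono_imp_inj_on)
  have contf: "continuous_on UNIV f"
    by (rule lipschitz_on_continuous_on[of L], rule lipschitz_onI) (use lipf L in \<open>auto simp: dist_real_def\<close>)
  then have contg: "continuous_on UNIV g" unfolding g_def by (intro continuous_intros)
  have surjg: "surj g"
  proof -
    have "\<exists>x. g x = y" for y
    proof -
      let ?M = "\<bar>y - g 0\<bar>"
      have "g (- ?M) \<le> y" using g_lo[of "- ?M" 0] by auto
      moreover have "y \<le> g ?M" using g_lo[of 0 ?M] by auto
      ultimately show ?thesis
        using IVT'[of g "- ?M" y ?M] continuous_on_subset[OF contg] by auto
    qed
    then show ?thesis by (metis surjI)
  qed
  define h where "h = inv g"
  have hg: "h (g x) = x" and gh: "g (h y) = y" for x y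
    using injg surjg by (simp_all add: h_def surj_f_inv_f)
  have h_up: "h w - h u \<le> 1 * (w - u)" if "u \<le> w" for u w
  proof -
    have "h u \<le> h w" using strict_mono_less_eq[OF sm, of "h u" "h w"] gh that by simp
    then show ?thesis using g_lo[of "h u" "h w"] gh by simp
  qed
  have smh: "strict_mono h"
    by (rule strict_monoI) (metis gh sm strict_mono_less)
  have conth: "continuous_on UNIV h"
    by (rule lipschitz_on_continuous_on[of 1], rule lipschitz_onI)
       (use h_up smh in \<open>force simp: dist_real_def abs_if strict_mono_less dest: strict_mono_leD\<close>)+
  let ?A = "\<lambda>p. {x. short_quotient g {..<p} x}" and ?B = "\<lambda>q. {x. short_quotient g {q<..} x}"
  have null: "?A p \<inter> ?B q \<in> null_sets lebesgue" if pq: "0 < p" "p < q" for p q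
  proof -
    have b: "?A p \<inter> ?B q \<in> sets borel" using short_quotient_borel[OF contg] by auto
    \<comment> \<open>The cut-off makes the measure finite, so that being at most
      \<open>p / q < 1\<close> times itself forces it to vanish.\<close>
    have "emeasure lebesgue (?A p \<inter> ?B q \<inter> {-r..r}) = 0" for r
    proof -
      let ?S = "?A p \<inter> ?B q \<inter> {-r..r}"
      have Sb: "?S \<in> sets borel" using b by auto
      then have Sm: "?S \<in> sets lebesgue" by auto
      have gS: "g ` ?S = h -` ?S \<inter> space borel"
      proof (intro set_eqI iffI)
        fix y assume "y \<in> h -` ?S \<inter> space borel"
        then have "h y \<in> ?S" by blast
        then show "y \<in> g ` ?S" using gh[of y] by (metis image_eqI)
      qed (use hg in auto)
      have "h \<in> borel_measurable borel" using conth by (simp add: borel_measurable_continuous_onI)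
      then have "g ` ?S \<in> sets borel" using Sb unfolding gS by (rule measurable_sets)
      then have gSm: "g ` ?S \<in> sets lebesgue" by auto
      have 1: "emeasure lebesgue (g ` ?S) \<le> ennreal p * emeasure lebesgue ?S"
      proof (rule emeasure_image_le_of_small_quotients[OF sm g_up Sm])
        fix x d :: real assume "x \<in> ?S" "0 < d"
        then obtain u w where "u \<le> x" "x \<le> w" "u < w" "w - u < d" "(g w - g u) / (w - u) < p"
          unfolding short_quotient_def by auto
        then show "\<exists>u w. u \<le> x \<and> x \<le> w \<and> u < w \<and> w - u < d \<and> g w - g u \<le> p * (w - u)"
          by (intro exI[of _ u] exI[of _ w]) (auto simp: field_simps)
      qed (use pq in auto)
      \<comment> \<open>A quotient of \<open>g\<close> above \<open>q\<close> between
        \<open>u\<close> and \<open>w\<close> is a quotient of \<open>h\<close> below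
        \<open>1 / q\<close> between \<open>g u\<close> and \<open>g w\<close>; dividing
        \<open>d\<close> by \<open>2 * L + 1\<close> keeps this image interval shorter than
        \<open>d\<close>.\<close>
      have "emeasure lebesgue (h ` g ` ?S) \<le> ennreal (1 / q) * emeasure lebesgue (g ` ?S)"
      proof (rule emeasure_image_le_of_small_quotients[OF smh h_up gSm])
        fix y d :: real assume "y \<in> g ` ?S" "0 < d"
        then obtain x where x: "x \<in> ?B q" "y = g x" by blast
        have K: "2 * L + 1 > 0" using L by simp
        then have "d / (2 * L + 1) > 0" using \<open>0 < d\<close> by simp
        then obtain u w where uw: "u \<le> x" "x \<le> w" "u < w" "w - u < d / (2 * L + 1)" "(g w - g u) / (w - u) > q"
          using x(1) unfolding short_quotient_def by auto
        have "g w - g u < d" using g_up[of u w] uw K by (auto simp: field_simps)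
        moreover have "w - u \<le> (1 / q) * (g w - g u)" using uw pq by (auto simp: field_simps)
        ultimately show "\<exists>u w. u \<le> y \<and> y \<le> w \<and> u < w \<and> w - u < d \<and> h w - h u \<le> (1 / q) * (w - u)"
          using uw x(2) hg strict_mono_leD[OF sm] strict_monoD[OF sm]
          by (intro exI[of _ "g u"] exI[of _ "g w"]) auto
      qed (use pq in auto)
      also have "h ` g ` ?S = ?S" using hg by (simp add: image_image)
      also have "ennreal (1 / q) * emeasure lebesgue (g ` ?S) \<le> ennreal (1 / q) * (ennreal p * emeasure lebesgue ?S)"
        using 1 by (intro mult_left_mono) auto
      also have "\<dots> = ennreal (p / q) * emeasure lebesgue ?S"
        using pq by (simp add: mult.assoc[symmetric] ennreal_mult[symmetric])
      finally have le: "emeasure lebesgue ?S \<le> ennreal (p / q) * emeasure lebesgue ?S" .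
      have "emeasure lebesgue ?S \<le> emeasure lebesgue {-r..r}" by (rule emeasure_mono) auto
      also have "\<dots> < \<infinity>" by (cases "r \<ge> 0") auto
      finally obtain c where c: "c \<ge> 0" "emeasure lebesgue ?S = ennreal c"
        by (metis ennreal_cases infinity_ennreal_def less_irrefl)
      then have "c \<le> (p / q) * c" using le pq by (simp add: ennreal_mult[symmetric] ennreal_le_iff)
      moreover have "p / q < 1" using pq by simp
      ultimately have "c = 0" using c(1) by (metis mult_less_cancel_right2 not_le order_le_less)
      then show ?thesis using c by simp
    qed
    then have "?A p \<inter> ?B q \<inter> {- real n..real n} \<in> null_sets lebesgue" for n
      using b by (intro null_setsI) auto
    then have "(\<Union>n. ?A p \<inter> ?B q \<inter> {- real n..real n}) \<in> null_sets lebesgue" by (intro null_sets_UN) auto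
    moreover have "(\<Union>n. ?A p \<inter> ?B q \<inter> {- real n..real n}) = ?A p \<inter> ?B q"
    proof -
      have "\<exists>n::nat. x \<in> {- real n..real n}" for x
      proof -
        obtain n :: nat where "\<bar>x\<bar> \<le> real n" using real_arch_simple by blast
        then have "x \<in> {- real n..real n}" by auto
        then show ?thesis by blast
      qed
      then show ?thesis by blast
    qed
    ultimately show ?thesis by simp
  qed
  have "AE t in lebesgue. \<forall>p\<in>\<rat>. \<forall>q\<in>\<rat>. 0 < p \<and> p < q \<longrightarrow> t \<notin> ?A p \<inter> ?B q"
  proof (intro AE_ball_countable[THEN iffD2] countable_rat ballI)
    fix p q :: real
    show "AE t in lebesgue. 0 < p \<and> p < q \<longrightarrow> t \<notin> ?A p \<inter> ?B q"
      using AE_not_in[OF null, of p q] by (cases "0 < p \<and> p < q") auto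
  qed
  then show ?thesis
  proof eventually_elim
    case (elim t)
    \<comment> \<open>Rational lower bounds for all sufficiently short quotients at
      \<open>t\<close>; their supremum is the candidate for the derivative of
      \<open>g\<close>.\<close>
    define Lo where "Lo = {p\<in>\<rat>. 0 < p \<and> t \<notin> ?A p}"
    have slopes: "1 \<le> (g w - g u) / (w - u)" "(g w - g u) / (w - u) \<le> 2 * L + 1" if "u < w" for u w
      using g_lo[of u w] g_up[of u w] that by (auto simp: field_simps)
    have Ainf: "t \<in> ?A p" if p: "p > 2 * L + 1" for p
      unfolding short_quotient_def mem_Collect_eq
    proof (intro allI impI)
      fix d :: real assume "d > 0"
      moreover have "(g (t + d / 2) - g t) / (t + d / 2 - t) < p" using slopes(2)[of t "t + d/2"] p \<open>d > 0\<close> by auto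
      ultimately show "\<exists>u w. u \<le> t \<and> t \<le> w \<and> u < w \<and> w - u < d \<and> (g w - g u) / (w - u) \<in> {..<p}"
        by (intro exI[of _ t] exI[of _ "t + d/2"]) auto
    qed
    have "1/2 \<in> Lo"
    proof -
      have "\<not> short_quotient g {..<1/2} t"
        unfolding short_quotient_def using slopes(1) by (auto intro!: exI[of _ 1]) (smt (verit) field_sum_of_halves)
      then show ?thesis by (simp add: Lo_def)
    qed
    have bdd: "bdd_above Lo"
      by (rule bdd_aboveI[of _ "2 * L + 1"]) (use Ainf in \<open>force simp: Lo_def not_le\<close>)
    define D where "D = Sup Lo"
    have "D \<ge> 1/2" unfolding D_def by (rule cSup_upper[OF \<open>1/2 \<in> Lo\<close> bdd])
    have main: "\<exists>d>0. \<forall>u w. u \<le> t \<and> t \<le> w \<and> u < w \<and> w - u < d \<longrightarrow> \<bar>(g w - g u) / (w - u) - D\<bar> \<le> e"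
      if e: "e > 0" for e
    proof -
      obtain p where p: "p \<in> Lo" "D - e < p"
        using less_cSupD[of Lo "D - e"] \<open>1/2 \<in> Lo\<close> e unfolding D_def by (metis diff_less_eq empty_iff less_add_same_cancel1)
      obtain d1 where d1: "d1 > 0" "\<And>u w. \<lbrakk>u \<le> t; t \<le> w; u < w; w - u < d1\<rbrakk> \<Longrightarrow> p \<le> (g w - g u) / (w - u)"
      proof -
        have "\<not> short_quotient g {..<p} t" using p(1) by (simp add: Lo_def)
        then obtain d where "d > 0" "\<not> (\<exists>u w. u \<le> t \<and> t \<le> w \<and> u < w \<and> w - u < d \<and> (g w - g u) / (w - u) \<in> {..<p})"
          unfolding short_quotient_def by blast
        then show thesis using that[of d] by (meson lessThan_iff not_less)
      qed
      obtain p' where p': "p' \<in> \<rat>" "D < p'" "p' < D + e/2" using Rats_dense_in_real[of D "D + e/2"] e by auto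
      obtain q where q: "q \<in> \<rat>" "D + e/2 < q" "q < D + e" using Rats_dense_in_real[of "D+e/2" "D + e"] e by auto
      \<comment> \<open>A rational \<open>p'\<close> just above the supremum is not a lower bound,
        so quotients below \<open>p'\<close> occur at all small scales. Off the exceptional null
        sets, quotients above the larger rational \<open>q\<close> then cannot, and \<open>q\<close>
        becomes the upper bound.\<close>
      have "p' \<notin> Lo" using cSup_upper[OF _ bdd, of p'] p' unfolding D_def by auto
      then have "t \<in> ?A p'" using p' \<open>D \<ge> 1/2\<close> by (auto simp: Lo_def)
      then have "t \<notin> ?B q" using elim p' q \<open>D \<ge> 1/2\<close> by (metis (no_types, lifting) Int_iff dual_order.strict_trans2 half_gt_zero less_le_trans order.strict_trans zero_less_one)
      then obtain d2 where d2: "d2 > 0" "\<And>u w. \<lbrakk>u \<le> t; t \<le> w; u < w; w - u < d2\<rbrakk> \<Longrightarrow> (g w - g u) / (w - u) \<le> q"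
      proof -
        have "\<not> short_quotient g {q<..} t" using \<open>t \<notin> ?B q\<close> by simp
        then obtain d where "d > 0" "\<not> (\<exists>u w. u \<le> t \<and> t \<le> w \<and> u < w \<and> w - u < d \<and> (g w - g u) / (w - u) \<in> {q<..})"
          unfolding short_quotient_def by blast
        then show thesis using that[of d] by (meson greaterThan_iff not_less)
      qed
      show ?thesis
      proof (intro exI[of _ "min d1 d2"] conjI allI impI)
        fix u w assume uw: "u \<le> t \<and> t \<le> w \<and> u < w \<and> w - u < min d1 d2"
        then have "p \<le> (g w - g u) / (w - u)" "(g w - g u) / (w - u) \<le> q" using d1(2) d2(2) by auto
        then show "\<bar>(g w - g u) / (w - u) - D\<bar> \<le> e" using p q by (auto simp: abs_le_iff)
      qed (use d1 d2 in auto)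
    qed
    have "((\<lambda>y. (g y - g t) / (y - t)) \<longlongrightarrow> D) (at t)"
    proof (rule tendstoI)
      fix e :: real assume "e > 0"
      then obtain d where d: "d > 0" "\<And>u w. u \<le> t \<and> t \<le> w \<and> u < w \<and> w - u < d \<Longrightarrow> \<bar>(g w - g u) / (w - u) - D\<bar> \<le> e/2"
        using main[of "e/2"] by auto
      have "dist ((g y - g t) / (y - t)) D < e" if y: "y \<noteq> t" "dist y t < d" for y
      proof (cases "y > t")
        case True
        then show ?thesis using d(2)[of t y] y \<open>e > 0\<close> by (auto simp: dist_real_def)
      next
        case False
        then have "(g y - g t) / (y - t) = (g t - g y) / (t - y)" by (metis minus_diff_eq minus_divide_divide)
        then show ?thesis using d(2)[of y t] y \<open>e > 0\<close> False by (auto simp: dist_real_def)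
      qed
      then show "\<forall>\<^sub>F y in at t. dist ((g y - g t) / (y - t)) D < e"
        using d(1) by (auto simp: eventually_at)
    qed
    then have "(g has_field_derivative D) (at t)" by (simp add: has_field_derivative_iff)
    then have "((\<lambda>t. g t - (L + 1) * t) has_field_derivative D - (L + 1)) (at t)"
      by (auto intro!: derivative_eq_intros)
    moreover have "(\<lambda>t. g t - (L + 1) * t) = f" by (simp add: g_def)
    ultimately show ?case using real_differentiable_def by (metis (no_types))
  qed
qed

section \<open>Jordan curves and transversal arcs\<close>

text \<open>The Jordan curve theorem in the form used for trapping: a connected set off the curve
  lies on one side, and both sides come arbitrarily close to any chosen point of the curve.\<close>

definition jordan_space :: "'a::euclidean_space set \<Rightarrow> bool" where
  "jordan_space S \<longleftrightarrow> (\<forall>\<gamma>. simple_path \<gamma> \<and> pathfinish \<gamma> = pathstart \<gamma> \<and> path_image \<gamma> \<subseteq> S \<longrightarrow>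
     (\<exists>A B. openin (top_of_set S) A \<and> openin (top_of_set S) B \<and> A \<inter> B = {} \<and>
        A \<union> B = S - path_image \<gamma> \<and> path_image \<gamma> \<subseteq> closure A \<and> path_image \<gamma> \<subseteq> closure B))"

text \<open>If the curve filled the sphere, the simply connected sphere would be homeomorphic to a
  circle. So the curve misses a point \<open>p\<close>, and removing \<open>p\<close> reduces the
  claim to the Jordan curve theorem in the plane.\<close>

lemma jordan_space_sphere:
  assumes "DIM('a::euclidean_space) = 3"
  shows "jordan_space (sphere (0::'a) 1)"
  unfolding jordan_space_def
proof (intro allI impI, elim conjE)
  fix \<gamma> :: "real \<Rightarrow> 'a"
  let ?S = "sphere (0::'a) 1" and ?J = "path_image \<gamma>"
  assume \<gamma>: "simple_path \<gamma>" "pathfinish \<gamma> = pathstart \<gamma>" "?J \<subseteq> ?S"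
  have compJ: "compact ?J" using \<gamma>(1) by (simp add: compact_simple_path_image)
  have "?J \<noteq> ?S"
  proof
    assume "?J = ?S"
    then have "?S homeomorphic sphere (0::complex) 1"
      using homeomorphic_simple_path_image_circle[OF \<gamma>(1,2), of 1 0] by simp
    then have "simply_connected (sphere (0::complex) 1)"
      using homeomorphic_simply_connected_eq simply_connected_sphere[where 'a='a, of 0 1] assms by auto
    then show False using not_simply_connected_circle[of 1 0] by simp
  qed
  then obtain p where p: "p \<in> ?S" "p \<notin> ?J" using \<gamma>(3) by blast
  have p0: "p \<noteq> 0" using p(1) by auto
  have "(?S - {p}) homeomorphic {x. p \<bullet> x = 0}"
    using p(1) p0 by (intro homeomorphic_punctured_sphere_hyperplane) auto
  also have "{x. p \<bullet> x = 0} homeomorphic (UNIV :: complex set)"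
    by (rule homeomorphic_affine_sets) (use p0 assms in \<open>auto simp: affine_hyperplane\<close>)
  finally obtain f g where fg: "homeomorphism (?S - {p}) (UNIV::complex set) f g"
    unfolding homeomorphic_def by blast
  have JS: "?J \<subseteq> ?S - {p}" using p \<gamma>(3) by blast
  have gf: "\<And>x. x \<in> ?S - {p} \<Longrightarrow> g (f x) = x" by (rule homeomorphism_apply1[OF fg])
  have f_g: "\<And>y. f (g y) = y" by (rule homeomorphism_apply2[OF fg]) simp
  have cf: "continuous_on (?S - {p}) f" and cg: "continuous_on UNIV g"
    using fg homeomorphism_cont1 homeomorphism_cont2 by blast+
  have gim: "\<And>y. g y \<in> ?S - {p}" using homeomorphism_image2[OF fg] by blast
  let ?c = "f \<circ> \<gamma>"
  have inj: "inj_on f ?J" by (rule inj_on_inverseI[of _ g]) (use gf JS in blast)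
  have c: "simple_path ?c" "pathfinish ?c = pathstart ?c"
    using simple_path_continuous_image[OF \<gamma>(1) continuous_on_subset[OF cf JS] inj] \<gamma>(2)
    by (simp_all add: pathfinish_compose pathstart_compose)
  have pc: "path_image ?c = f ` ?J" by (simp add: path_image_compose)
  let ?I = "inside (f ` ?J)" and ?O = "outside (f ` ?J)"
  have io: "open ?I" "bounded ?I" "?I \<inter> ?O = {}" "?I \<union> ?O = - (f ` ?J)"
    "frontier ?I = f ` ?J" "frontier ?O = f ` ?J"
    using Jordan_inside_outside[OF c] unfolding pc by auto
  define A where "A = g ` ?I"
  define B where "B = ?S - ?J - A"
  have gfJ: "g ` f ` ?J = ?J" unfolding image_comp o_def using gf JS by (simp add: subset_iff)
  have clI: "closure ?I = ?I \<union> f ` ?J" using io(5) by (metis closure_Un_frontier)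
  have clO: "closure ?O = ?O \<union> f ` ?J" using io(6) by (metis closure_Un_frontier)
  have sub: "f ` ?J \<subseteq> closure ?I" "f ` ?J \<subseteq> closure ?O" using clI clO by auto
  have gcl: "g ` closure X \<subseteq> closure (g ` X)" for X
    by (rule image_closure_subset) (auto intro: continuous_on_subset[OF cg] closure_subset[THEN subsetD])
  have disj: "A \<inter> ?J = {}"
  proof -
    have "f p \<in> ?I" if "p \<in> A" for p using f_g that by (auto simp: A_def)
    then show ?thesis using io(4) by blast
  qed
  have oA: "openin (top_of_set ?S) A"
  proof -
    have "openin (top_of_set (?S - {p})) A"
      unfolding A_def using homeomorphism_imp_open_map[OF homeomorphism_symD[OF fg]] io(1) by auto
    moreover have "openin (top_of_set ?S) (?S - {p})" by (simp add: openin_delete)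
    ultimately show ?thesis by (rule openin_trans)
  qed
  have oB: "openin (top_of_set ?S) B"
  proof -
    have "compact (closure ?I)" using io(2) by simp
    then have "compact (g ` closure ?I)" using compact_continuous_image continuous_on_subset[OF cg] by blast
    moreover have "g ` closure ?I = ?J \<union> A" by (simp add: clI image_Un gfJ A_def Un_commute)
    ultimately have "closed (?J \<union> A)" by (simp add: compact_imp_closed)
    moreover have "B = ?S - (?J \<union> A)" by (auto simp: B_def)
    moreover have "openin (top_of_set ?S) (?S \<inter> - (?J \<union> A))" if "closed (?J \<union> A)"
      using that by (intro openin_open_Int) (simp only: open_Compl)
    ultimately show ?thesis by (simp only: Diff_eq)
  qed
  have gO: "g ` ?O \<subseteq> B"
  proof clarify
    fix y assume y: "y \<in> ?O"
    have "y \<notin> f ` ?J" "y \<notin> ?I" using y io(3,4) by blast+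
    moreover have "y \<in> f ` ?J" if "g y \<in> ?J" using f_g[of y] that by (metis image_eqI)
    moreover have "y \<in> ?I" if "g y \<in> A" using f_g that unfolding A_def by (metis imageE)
    ultimately show "g y \<in> B" using gim[of y] unfolding B_def by blast
  qed
  have "?J \<subseteq> closure A" using gcl[of ?I] sub(1) gfJ unfolding A_def by blast
  moreover have "?J \<subseteq> closure B" using gcl[of ?O] sub(2) gfJ closure_mono[OF gO] by blast
  moreover have "A \<subseteq> ?S" using gim by (auto simp: A_def)
  ultimately show "\<exists>A B. openin (top_of_set ?S) A \<and> openin (top_of_set ?S) B \<and> A \<inter> B = {} \<and>
        A \<union> B = ?S - ?J \<and> ?J \<subseteq> closure A \<and> ?J \<subseteq> closure B"
    using oA oB disj by (intro exI[of _ A] exI[of _ B]) (auto simp: B_def)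
qed

lemma connected_dichotomy:
  assumes "connected X" "X \<subseteq> A \<union> B" "A \<inter> B = {}" "openin (top_of_set S) A" "openin (top_of_set S) B"
  shows "X \<subseteq> A \<or> X \<subseteq> B"
proof -
  obtain V W where "open V" "A = S \<inter> V" "open W" "B = S \<inter> W" using assms(4,5) by (auto simp: openin_open)
  moreover have "X \<inter> V \<inter> W = {}" "X \<subseteq> V \<union> W" using calculation assms(2,3) by auto
  ultimately have "X \<inter> V = {} \<or> X \<inter> W = {}" using assms(1) unfolding connected_def by (metis inf_assoc inf_commute)
  then show ?thesis using assms(2) \<open>A = S \<inter> V\<close> \<open>B = S \<inter> W\<close> by blast
qed

text \<open>Chart coordinates are pairs (a, b) with the transversal arc at a = 0. The margin \<rho>
  < R makes the part of the arc with \<bar>b\<bar> \<le> \<rho> compact inside the chart.\<close>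

locale jordan_chart =
  fixes S U :: "'a::euclidean_space set" and \<sigma> :: "real \<times> real \<Rightarrow> 'a" and g :: "'a \<Rightarrow> real \<times> real"
    and R \<rho> :: real
  assumes jordan: "jordan_space S"
    and hom: "homeomorphism ({-R<..<R} \<times> {-R<..<R}) U \<sigma> g"
    and openU: "openin (top_of_set S) U"
    and rho: "0 < \<rho>" "\<rho> < R"
begin

abbreviation "Q \<equiv> {-R<..<R} \<times> {-R<..<R}"

lemma openQ: "open Q" by (simp add: open_Times)

lemma cont_sigma: "continuous_on Q \<sigma>" and cont_g: "continuous_on U g"
  and g_sigma: "\<And>q. q \<in> Q \<Longrightarrow> g (\<sigma> q) = q" and sigma_g: "\<And>u. u \<in> U \<Longrightarrow> \<sigma> (g u) = u"
  and sigma_U: "\<And>q. q \<in> Q \<Longrightarrow> \<sigma> q \<in> U" and g_Q: "\<And>u. u \<in> U \<Longrightarrow> g u \<in> Q"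
  using homeomorphism_cont1[OF hom] homeomorphism_cont2[OF hom] homeomorphism_apply1[OF hom]
    homeomorphism_apply2[OF hom] homeomorphism_image1[OF hom] homeomorphism_image2[OF hom] by blast+

lemma US: "U \<subseteq> S" using openU openin_imp_subset by blast

lemma sigma_inj: "q \<in> Q \<Longrightarrow> q' \<in> Q \<Longrightarrow> \<sigma> q = \<sigma> q' \<Longrightarrow> q = q'"
  using g_sigma by metis

text \<open>Tube lemma: a compact piece of the arc that misses a closed set has a whole rectangle
  around it, in chart coordinates, that misses this set. The closed set will be a piece of a
  trajectory.\<close>

lemma strip:
  assumes "\<beta>0 \<le> \<beta>1" "-R < \<beta>0" "\<beta>1 < R" "closed C" "\<And>b. b \<in> {\<beta>0..\<beta>1} \<Longrightarrow> \<sigma> (0,b) \<notin> C"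
  obtains \<epsilon> where "\<epsilon> > 0"
    "\<And>a b. \<lbrakk>\<bar>a\<bar> < \<epsilon>; \<beta>0 - \<epsilon> < b; b < \<beta>1 + \<epsilon>\<rbrakk> \<Longrightarrow> (a,b) \<in> Q \<and> \<sigma> (a,b) \<notin> C"
proof -
  have "open (Q \<inter> \<sigma> -` (- C))"
    using assms by (intro continuous_open_preimage cont_sigma openQ) auto
  moreover have "compact ({0} \<times> {\<beta>0..\<beta>1})" by (intro compact_Times) auto
  moreover have "{0} \<times> {\<beta>0..\<beta>1} \<subseteq> Q \<inter> \<sigma> -` (- C)" using assms rho by auto
  ultimately obtain e where e: "e > 0" "(\<Union>x\<in>{0} \<times> {\<beta>0..\<beta>1}. ball x e) \<subseteq> Q \<inter> \<sigma> -` (- C)"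
    using compact_subset_open_imp_ball_epsilon_subset by metis
  show thesis
  proof (rule that[of "e/2"])
    fix a b assume ab: "\<bar>a\<bar> < e/2" "\<beta>0 - e/2 < b" "b < \<beta>1 + e/2"
    define b' where "b' = max \<beta>0 (min \<beta>1 b)"
    have b': "b' \<in> {\<beta>0..\<beta>1}" "\<bar>b' - b\<bar> < e/2" using ab assms(1) e unfolding b'_def by (auto simp: max_def min_def)
    have "dist (0,b') (a,b) \<le> \<bar>a\<bar> + \<bar>b' - b\<bar>"
      unfolding dist_Pair_Pair dist_real_def using sqrt_sum_squares_le_sum_abs[of "0-a" "b'-b"] by simp
    then have "(a,b) \<in> ball (0,b') e" using ab b' by simp
    then show "(a,b) \<in> Q \<and> \<sigma> (a,b) \<notin> C" using e(2) b'(1) by fastforce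
  qed (use e in auto)
qed

lemma strip_connected:
  assumes "{a0<..<a1} \<times> {c0<..<c1} \<subseteq> Q"
  shows "connected (\<sigma> ` ({a0<..<a1} \<times> {c0<..<c1}))"
  by (intro connected_continuous_image continuous_on_subset[OF cont_sigma assms] connected_Times) auto

end

text \<open>The differential inclusion enters the topological argument only through
  \<open>mono\<close>: inside the chart the first coordinate increases strictly with time, so the
  arc is always crossed from negative to positive.\<close>

locale transversal_trajectory = jordan_chart +
  fixes y :: "real \<Rightarrow> 'a::euclidean_space"
  assumes cont: "continuous_on {0..} y"
    and yS: "\<And>t. t \<ge> 0 \<Longrightarrow> y t \<in> S"
    and mono: "\<And>s t. \<lbrakk>0 \<le> s; s < t; y ` {s..t} \<subseteq> U\<rbrakk> \<Longrightarrow> fst (g (y s)) < fst (g (y t))"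
begin

lemma near:
  assumes "t \<ge> 0" "y t = \<sigma> (0,b)" "\<bar>b\<bar> < R" "\<epsilon> > 0"
  obtains \<delta> where "\<delta> > 0" "\<And>\<tau>. \<lbrakk>\<tau> \<ge> 0; \<bar>\<tau> - t\<bar> < \<delta>\<rbrakk> \<Longrightarrow>
    y \<tau> \<in> U \<and> \<bar>fst (g (y \<tau>))\<bar> < \<epsilon> \<and> \<bar>snd (g (y \<tau>)) - b\<bar> < \<epsilon>
    \<and> (t < \<tau> \<longrightarrow> 0 < fst (g (y \<tau>))) \<and> (\<tau> < t \<longrightarrow> fst (g (y \<tau>)) < 0)"
proof -
  have q: "(0,b) \<in> Q" using assms(3) rho by auto
  then have yU: "y t \<in> U" and gy: "g (y t) = (0,b)" using assms(2) sigma_U g_sigma by auto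
  obtain V where V: "open V" "U = S \<inter> V" using openU by (auto simp: openin_open)
  obtain d1 where d1: "d1 > 0" "ball (y t) d1 \<subseteq> V" using V yU open_contains_ball by blast
  obtain d2 where d2: "d2 > 0" "\<And>u. u \<in> U \<Longrightarrow> dist u (y t) < d2 \<Longrightarrow> dist (g u) (g (y t)) < \<epsilon>"
    using cont_g yU assms(4) unfolding continuous_on_iff by metis
  obtain \<delta> where \<delta>: "\<delta> > 0" "\<And>\<tau>. \<tau> \<ge> 0 \<Longrightarrow> dist \<tau> t < \<delta> \<Longrightarrow> dist (y \<tau>) (y t) < min d1 d2"
    using cont assms(1) d1(1) d2(1) unfolding continuous_on_iff by (metis atLeast_iff min_less_iff_conj)
  have inU: "y \<tau> \<in> U" if "\<tau> \<ge> 0" "\<bar>\<tau> - t\<bar> < \<delta>" for \<tau>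
    using \<delta>(2)[of \<tau>] that d1(2) V(2) yS by (auto simp: dist_real_def dist_commute subset_eq)
  show thesis
  proof (rule that[OF \<delta>(1)])
    fix \<tau> assume \<tau>: "\<tau> \<ge> 0" "\<bar>\<tau> - t\<bar> < \<delta>"
    have d: "dist (g (y \<tau>)) (0,b) < \<epsilon>"
      using \<delta>(2)[of \<tau>] \<tau> d2(2)[OF inU[OF \<tau>]] gy by (simp add: dist_real_def)
    have 1: "\<bar>fst (g (y \<tau>))\<bar> < \<epsilon>"
      using d dist_fst_le[of "g (y \<tau>)" "(0,b)"] by (simp add: dist_real_def)
    have 2: "\<bar>snd (g (y \<tau>)) - b\<bar> < \<epsilon>"
      using d dist_snd_le[of "g (y \<tau>)" "(0,b)"] by (simp add: dist_real_def)
    have 3: "0 < fst (g (y \<tau>))" if "t < \<tau>"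
    proof -
      have "y ` {t..\<tau>} \<subseteq> U" using inU \<tau> assms(1) by auto
      then show ?thesis using mono[OF assms(1) that] gy by simp
    qed
    have 4: "fst (g (y \<tau>)) < 0" if "\<tau> < t"
    proof -
      have "y ` {\<tau>..t} \<subseteq> U" using inU \<tau> assms(1) by auto
      then show ?thesis using mono[OF \<tau>(1) that] gy by simp
    qed
    show "y \<tau> \<in> U \<and> \<bar>fst (g (y \<tau>))\<bar> < \<epsilon> \<and> \<bar>snd (g (y \<tau>)) - b\<bar> < \<epsilon>
      \<and> (t < \<tau> \<longrightarrow> 0 < fst (g (y \<tau>))) \<and> (\<tau> < t \<longrightarrow> fst (g (y \<tau>)) < 0)"
      using inU[OF \<tau>] 1 2 3 4 by blast
  qed
qed

text \<open>Provides first and last crossings of a closed piece of the arc within a closed range of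
  times.\<close>

lemma compact_crossings:
  assumes "0 \<le> s" "-\<rho> \<le> \<beta>0" "\<beta>1 \<le> \<rho>"
  shows "compact {t\<in>{s..s'}. \<exists>b\<in>{\<beta>0..\<beta>1}. y t = \<sigma> (0,b)}"
proof -
  have "continuous_on ({0} \<times> {\<beta>0..\<beta>1}) \<sigma>"
    by (rule continuous_on_subset[OF cont_sigma]) (use assms rho in auto)
  then have "compact (\<sigma> ` ({0} \<times> {\<beta>0..\<beta>1}))"
    by (intro compact_continuous_image compact_Times) auto
  then have "closed ({s..s'} \<inter> y -` (\<sigma> ` ({0} \<times> {\<beta>0..\<beta>1})))"
    by (intro continuous_closed_preimage continuous_on_subset[OF cont]) (use assms in \<open>auto simp: compact_imp_closed\<close>)
  then have "compact ({s..s'} \<inter> ({s..s'} \<inter> y -` (\<sigma> ` ({0} \<times> {\<beta>0..\<beta>1}))))"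
    by (intro compact_Int_closed) auto
  moreover have "{s..s'} \<inter> ({s..s'} \<inter> y -` (\<sigma> ` ({0} \<times> {\<beta>0..\<beta>1}))) =
    {t\<in>{s..s'}. \<exists>b\<in>{\<beta>0..\<beta>1}. y t = \<sigma> (0,b)}" by auto
  ultimately show ?thesis by simp
qed

text \<open>The arc of \<open>y\<close> between two consecutive crossings, closed up by the piece of the transversal
  between them, is a Jordan curve that \<open>y\<close> cannot leave any more: it could only cross the transversal
  piece in the same direction as before.\<close>
lemma trap:
  assumes inj: "inj_on y {0..}"
    and t: "0 \<le> t1" "t1 < t2" "t2 < t3"
    and y1: "y t1 = \<sigma> (0,b1)" and y2: "y t2 = \<sigma> (0,b2)" and y3: "y t3 = \<sigma> (0,b3)"
    and b: "\<bar>b1\<bar> \<le> \<rho>" "\<bar>b2\<bar> \<le> \<rho>" "\<bar>b3\<bar> \<le> \<rho>" "b1 < b2"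
    and gap: "\<And>\<tau> b. \<lbrakk>t1 < \<tau>; \<tau> < t2; \<bar>b\<bar> \<le> \<rho>\<rbrakk> \<Longrightarrow> y \<tau> \<noteq> \<sigma> (0,b)"
  shows "b2 < b3"
proof (rule ccontr)
  assume "\<not> b2 < b3"
  have injD: "s = s'" if "y s = y s'" "0 \<le> s" "0 \<le> s'" for s s'
    using inj that by (auto dest: inj_onD)
  have sinj: "b = b'" if "\<sigma> (0,b) = \<sigma> (0,b')" "\<bar>b\<bar> \<le> \<rho>" "\<bar>b'\<bar> \<le> \<rho>" for b b'
    using sigma_inj[of "(0,b)" "(0,b')"] that rho by (auto simp: abs_le_iff)
  have gs: "g (\<sigma> (0,b)) = (0,b)" if "\<bar>b\<bar> \<le> \<rho>" for b
    by (rule g_sigma) (use that rho in auto)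
  obtain d1 where d1: "d1 > 0" "\<And>\<tau>. \<lbrakk>\<tau> \<ge> 0; \<bar>\<tau> - t1\<bar> < d1\<rbrakk> \<Longrightarrow> y \<tau> \<in> U \<and> (t1 < \<tau> \<longrightarrow> 0 < fst (g (y \<tau>)))"
    using near[OF t(1) y1, of 1] b rho by (smt (verit))
  obtain d2 where d2: "d2 > 0" "\<And>\<tau>. \<lbrakk>\<tau> \<ge> 0; \<bar>\<tau> - t2\<bar> < d2\<rbrakk> \<Longrightarrow> y \<tau> \<in> U \<and> (t2 < \<tau> \<longrightarrow> 0 < fst (g (y \<tau>)))
      \<and> (\<tau> < t2 \<longrightarrow> fst (g (y \<tau>)) < 0)"
    using near[OF _ y2, of 1] t b rho by (smt (verit))
  \<comment> \<open>Returns to the arc at or below \<open>b2\<close>. Starting at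
    \<open>t2 + d2\<close> excludes \<open>t2\<close> itself, keeps the set compact and loses
    nothing, as no crossing happens in between. Crossings above \<open>b2\<close> are not recorded
    because they do not touch the Jordan curve.\<close>
  define W where "W = {\<tau>\<in>{t2+d2..t3}. \<exists>b\<in>{-\<rho>..b2}. y \<tau> = \<sigma> (0,b)}"
  have "t3 \<in> W"
  proof -
    have "\<not> \<bar>t3 - t2\<bar> < d2" using d2(2)[of t3] t y3 gs[OF b(3)] by auto
    then show ?thesis using t y3 b \<open>\<not> b2 < b3\<close> by (auto simp: W_def intro!: bexI[of _ b3])
  qed
  moreover have "compact W" unfolding W_def by (rule compact_crossings) (use t d2 b in auto)
  ultimately obtain t' where t': "t' \<in> W" "\<And>\<tau>. \<tau> \<in> W \<Longrightarrow> t' \<le> \<tau>"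
    using compact_attains_inf[of W] by blast
  then obtain b' where b': "-\<rho> \<le> b'" "b' \<le> b2" "y t' = \<sigma> (0,b')" and tt': "t2 + d2 \<le> t'" "t' \<le> t3"
    by (auto simp: W_def)
  have "b' < b2" using injD[of t' t2] b' y2 tt' d2 t by (cases "b' = b2") auto
  have first: "y \<tau> \<noteq> \<sigma> (0,b)" if "t2 < \<tau>" "\<tau> < t'" "-\<rho> \<le> b" "b \<le> b2" for \<tau> b
  proof
    assume eq: "y \<tau> = \<sigma> (0,b)"
    show False
    proof (cases "\<tau> < t2 + d2")
      case True
      then show False using d2(2)[of \<tau>] that t eq gs[of b] b by auto
    next
      case False
      then have "\<tau> \<in> W" using that tt' eq by (auto simp: W_def)
      then show False using t'(2) that by fastforce
    qed
  qed
  define arc1 where "arc1 = y \<circ> linepath t1 t2"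
  define arc2 where "arc2 = (\<lambda>b. \<sigma> (0,b)) \<circ> linepath b2 b1"
  define Sg where "Sg = (\<lambda>b. \<sigma> (0,b)) ` {b1..b2}"
  have seg: "closed_segment t1 t2 = {t1..t2}" "closed_segment b2 b1 = {b1..b2}"
    using t b by (auto simp: closed_segment_eq_real_ivl)
  have cs: "continuous_on {b1..b2} (\<lambda>b. \<sigma> (0,b))"
    by (intro continuous_on_compose2[OF cont_sigma] continuous_intros) (use b rho in auto)
  have pi: "path_image arc1 = y ` {t1..t2}" "path_image arc2 = Sg"
    by (simp_all add: arc1_def arc2_def path_image_compose seg Sg_def)
  have a1: "arc arc1"
    unfolding arc_def arc1_def
  proof
    show "path (y \<circ> linepath t1 t2)"
      by (rule path_continuous_image) (use t in \<open>auto simp: seg intro: continuous_on_subset[OF cont]\<close>)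
    have "inj_on y (linepath t1 t2 ` {0..1})"
      by (rule inj_on_subset[OF inj]) (use t in \<open>auto simp: linepath_image_01 seg\<close>)
    then show "inj_on (y \<circ> linepath t1 t2) {0..1}"
      using inj_on_linepath[of t1 t2] t by (intro comp_inj_on) auto
  qed
  have a2: "arc arc2"
    unfolding arc_def arc2_def
  proof
    show "path ((\<lambda>b. \<sigma> (0,b)) \<circ> linepath b2 b1)"
      by (rule path_continuous_image) (use cs in \<open>auto simp: seg\<close>)
    have "inj_on (\<lambda>b. \<sigma> (0,b)) (linepath b2 b1 ` {0..1})"
      using sinj b by (auto simp: linepath_image_01 seg inj_on_def)
    then show "inj_on ((\<lambda>b. \<sigma> (0,b)) \<circ> linepath b2 b1) {0..1}"
      using inj_on_linepath[of b2 b1] b by (intro comp_inj_on) auto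
  qed
  have ends: "pathstart arc1 = y t1" "pathfinish arc1 = y t2" "pathstart arc2 = y t2" "pathfinish arc2 = y t1"
    by (simp_all add: arc1_def arc2_def pathstart_compose pathfinish_compose y1 y2)
  define \<gamma> where "\<gamma> = arc1 +++ arc2"
  define J where "J = y ` {t1..t2} \<union> Sg"
  have gap': "\<tau> = t1 \<or> \<tau> = t2" if "\<tau> \<in> {t1..t2}" "y \<tau> = \<sigma> (0,b)" "\<bar>b\<bar> \<le> \<rho>" for \<tau> b
    using gap[of \<tau> b] that by fastforce
  have "simple_path \<gamma>" unfolding \<gamma>_def
  proof (rule simple_path_join_loop[OF a1 a2])
    show "path_image arc1 \<inter> path_image arc2 \<subseteq> {pathstart arc1, pathstart arc2}"
    proof
      fix p assume "p \<in> path_image arc1 \<inter> path_image arc2"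
      then obtain \<tau> b where "\<tau> \<in> {t1..t2}" "p = y \<tau>" "p = \<sigma> (0,b)" "b \<in> {b1..b2}"
        unfolding pi by (auto simp: Sg_def)
      then show "p \<in> {pathstart arc1, pathstart arc2}"
        using gap'[of \<tau> b] b by (auto simp: ends abs_le_iff)
    qed
  qed (simp_all add: ends)
  moreover have pi\<gamma>: "path_image \<gamma> = J"
    unfolding \<gamma>_def by (subst path_image_join) (simp_all add: ends J_def pi)
  moreover have SgU: "Sg \<subseteq> U" unfolding Sg_def using b rho by (auto intro!: sigma_U)
  moreover have "J \<subseteq> S" using SgU US yS t by (auto simp: J_def)
  moreover have "pathfinish \<gamma> = pathstart \<gamma>" by (simp add: \<gamma>_def ends)
  ultimately obtain A B where AB: "openin (top_of_set S) A" "openin (top_of_set S) B" "A \<inter> B = {}"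
    "A \<union> B = S - J" "J \<subseteq> closure A" "J \<subseteq> closure B"
    using jordan unfolding jordan_space_def by metis
  \<comment> \<open>The midpoint of the arc piece is the place where the two sides of the curve are
    inspected.\<close>
  define m where "m = (b1 + b2) / 2"
  have m: "b1 < m" "m < b2" "\<bar>m\<bar> \<le> \<rho>" using b by (auto simp: m_def)
  have Sg0: "fst (g p) = 0" if "p \<in> Sg" for p using that gs b by (auto simp: Sg_def)
  have closedY: "closed (y ` {s..s'})" if "0 \<le> s" for s s'
    by (intro compact_imp_closed compact_continuous_image continuous_on_subset[OF cont]) (use that in auto)

  obtain ep where ep: "ep > 0" "\<And>a b. \<lbrakk>\<bar>a\<bar> < ep; m - ep < b; b < b2 + ep\<rbrakk> \<Longrightarrow>
      (a,b) \<in> Q \<and> \<sigma> (a,b) \<notin> y ` {t1..t2 - d2/2}"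
  proof (rule strip[of m b2 "y ` {t1..t2 - d2/2}"])
    fix b assume bm: "b \<in> {m..b2}"
    show "\<sigma> (0,b) \<notin> y ` {t1..t2 - d2/2}"
    proof
      assume "\<sigma> (0,b) \<in> y ` {t1..t2 - d2/2}"
      then obtain \<tau> where \<tau>: "\<tau> \<in> {t1..t2 - d2/2}" "y \<tau> = \<sigma> (0,b)" by force
      have "\<bar>b\<bar> \<le> \<rho>" using bm m b by auto
      then have "\<tau> = t1" using gap'[OF _ \<tau>(2)] \<tau>(1) d2 by auto
      then have "b = b1" using \<tau>(2) y1 sinj b \<open>\<bar>b\<bar> \<le> \<rho>\<close> by metis
      then show False using bm m by auto
    qed
  qed (use m b rho t closedY in auto)
  \<comment> \<open>Rectangle on the positive side of the arc, reaching from \<open>m\<close> to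
    \<open>b2\<close>, where \<open>y\<close> departs at time \<open>t2\<close>. It misses the
    curve: \<open>ep\<close> keeps it away from the earlier part of \<open>y\<close>, and just
    before \<open>t2\<close> the trajectory is on the negative side.\<close>
  define Rp where "Rp = \<sigma> ` ({0<..<ep} \<times> {m-ep<..<b2+ep})"
  have RpQ: "{0<..<ep} \<times> {m-ep<..<b2+ep} \<subseteq> Q"
  proof clarify
    fix a b assume "a \<in> {0<..<ep}" "b \<in> {m-ep<..<b2+ep}"
    then show "a \<in> {-R<..<R} \<and> b \<in> {-R<..<R}" using ep(2)[of a b] by auto
  qed
  have Rp_conn: "connected Rp" unfolding Rp_def by (rule strip_connected[OF RpQ])
  have Rp_pos: "fst (g p) > 0" "p \<in> U" if "p \<in> Rp" for p
    using that g_sigma RpQ sigma_U unfolding Rp_def by (auto simp: subset_iff)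
  have Rp_J: "Rp \<inter> J = {}"
  proof -
    have False if p: "p \<in> Rp" "p \<in> J" for p
    proof -
      have "p \<notin> Sg" using Rp_pos(1)[OF p(1)] Sg0 by fastforce
      then obtain \<tau> where \<tau>: "p = y \<tau>" "t1 \<le> \<tau>" "\<tau> \<le> t2" using p by (auto simp: J_def)
      obtain a c where "p = \<sigma> (a,c)" "0 < a" "a < ep" "m - ep < c" "c < b2 + ep" using p(1) by (auto simp: Rp_def)
      then have "p \<notin> y ` {t1..t2 - d2/2}" using ep(2)[of a c] by simp
      then have "t2 - d2/2 < \<tau>" using \<tau> by (meson atLeastAtMost_iff image_eqI not_le)
      then have "fst (g p) \<le> 0" using d2(1) d2(2)[of \<tau>] \<tau> t gs[OF b(2)] y2 by (cases "\<tau> = t2") auto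
      then show False using Rp_pos(1)[OF p(1)] by simp
    qed
    then show ?thesis by blast
  qed
  obtain em where em: "em > 0" "\<And>a b. \<lbrakk>\<bar>a\<bar> < em; min b' m - em < b; b < max b' m + em\<rbrakk> \<Longrightarrow>
      (a,b) \<in> Q \<and> \<sigma> (a,b) \<notin> y ` {t1 + d1/2..t2}"
  proof (rule strip[of "min b' m" "max b' m" "y ` {t1 + d1/2..t2}"])
    fix b assume bm: "b \<in> {min b' m..max b' m}"
    show "\<sigma> (0,b) \<notin> y ` {t1 + d1/2..t2}"
    proof
      assume "\<sigma> (0,b) \<in> y ` {t1 + d1/2..t2}"
      then obtain \<tau> where \<tau>: "\<tau> \<in> {t1 + d1/2..t2}" "y \<tau> = \<sigma> (0,b)" by force
      have br: "\<bar>b\<bar> \<le> \<rho>" using bm m b' \<open>\<bar>b2\<bar> \<le> \<rho>\<close> by auto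
      then have "\<tau> = t2" using gap'[OF _ \<tau>(2)] \<tau>(1) d1 by auto
      then have "b = b2" using \<tau>(2) y2 sinj[OF _ br \<open>\<bar>b2\<bar> \<le> \<rho>\<close>] by metis
      then show False using bm m \<open>b' < b2\<close> by auto
    qed
  qed (use m b b' rho t d1 closedY in auto)
  \<comment> \<open>Its counterpart on the negative side, joining \<open>m\<close> to the point
    \<open>b'\<close> of the first return. This arc piece stays strictly below \<open>b2\<close>, so
    \<open>y\<close> can be avoided up to and including \<open>t2\<close>; just after
    \<open>t1\<close> the trajectory is on the positive side.\<close>
  define Rm where "Rm = \<sigma> ` ({-em<..<0} \<times> {min b' m - em<..<max b' m + em})"
  have RmQ: "{-em<..<0} \<times> {min b' m - em<..<max b' m + em} \<subseteq> Q"
  proof clarify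
    fix a b assume "a \<in> {-em<..<0}" "b \<in> {min b' m - em<..<max b' m + em}"
    then show "a \<in> {-R<..<R} \<and> b \<in> {-R<..<R}" using em(2)[of a b] by auto
  qed
  have Rm_conn: "connected Rm" unfolding Rm_def by (rule strip_connected[OF RmQ])
  have Rm_neg: "fst (g p) < 0" "p \<in> U" if "p \<in> Rm" for p
    using that g_sigma RmQ sigma_U unfolding Rm_def by (auto simp: subset_iff)
  have Rm_J: "Rm \<inter> J = {}"
  proof -
    have False if p: "p \<in> Rm" "p \<in> J" for p
    proof -
      have "p \<notin> Sg" using Rm_neg(1)[OF p(1)] Sg0 by fastforce
      then obtain \<tau> where \<tau>: "p = y \<tau>" "t1 \<le> \<tau>" "\<tau> \<le> t2" using p by (auto simp: J_def)
      obtain a c where "p = \<sigma> (a,c)" "-em < a" "a < 0" "min b' m - em < c" "c < max b' m + em"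
        using p(1) by (auto simp: Rm_def)
      then have "p \<notin> y ` {t1 + d1/2..t2}" using em(2)[of a c] by simp
      then have "\<tau> < t1 + d1/2" using \<tau> by (meson atLeastAtMost_iff image_eqI not_le)
      then have "fst (g p) \<ge> 0" using d1(1) d1(2)[of \<tau>] \<tau> t gs[OF b(1)] y1 by (cases "\<tau> = t1") auto
      then show False using Rm_neg(1)[OF p(1)] by simp
    qed
    then show ?thesis by blast
  qed
  \<comment> \<open>The first two bounds put the square around \<open>m\<close>, without the arc,
    into the union of the two rectangles; the third makes the square meet the arc only within
    \<open>Sg\<close>.\<close>
  define e where "e = min (min ep em) ((b2 - b1)/2)"
  have e: "e > 0" "e \<le> ep" "e \<le> em" "e \<le> (b2-b1)/2" using ep(1) em(1) b(4) by (auto simp: e_def min_def)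
  define Nb where "Nb = \<sigma> ` ({-e<..<e} \<times> {m-e<..<m+e})"
  have NbQ: "{-e<..<e} \<times> {m-e<..<m+e} \<subseteq> Q"
  proof clarify
    fix a b assume "a \<in> {-e<..<e}" "b \<in> {m-e<..<m+e}"
    then show "a \<in> {-R<..<R} \<and> b \<in> {-R<..<R}" using ep(2)[of a b] e m by auto
  qed
  have "openin (top_of_set Q) ({-e<..<e} \<times> {m-e<..<m+e})"
    by (rule open_subset[OF NbQ]) (simp add: open_Times)
  then have "openin (top_of_set U) Nb" unfolding Nb_def by (rule homeomorphism_imp_open_map[OF hom])
  then have "openin (top_of_set S) Nb" using openU openin_trans by blast
  then obtain V where V: "open V" "Nb = S \<inter> V" by (auto simp: openin_open)
  have mN: "\<sigma> (0,m) \<in> Nb" "\<sigma> (0,m) \<in> J" using e(1) m by (auto simp: Nb_def J_def Sg_def)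
  \<comment> \<open>Each side of the curve accumulates at the arc point with coordinate
    \<open>m\<close>, and near this point everything off the curve lies in one of the two
    rectangles.\<close>
  have meets: "\<exists>p\<in>X. p \<in> Rp \<union> Rm" if X: "J \<subseteq> closure X" "X \<subseteq> S - J" for X
  proof -
    have "\<sigma> (0,m) \<in> V" "\<sigma> (0,m) \<in> closure X" using mN V X by auto
    then have "V \<inter> X \<noteq> {}" using open_Int_closure_eq_empty[OF V(1), of X] by blast
    then obtain p where p: "p \<in> X" "p \<in> Nb" using X V by blast
    then obtain a c where ac: "p = \<sigma> (a,c)" "-e < a" "a < e" "m - e < c" "c < m + e"
      by (auto simp: Nb_def)
    have "a \<noteq> 0"
    proof
      assume "a = 0"
      then have "p \<in> J" using ac e(4) unfolding J_def Sg_def m_def by (auto simp: field_simps intro!: image_eqI[of _ _ c])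
      then show False using p X by auto
    qed
    then have "p \<in> Rp \<union> Rm" using ac e m unfolding Rp_def Rm_def
      by (cases "a > 0") (auto intro!: image_eqI[of _ _ "(a,c)"])
    then show ?thesis using p by blast
  qed
  \<comment> \<open>The trajectory between \<open>t2\<close> and the first return leads from the
    positive rectangle to the negative one without meeting the curve. Hence both rectangles lie on
    the same side, although each side must meet one of them.\<close>
  define Y where "Y = y ` {t2<..<t'}"
  have "t2 < t'" using tt' d2 by simp
  have Yc: "connected Y" unfolding Y_def
    by (intro connected_continuous_image continuous_on_subset[OF cont]) (use t in auto)
  have YJ: "Y \<subseteq> S - J"
  proof
    fix p assume "p \<in> Y"
    then obtain \<tau> where \<tau>: "p = y \<tau>" "t2 < \<tau>" "\<tau> < t'" by (auto simp: Y_def)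
    have "p \<notin> y ` {t1..t2}" using injD[of \<tau>] \<tau> t by force
    moreover have "\<sigma> (0,c) \<noteq> p" if c: "c \<in> {b1..b2}" for c
      using first[OF \<tau>(2,3), of c] c b(1) \<tau>(1) by (auto simp: abs_le_iff)
    then have "p \<notin> Sg" unfolding Sg_def by blast
    ultimately show "p \<in> S - J" using yS[of \<tau>] \<tau> t by (auto simp: J_def)
  qed
  have YRp: "Y \<inter> Rp \<noteq> {}"
  proof -
    obtain d where d: "d > 0" "\<And>\<tau>. \<lbrakk>\<tau> \<ge> 0; \<bar>\<tau> - t2\<bar> < d\<rbrakk> \<Longrightarrow> y \<tau> \<in> U \<and> \<bar>fst (g (y \<tau>))\<bar> < ep \<and>
       \<bar>snd (g (y \<tau>)) - b2\<bar> < ep \<and> (t2 < \<tau> \<longrightarrow> 0 < fst (g (y \<tau>)))"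
      using near[OF _ y2, of ep] t b rho ep(1) by (smt (verit))
    define \<tau> where "\<tau> = t2 + min d (t' - t2) / 2"
    have \<tau>: "t2 < \<tau>" "\<tau> < t'" "\<bar>\<tau> - t2\<bar> < d" using d(1) \<open>t2 < t'\<close> by (auto simp: \<tau>_def min_def field_simps)
    then have "y \<tau> \<in> U" "g (y \<tau>) \<in> {0<..<ep} \<times> {m-ep<..<b2+ep}" using d(2)[of \<tau>] t m by (auto simp: mem_Times_iff)
    then have "y \<tau> \<in> Rp" unfolding Rp_def using sigma_g by (metis image_eqI)
    moreover have "y \<tau> \<in> Y" unfolding Y_def using \<tau> by (intro imageI) simp
    ultimately show ?thesis by blast
  qed
  have YRm: "Y \<inter> Rm \<noteq> {}"
  proof -
    obtain d where d: "d > 0" "\<And>\<tau>. \<lbrakk>\<tau> \<ge> 0; \<bar>\<tau> - t'\<bar> < d\<rbrakk> \<Longrightarrow> y \<tau> \<in> U \<and> \<bar>fst (g (y \<tau>))\<bar> < em \<and>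
       \<bar>snd (g (y \<tau>)) - b'\<bar> < em \<and> (\<tau> < t' \<longrightarrow> fst (g (y \<tau>)) < 0)"
      using near[OF _ b'(3), of em] t b rho em(1) tt' d2(1) b' by (smt (verit))
    define \<tau> where "\<tau> = t' - min d (t' - t2) / 2"
    have \<tau>: "t2 < \<tau>" "\<tau> < t'" "\<bar>\<tau> - t'\<bar> < d" using d(1) \<open>t2 < t'\<close> by (auto simp: \<tau>_def min_def field_simps)
    then have "y \<tau> \<in> U" "g (y \<tau>) \<in> {-em<..<0} \<times> {min b' m - em<..<max b' m + em}"
      using d(2)[of \<tau>] t m by (auto simp: mem_Times_iff)
    then have "y \<tau> \<in> Rm" unfolding Rm_def using sigma_g by (metis image_eqI)
    moreover have "y \<tau> \<in> Y" unfolding Y_def using \<tau> by (intro imageI) simp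
    ultimately show ?thesis by blast
  qed
  have dich: "X \<subseteq> A \<or> X \<subseteq> B" if "connected X" "X \<subseteq> S" "X \<inter> J = {}" for X
    by (rule connected_dichotomy[OF that(1) _ AB(3,1,2)]) (use that AB(4) in blast)
  have "Rp \<subseteq> S" "Rm \<subseteq> S" using Rp_pos(2) Rm_neg(2) US by blast+
  note D = dich[OF Rp_conn \<open>Rp \<subseteq> S\<close> Rp_J] dich[OF Rm_conn \<open>Rm \<subseteq> S\<close> Rm_J]
  have "Y \<subseteq> A \<or> Y \<subseteq> B" using dich[OF Yc] YJ by blast
  then have "Rp \<union> Rm \<subseteq> A \<or> Rp \<union> Rm \<subseteq> B" using D YRp YRm AB(3) by blast
  moreover obtain p q where "p \<in> A" "p \<in> Rp \<union> Rm" "q \<in> B" "q \<in> Rp \<union> Rm"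
    using meets[of A] meets[of B] AB by blast
  ultimately show False using AB(3) by blast
qed

text \<open>Between a visit near \<beta>1 and the next crossing near or above \<beta>2 there are two
  consecutive crossings with increasing arc coordinate. Trapping keeps all later crossings above the
  second one, which excludes another visit near \<beta>1.\<close>

lemma no_two_recurrent_crossings:
  assumes inj: "inj_on y {0..}" and \<beta>: "-\<rho> < \<beta>1" "\<beta>1 < \<beta>2" "\<beta>2 < \<rho>"
    and rec: "\<And>\<delta> T \<beta>. \<lbrakk>\<delta> > 0; \<beta> \<in> {\<beta>1, \<beta>2}\<rbrakk> \<Longrightarrow> \<exists>t\<ge>T. \<exists>b. t \<ge> 0 \<and> \<bar>b - \<beta>\<bar> < \<delta> \<and> y t = \<sigma> (0,b)"
  shows False
proof -
  \<comment> \<open>Makes the windows of radius \<delta> about \<beta>1 and \<beta>2 disjoint and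
    keeps them within the part \<bar>b\<bar> \<le> \<rho> of the arc.\<close>
  define \<delta> where "\<delta> = min (min (\<beta>1 + \<rho>) (\<rho> - \<beta>2)) ((\<beta>2 - \<beta>1) / 2)"
  have \<delta>: "\<delta> > 0" "\<delta> \<le> \<beta>1 + \<rho>" "\<delta> \<le> \<rho> - \<beta>2" "\<beta>1 + \<delta> \<le> \<beta>2 - \<delta>" using \<beta> by (auto simp: \<delta>_def min_def field_simps)
  obtain s bs where s: "s \<ge> 0" "\<bar>bs - \<beta>1\<bar> < \<delta>" "y s = \<sigma> (0,bs)" using rec[OF \<delta>(1), of \<beta>1 0] by auto
  obtain t2 b2 where t2: "t2 \<ge> s + 1" "\<bar>b2 - \<beta>2\<bar> < \<delta>" "y t2 = \<sigma> (0,b2)" using rec[OF \<delta>(1), of \<beta>2 "s+1"] by auto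
  have sinj: "b = b'" if "\<sigma> (0,b) = \<sigma> (0,b')" "\<bar>b\<bar> \<le> \<rho>" "\<bar>b'\<bar> \<le> \<rho>" for b b'
    using sigma_inj[of "(0,b)" "(0,b')"] that rho by (auto simp: abs_le_iff)
  have gs: "g (\<sigma> (0,b)) = (0,b)" if "\<bar>b\<bar> \<le> \<rho>" for b
    by (rule g_sigma) (use that rho in auto)
  define W where "W = {t\<in>{s..t2}. \<exists>b\<in>{\<beta>2-\<delta>..\<rho>}. y t = \<sigma> (0,b)}"
  have "t2 \<in> W" using t2 \<delta> by (auto simp: W_def intro!: bexI[of _ b2])
  moreover have "compact W" unfolding W_def by (rule compact_crossings) (use s \<delta> \<beta> in auto)
  ultimately obtain t' where t': "t' \<in> W" "\<And>\<tau>. \<tau> \<in> W \<Longrightarrow> t' \<le> \<tau>"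
    using compact_attains_inf[of W] by blast
  then obtain b' where b': "\<beta>2 - \<delta> \<le> b'" "b' \<le> \<rho>" "y t' = \<sigma> (0,b')" and tt': "s \<le> t'" "t' \<le> t2"
    by (auto simp: W_def)
  have "t' \<noteq> s"
  proof
    assume "t' = s"
    moreover have "\<bar>b'\<bar> \<le> \<rho>" "\<bar>bs\<bar> \<le> \<rho>" using b' s \<delta> \<beta> by auto
    ultimately have "b' = bs" using b' s sinj by metis
    then show False using b' s \<delta> by auto
  qed
  obtain d where d: "d > 0" "\<And>\<tau>. \<lbrakk>\<tau> \<ge> 0; \<bar>\<tau> - t'\<bar> < d\<rbrakk> \<Longrightarrow> \<tau> < t' \<longrightarrow> fst (g (y \<tau>)) < 0"
    using near[OF _ b'(3), of 1] s tt' b' rho \<delta> \<beta> by (smt (verit))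
  have nocross: "y \<tau> \<noteq> \<sigma> (0,b)" if "\<tau> \<ge> 0" "t' - d < \<tau>" "\<tau> < t'" "\<bar>b\<bar> \<le> \<rho>" for \<tau> b
    using d(2)[of \<tau>] that gs[of b] by auto
  \<comment> \<open>No crossing falls into the last stretch of length \<open>d\<close> before
    \<open>t'\<close>, so ending the time range at \<open>t' - d\<close> loses none and a last
    crossing \<open>t''\<close> before \<open>t'\<close> exists. It lies below the upper window
    because \<open>t'\<close> is the first crossing at or above
    \<open>\<beta>2 - \<delta>\<close>.\<close>
  define W2 where "W2 = {t\<in>{s..t'-d}. \<exists>b\<in>{-\<rho>..\<rho>}. y t = \<sigma> (0,b)}"
  have "s \<in> W2" using s \<delta> \<beta> nocross[of s bs] tt' \<open>t' \<noteq> s\<close> by (force simp: W2_def)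
  moreover have "compact W2" unfolding W2_def by (rule compact_crossings) (use s in auto)
  ultimately obtain t'' where t'': "t'' \<in> W2" "\<And>\<tau>. \<tau> \<in> W2 \<Longrightarrow> \<tau> \<le> t''"
    using compact_attains_sup[of W2] by blast
  then obtain b'' where b'': "-\<rho> \<le> b''" "b'' \<le> \<rho>" "y t'' = \<sigma> (0,b'')" and tt'': "s \<le> t''" "t'' \<le> t' - d"
    by (auto simp: W2_def)
  have "b'' < \<beta>2 - \<delta>"
  proof (rule ccontr)
    assume "\<not> b'' < \<beta>2 - \<delta>"
    then have "t'' \<in> W" using b'' tt'' tt' d(1) by (auto simp: W_def)
    then show False using t'(2)[of t''] tt'' d(1) by auto
  qed
  obtain t3 b3 where t3: "t3 \<ge> t' + 1" "\<bar>b3 - \<beta>1\<bar> < \<delta>" "y t3 = \<sigma> (0,b3)" using rec[OF \<delta>(1), of \<beta>1 "t'+1"] by auto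
  have "b' < b3"
  proof (rule trap[OF inj, of t'' t' t3 b'' b' b3])
    fix \<tau> b assume \<tau>: "t'' < \<tau>" "\<tau> < t'" and b: "\<bar>b\<bar> \<le> \<rho>"
    show "y \<tau> \<noteq> \<sigma> (0,b)"
    proof (cases "t' - d < \<tau>")
      case True then show ?thesis using nocross \<tau> b tt'' s by auto
    next
      case False
      have "\<tau> \<notin> W2" using t''(2) \<tau> by fastforce
      then show ?thesis using False \<tau> b tt'' by (auto simp: W2_def abs_le_iff)
    qed
  qed (use s tt'' tt' d(1) t3 b' b'' \<open>b'' < \<beta>2 - \<delta>\<close> \<delta> \<beta> in auto)
  then show False using b' t3 \<delta> by auto
qed

end

section \<open>Periodic weak solutions on the sphere\<close>

text \<open>The direction is that of the point of the convex hull nearest to 0. It is tangent at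
  \<open>z\<close> because the hull lies in the tangent plane. At \<open>z\<close> the fields have
  component at least \<open>2 * c\<close> along it, and half of this survives nearby by
  continuity.\<close>

lemma transversal_direction:
  fixes \<Psi> :: "nat \<Rightarrow> 'a::euclidean_space \<Rightarrow> 'a"
  assumes "1 \<le> N" and \<Psi>: "\<And>i. i \<in> {1..N} \<Longrightarrow> continuous_on Z (\<Psi> i)" and z: "z \<in> Z"
    and tang: "\<And>i. i \<in> {1..N} \<Longrightarrow> \<Psi> i z \<bullet> z = 0"
    and no0: "0 \<notin> convex hull ((\<lambda>i. \<Psi> i z) ` {1..N})"
  obtains v c r where "norm v = 1" "v \<bullet> z = 0" "c > 0" "r > 0"
    "\<And>z' i. \<lbrakk>z' \<in> Z; dist z' z < r; i \<in> {1..N}\<rbrakk> \<Longrightarrow> c \<le> v \<bullet> \<Psi> i z'"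
proof -
  let ?H = "convex hull ((\<lambda>i. \<Psi> i z) ` {1..N})"
  have H: "closed ?H" "convex ?H" "?H \<noteq> {}"
    using \<open>1 \<le> N\<close> by (auto simp: finite_imp_compact_convex_hull compact_imp_closed)
  define a where "a = closest_point ?H 0"
  have a: "a \<in> ?H" unfolding a_def by (rule closest_point_in_set[OF H(1,3)])
  then have a0: "norm a > 0" using no0 by auto
  have ax: "a \<bullet> a \<le> a \<bullet> x" if "x \<in> ?H" for x
    using closest_point_dot[OF H(2,1) that, of 0] unfolding a_def[symmetric] by (simp add: inner_diff_right)
  have "z \<bullet> \<Psi> i z = 0" if "i \<in> {1..N}" for i using tang[OF that] by (simp add: inner_commute)
  then have "?H \<subseteq> {x. z \<bullet> x = 0}"
    using convex_hyperplane[of z 0] by (intro hull_minimal) auto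
  then have az: "a \<bullet> z = 0" using a by (auto simp: inner_commute)
  define v where "v = (1 / norm a) *\<^sub>R a"
  define c where "c = norm a / 2"
  have v: "norm v = 1" "v \<bullet> z = 0" and c: "c > 0" using a0 az by (auto simp: v_def c_def)
  have v\<Psi>: "2 * c \<le> v \<bullet> \<Psi> i z" if i: "i \<in> {1..N}" for i
  proof -
    have "a \<bullet> a \<le> a \<bullet> \<Psi> i z" using i by (intro ax hull_inc) auto
    then show ?thesis using a0 by (simp add: v_def c_def field_simps power2_norm_eq_inner[symmetric] power2_eq_square)
  qed
  have "\<exists>r>0. \<forall>z'\<in>Z. dist z' z < r \<longrightarrow> dist (\<Psi> i z') (\<Psi> i z) < c" if "i \<in> {1..N}" for i
    using \<Psi>[OF that] z c unfolding continuous_on_iff by blast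
  then obtain \<rho> where \<rho>: "\<And>i. i \<in> {1..N} \<Longrightarrow> \<rho> i > 0"
    "\<And>i z'. \<lbrakk>i \<in> {1..N}; z' \<in> Z; dist z' z < \<rho> i\<rbrakk> \<Longrightarrow> dist (\<Psi> i z') (\<Psi> i z) < c" by metis
  define r where "r = Min (\<rho> ` {1..N})"
  have r: "r > 0" "\<And>i. i \<in> {1..N} \<Longrightarrow> r \<le> \<rho> i"
    using \<rho>(1) \<open>1 \<le> N\<close> by (auto simp: r_def)
  show thesis
  proof (rule that[OF v c r(1)])
    fix z' i assume z': "z' \<in> Z" "dist z' z < r" and i: "i \<in> {1..N}"
    then have "norm (\<Psi> i z' - \<Psi> i z) < c" using \<rho>(2)[OF i] r(2)[OF i] by (auto simp: dist_norm)
    then have "\<bar>v \<bullet> (\<Psi> i z' - \<Psi> i z)\<bar> \<le> c"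
      using Cauchy_Schwarz_ineq2[of v "\<Psi> i z' - \<Psi> i z"] v by simp
    then show "c \<le> v \<bullet> \<Psi> i z'" using v\<Psi>[OF i] by (simp add: inner_diff_right abs_le_iff)
  qed
qed

text \<open>The chart is the inverse of the orthogonal projection to the tangent plane at
  \<open>z\<close>, with axes \<open>v\<close> and the cross product of \<open>z\<close> and
  \<open>v\<close>. Its first coordinate is exactly \<open>v \<bullet> u\<close>, the quantity that
  increases along solutions.\<close>

lemma sphere_chart:
  fixes z v :: "real^3"
  assumes z: "norm z = 1" and v: "norm v = 1" "v \<bullet> z = 0" and "r > 0"
  obtains R U \<sigma> g where "0 < R" "homeomorphism ({-R<..<R} \<times> {-R<..<R}) U \<sigma> g"
    "openin (top_of_set (sphere 0 1)) U" "U \<subseteq> ball z r" "\<And>u. fst (g u) = v \<bullet> u" "\<sigma> (0,0) = z"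
proof -
  define w where "w = cross3 z v"
  have "(norm w)\<^sup>2 = 1" unfolding w_def norm_cross using z v by (simp add: inner_commute)
  then have w: "w \<bullet> w = 1" by (simp add: power2_norm_eq_inner)
  have wz: "w \<bullet> z = 0" "w \<bullet> v = 0" by (simp_all add: w_def dot_cross_self)
  have zz: "z \<bullet> z = 1" "v \<bullet> v = 1" using z v by (simp_all add: norm_eq_1)
  have comm: "z \<bullet> v = 0" "z \<bullet> w = 0" "v \<bullet> w = 0" using v(2) wz by (simp_all add: inner_commute)
  note ip = w wz zz comm v(2)
  have expand: "u = (u \<bullet> z) *\<^sub>R z + (u \<bullet> v) *\<^sub>R v + (u \<bullet> w) *\<^sub>R w" for u
  proof -
    have ne: "z \<noteq> v" "z \<noteq> w" "v \<noteq> w" using ip by auto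
    have nz: "z \<noteq> 0" "v \<noteq> 0" "w \<noteq> 0" using ip by auto
    have orth: "pairwise orthogonal {z, v, w}" using ip by (auto simp: pairwise_def orthogonal_def)
    then have ind: "independent {z, v, w}" using nz by (intro pairwise_orthogonal_independent) auto
    have "(UNIV :: (real^3) set) \<subseteq> span {z, v, w}"
      by (rule card_ge_dim_independent[OF _ ind]) (use ne in \<open>auto\<close>)
    then have "u \<in> span {z, v, w}" by auto
    then have "(\<Sum>b\<in>{z, v, w}. (u \<bullet> b) *\<^sub>R b) = u"
      by (intro orthonormal_basis_expand[OF orth]) (use z v w in \<open>auto simp: norm_eq_1\<close>)
    then show ?thesis using ne by (simp add: add.assoc)
  qed
  define \<sigma> where "\<sigma> p = fst p *\<^sub>R v + snd p *\<^sub>R w + sqrt (1 - (fst p)\<^sup>2 - (snd p)\<^sup>2) *\<^sub>R z" for p :: "real \<times> real"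
  define g where "g u = (v \<bullet> u, w \<bullet> u)" for u
  have c\<sigma>: "continuous_on UNIV \<sigma>" unfolding \<sigma>_def by (intro continuous_intros)
  have \<sigma>0: "\<sigma> (0,0) = z" by (simp add: \<sigma>_def)
  obtain d where d: "d > 0" "\<And>p. dist p (0,0) < d \<Longrightarrow> dist (\<sigma> p) z < r"
    using c\<sigma> \<open>r > 0\<close> \<sigma>0 unfolding continuous_on_iff by (metis UNIV_I)
  \<comment> \<open>The bound 1/2 keeps the radicand positive, and \<open>d / 2\<close> keeps the
    square within distance \<open>d\<close> of the origin.\<close>
  define R where "R = min (1/2) (d/2)"
  have R: "0 < R" "R \<le> 1/2" "R \<le> d/2" using d by (auto simp: R_def)
  let ?Q = "{-R<..<R} \<times> {-R<..<R}"
  have Qd: "dist p (0,0) < d" if "p \<in> ?Q" for p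
  proof -
    have "dist p (0,0) \<le> \<bar>fst p\<bar> + \<bar>snd p\<bar>"
      using sqrt_sum_squares_le_sum_abs[of "fst p" "snd p"] by (cases p) (simp add: dist_Pair_Pair dist_real_def)
    then show ?thesis using that R by auto
  qed
  have sq: "a\<^sup>2 < 1/4" if "a \<in> {-R<..<R}" for a
  proof -
    have "\<bar>a\<bar> < 1/2" using that R by auto
    then have "\<bar>a\<bar>\<^sup>2 < (1/2)\<^sup>2" by (intro power_strict_mono) auto
    then show ?thesis by (simp add: power2_eq_square)
  qed
  have Qs: "1 - (fst p)\<^sup>2 - (snd p)\<^sup>2 > 0" if "p \<in> ?Q" for p
    using sq[of "fst p"] sq[of "snd p"] that by auto
  have z\<sigma>: "z \<bullet> \<sigma> p = sqrt (1 - (fst p)\<^sup>2 - (snd p)\<^sup>2)" for p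
    using ip by (simp add: \<sigma>_def inner_add_right)
  have g\<sigma>: "g (\<sigma> p) = p" for p
    using ip by (simp add: \<sigma>_def g_def inner_add_right)
  have n\<sigma>: "norm (\<sigma> p) = 1" if "p \<in> ?Q" for p
  proof -
    have "\<sigma> p \<bullet> \<sigma> p = (fst p)\<^sup>2 + (snd p)\<^sup>2 + (sqrt (1 - (fst p)\<^sup>2 - (snd p)\<^sup>2))\<^sup>2"
      using ip by (simp add: \<sigma>_def inner_add_right inner_add_left power2_eq_square)
    also have "\<dots> = 1" using Qs[OF that] by simp
    finally show ?thesis by (simp add: norm_eq_1)
  qed
  have \<sigma>g: "\<sigma> (g u) = u" if u: "norm u = 1" "z \<bullet> u > 0" for u
  proof -
    have "1 = u \<bullet> u" using u by (simp add: norm_eq_1)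
    also have "\<dots> = u \<bullet> ((u \<bullet> z) *\<^sub>R z + (u \<bullet> v) *\<^sub>R v + (u \<bullet> w) *\<^sub>R w)" by (subst expand[of u, symmetric]) (rule refl)
    also have "\<dots> = (z \<bullet> u)\<^sup>2 + (v \<bullet> u)\<^sup>2 + (w \<bullet> u)\<^sup>2"
      by (simp add: inner_add_right power2_eq_square inner_commute)
    finally have "1 - (v \<bullet> u)\<^sup>2 - (w \<bullet> u)\<^sup>2 = (z \<bullet> u)\<^sup>2" by simp
    then have "sqrt (1 - (v \<bullet> u)\<^sup>2 - (w \<bullet> u)\<^sup>2) = z \<bullet> u" using u by simp
    then show ?thesis using expand[of u] by (simp add: \<sigma>_def g_def inner_commute add.commute add.left_commute)
  qed
  define U where "U = \<sigma> ` ?Q"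
  have U_eq: "U = sphere 0 1 \<inter> ({u. 0 < z \<bullet> u} \<inter> g -` ?Q)"
  proof (intro set_eqI iffI)
    fix u assume "u \<in> U"
    then obtain p where "p \<in> ?Q" "u = \<sigma> p" by (auto simp: U_def)
    then show "u \<in> sphere 0 1 \<inter> ({u. 0 < z \<bullet> u} \<inter> g -` ?Q)" using z\<sigma> g\<sigma> n\<sigma> Qs by (simp add: real_sqrt_gt_zero)
  next
    fix u assume "u \<in> sphere 0 1 \<inter> ({u. 0 < z \<bullet> u} \<inter> g -` ?Q)"
    then show "u \<in> U" using \<sigma>g[of u] by (force simp: U_def)
  qed
  have cg: "continuous_on UNIV g" unfolding g_def by (intro continuous_intros)
  show thesis
  proof (rule that[OF R(1)])
    show "homeomorphism ?Q U \<sigma> g"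
      by (rule homeomorphismI)
        (use g\<sigma> \<sigma>g U_eq in \<open>auto simp: U_def intro: continuous_on_subset[OF c\<sigma>] continuous_on_subset[OF cg]\<close>)
    have "open ({u. 0 < z \<bullet> u} \<inter> g -` ?Q)"
      by (intro open_Int open_halfspace_gt open_vimage open_Times cg) auto
    then show "openin (top_of_set (sphere 0 1)) U" unfolding U_eq by (rule openin_open_Int)
    show "U \<subseteq> ball z r" using d(2)[OF Qd] by (auto simp: U_def dist_commute)
  qed (use \<sigma>0 in \<open>auto simp: g_def\<close>)
qed

text \<open>A half space that contains all the vectors \<open>\<Psi> i z\<close> contains their hull
  and therefore 0, so its level \<open>c\<close> is at most 0.\<close>

lemma weak_sol_const:
  assumes "z \<in> Z" "0 \<in> convex hull ((\<lambda>i. \<Psi> i z) ` {1..N})"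
  shows "weak_sol Z N \<Psi> (\<lambda>_. z)"
  unfolding weak_sol_def
proof (intro conjI allI impI; (elim conjE)?)
  fix v c s t assume st: "0 \<le> (s::real)" "s \<le> t" and c: "\<forall>\<tau>\<in>{s..t}. \<forall>i\<in>{1..N}. c \<le> v \<bullet> \<Psi> i z"
  have "convex hull ((\<lambda>i. \<Psi> i z) ` {1..N}) \<subseteq> {x. v \<bullet> x \<ge> c}"
    by (rule hull_minimal) (use c st in \<open>auto simp: convex_halfspace_ge\<close>)
  then have "c \<le> 0" using assms(2) by auto
  then show "c * (t - s) \<le> v \<bullet> (z - z)" using st by (simp add: mult_nonpos_nonneg)
qed (use assms in auto)

theorem weak_poincare_bendixson:
  fixes Z :: "(real^3) set"
  assumes Zs: "Z \<subseteq> sphere 0 1" and Z: "compact Z" and N: "1 \<le> N"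
    and \<Psi>: "\<And>i. i \<in> {1..N} \<Longrightarrow> continuous_on Z (\<Psi> i)"
    and tang: "\<And>i z. i \<in> {1..N} \<Longrightarrow> z \<in> Z \<Longrightarrow> \<Psi> i z \<bullet> z = 0"
    and x: "weak_sol Z N \<Psi> x"
  obtains y p where "p > 0" "weak_sol Z N \<Psi> y" "\<And>t. t \<ge> 0 \<Longrightarrow> y (t + p) = y t"
    "\<And>t. t \<ge> 0 \<Longrightarrow> y t \<in> omega_limit x"
proof -
  note result = that
  note in_omega = weak_sol_in_omega_limit[of Z N \<Psi>, OF Z \<Psi>]
  obtain y1 where y1: "weak_sol Z N \<Psi> y1" "\<And>t. t \<ge> 0 \<Longrightarrow> y1 t \<in> omega_limit x"
    using in_omega[OF _ x] by blast
  obtain y2 where y2: "weak_sol Z N \<Psi> y2" "\<And>t. t \<ge> 0 \<Longrightarrow> y2 t \<in> omega_limit y1"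
    using in_omega[OF _ y1(1)] by blast
  obtain y3 where y3: "weak_sol Z N \<Psi> y3" "\<And>t. t \<ge> 0 \<Longrightarrow> y3 t \<in> omega_limit y2"
    using in_omega[OF _ y2(1)] by blast
  define z where "z = y3 0"
  have om1: "omega_limit y1 \<subseteq> omega_limit x"
    by (rule omega_limit_subset[OF closed_omega_limit y1(2)])
  have om2: "omega_limit y2 \<subseteq> omega_limit y1"
    by (rule omega_limit_subset[OF closed_omega_limit y2(2)])
  have z\<omega>: "z \<in> omega_limit y2" and zZ: "z \<in> Z" using y3 weak_solD1[OF y3(1)] by (auto simp: z_def)
  \<comment> \<open>It now suffices to exhibit one solution inside the omega-limit set of
    \<open>x\<close> that passes through some point twice.\<close>
  have finish: thesis if "weak_sol Z N \<Psi> y" "\<And>t. t \<ge> 0 \<Longrightarrow> y t \<in> omega_limit x" "\<not> inj_on y {0..}" for y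
  proof -
    obtain s t where st: "0 \<le> s" "s < t" "y s = y t"
    proof -
      obtain a b where "0 \<le> a" "0 \<le> b" "a \<noteq> b" "y a = y b" using \<open>\<not> inj_on y {0..}\<close> by (auto simp: inj_on_def)
      then show thesis using that[of a b] that[of b a] by (cases "a < b") auto
    qed
    obtain p E where E: "p > 0" "weak_sol Z N \<Psi> E" "\<And>\<tau>. \<tau> \<ge> 0 \<Longrightarrow> E (\<tau> + p) = E \<tau>" "E ` {0..} \<subseteq> y ` {0..}"
      by (rule weak_sol_periodic_extension[OF \<open>weak_sol Z N \<Psi> y\<close> st], rule that)
    show thesis
    proof (rule result[OF E(1,2,3)])
      fix t :: real assume "t \<ge> 0"
      then have "E t \<in> y ` {0..}" using E(4) by auto
      then show "E t \<in> omega_limit x" using \<open>\<And>t. t \<ge> 0 \<Longrightarrow> y t \<in> omega_limit x\<close> by auto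
    qed
  qed
  show thesis
  proof (cases "0 \<in> convex hull ((\<lambda>i. \<Psi> i z) ` {1..N})")
    case True
    show thesis
      by (rule result[OF zero_less_one weak_sol_const[of z Z \<Psi> N, OF zZ True]]) (use z\<omega> om1 om2 in auto)
  next
    case False
    obtain v c r where v: "norm v = 1" "v \<bullet> z = 0" and c: "c > 0" and r: "r > 0" and
      trans: "\<And>z' i. \<lbrakk>z' \<in> Z; dist z' z < r; i \<in> {1..N}\<rbrakk> \<Longrightarrow> c \<le> v \<bullet> \<Psi> i z'"
      using transversal_direction[of N Z \<Psi> z, OF N \<Psi> zZ tang[OF _ zZ] False] by blast
    have "norm z = 1" using zZ Zs by auto
    then obtain R U \<sigma> g where R: "0 < R" and hom: "homeomorphism ({-R<..<R} \<times> {-R<..<R}) U \<sigma> g"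
      and oU: "openin (top_of_set (sphere 0 1)) U" and Ub: "U \<subseteq> ball z r" and gv: "\<And>u. fst (g u) = v \<bullet> u"
      and \<sigma>0: "\<sigma> (0,0) = z"
      using sphere_chart[OF _ v r] by blast
    interpret jordan_chart "sphere 0 1" U \<sigma> g R "R/2"
      by standard (use jordan_space_sphere[where 'a="real^3"] hom oU R in auto)
    obtain L where L: "L > 0"
      "\<And>y s t. \<lbrakk>weak_sol Z N \<Psi> y; 0 \<le> s; 0 \<le> t\<rbrakk> \<Longrightarrow> norm (y t - y s) \<le> L * \<bar>t - s\<bar>"
      using weak_sol_lipschitz[of Z N \<Psi>, OF Z \<Psi>] by blast
    have yS: "y t \<in> sphere 0 1" if "weak_sol Z N \<Psi> y" "t \<ge> 0" for y t
      using weak_solD1[OF that] Zs by blast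
    have conty: "continuous_on {0..} y" if "weak_sol Z N \<Psi> y" for y
      by (rule lipschitz_on_continuous_on[of L], rule lipschitz_onI)
         (use L that in \<open>auto simp: dist_norm norm_minus_commute abs_minus_commute\<close>)
    have mono: "c * (t - s) \<le> v \<bullet> y t - v \<bullet> y s"
      if y: "weak_sol Z N \<Psi> y" "0 \<le> s" "s \<le> t" "y ` {s..t} \<subseteq> U" for y s t
    proof -
      have "c * (t - s) \<le> v \<bullet> (y t - y s)"
      proof (rule weak_solD2[OF y(1-3)])
        fix \<tau> i assume "\<tau> \<in> {s..t}" "i \<in> {1..N}"
        moreover then have "y \<tau> \<in> ball z r" using y(4) Ub by blast
        then have "dist (y \<tau>) z < r" by (simp add: dist_commute)
        ultimately show "c \<le> v \<bullet> \<Psi> i (y \<tau>)" using trans weak_solD1[OF y(1)] y(2) by auto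
      qed
      then show ?thesis by (simp add: inner_diff_right)
    qed
    \<comment> \<open>An arc point in the omega-limit set is approached at arbitrarily late times,
      and the positive speed across the arc turns each close approach into a genuine crossing
      nearby.\<close>
    have cross: "\<exists>t\<ge>T. \<exists>b. t \<ge> 0 \<and> \<bar>b - \<beta>\<bar> < \<delta> \<and> y t = \<sigma> (0,b)"
      if y: "weak_sol Z N \<Psi> y" and \<beta>: "\<bar>\<beta>\<bar> < R" "\<sigma> (0,\<beta>) \<in> omega_limit y" and \<delta>: "\<delta> > 0" for y \<beta> \<delta> T
    proof -
      define q where "q = \<sigma> (0,\<beta>)"
      have Q0: "(0,\<beta>) \<in> {-R<..<R} \<times> {-R<..<R}" using \<beta>(1) R by auto
      have qU: "q \<in> U" and gq: "g q = (0,\<beta>)" unfolding q_def using sigma_U[OF Q0] g_sigma[OF Q0] by auto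
      obtain V where V: "open V" "U = sphere 0 1 \<inter> V" using oU by (auto simp: openin_open)
      obtain d1 where d1: "d1 > 0" "ball q d1 \<subseteq> V" using V qU open_contains_ball by blast
      obtain d2 where d2: "d2 > 0" "\<And>u. u \<in> U \<Longrightarrow> dist u q < d2 \<Longrightarrow> dist (g u) (g q) < \<delta>"
        using cont_g qU \<delta> unfolding continuous_on_iff by metis
      define \<eta>0 where "\<eta>0 = min d1 d2"
      have \<eta>0: "\<eta>0 > 0" using d1 d2 by (simp add: \<eta>0_def)
      have inU: "u \<in> U" "\<bar>snd (g u) - \<beta>\<bar> < \<delta>" if u: "u \<in> sphere 0 1" "dist u q < \<eta>0" for u
      proof -
        show "u \<in> U" using u d1(2) V(2) by (auto simp: \<eta>0_def dist_commute subset_eq)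
        then have "dist (g u) (g q) < \<delta>" using d2(2) u(2) by (simp add: \<eta>0_def)
        then show "\<bar>snd (g u) - \<beta>\<bar> < \<delta>"
          using dist_snd_le[of "g u" "g q"] gq by (simp add: dist_real_def)
      qed
      \<comment> \<open>During time \<tau> before or after \<open>t\<close> a solution moves by at
        most \<open>\<eta>0 / 2\<close> and so remains in the chart. In each of these two stretches
        \<open>v \<bullet> y\<close> gains at least \<open>c * \<tau>\<close>, while at time
        \<open>t\<close> it is closer to 0 than that; hence it vanishes in between.\<close>
      define \<tau> where "\<tau> = \<eta>0 / (2 * L)"
      have \<tau>: "\<tau> > 0" "L * \<tau> = \<eta>0 / 2" using \<eta>0 L(1) by (auto simp: \<tau>_def)
      obtain t where t: "t \<ge> max T 0 + \<tau>" "dist (y t) q < min (\<eta>0 / 2) (c * \<tau>)"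
        using omega_limit_recurrent[OF \<beta>(2), of "min (\<eta>0 / 2) (c * \<tau>)" "max T 0 + \<tau>"] \<eta>0 c \<tau>(1) by (auto simp: q_def)
      have close: "dist (y s) q < \<eta>0" if s: "s \<in> {t-\<tau>..t+\<tau>}" for s
      proof -
        have "norm (y s - y t) \<le> L * \<bar>s - t\<bar>" by (rule L(2)[OF y]) (use t s \<tau> in auto)
        also have "\<dots> \<le> L * \<tau>" using s L(1) by (intro mult_left_mono) auto
        finally have "dist (y s) (y t) \<le> \<eta>0 / 2" using \<tau>(2) by (simp add: dist_norm)
        then show ?thesis using t(2) dist_triangle[of "y s" q "y t"] by simp
      qed
      have ysU: "y s \<in> U" "\<bar>snd (g (y s)) - \<beta>\<bar> < \<delta>" if "s \<in> {t-\<tau>..t+\<tau>}" for s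
        using inU[OF yS[OF y, of s] close[OF that]] that t(1) by auto
      have "v \<bullet> q = 0" using gv[of q] gq by simp
      then have vy: "\<bar>v \<bullet> y t\<bar> < c * \<tau>"
        using Cauchy_Schwarz_ineq2[of v "y t - q"] v(1) t(2) by (simp add: inner_diff_right dist_norm)
      have "c * (t + \<tau> - t) \<le> v \<bullet> y (t + \<tau>) - v \<bullet> y t"
        by (rule mono[OF y]) (use t(1) \<tau>(1) ysU in auto)
      then have up: "v \<bullet> y (t + \<tau>) \<ge> 0" using vy by simp
      have "c * (t - (t - \<tau>)) \<le> v \<bullet> y t - v \<bullet> y (t - \<tau>)"
        by (rule mono[OF y]) (use t(1) \<tau>(1) ysU in auto)
      then have lo: "v \<bullet> y (t - \<tau>) \<le> 0" using vy by simp
      have "continuous_on {t-\<tau>..t+\<tau>} (\<lambda>s. v \<bullet> y s)"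
        by (intro continuous_intros continuous_on_subset[OF conty[OF y]]) (use t(1) in auto)
      then obtain s where s: "t - \<tau> \<le> s" "s \<le> t + \<tau>" "v \<bullet> y s = 0"
        using IVT'[of "\<lambda>s. v \<bullet> y s", OF lo up] \<tau>(1) by auto
      then have "y s \<in> U" "\<bar>snd (g (y s)) - \<beta>\<bar> < \<delta>" using ysU by auto
      moreover have "g (y s) = (0, snd (g (y s)))" using gv[of "y s"] s(3) by (metis prod.collapse)
      ultimately have "y s = \<sigma> (0, snd (g (y s)))" using sigma_g by metis
      then show ?thesis using s t(1) \<open>\<bar>snd (g (y s)) - \<beta>\<bar> < \<delta>\<close> by (intro exI[of _ s]) auto
    qed
    \<comment> \<open>As values of \<open>y2\<close>, both crossing points belong to the omega-limit
      set of \<open>y1\<close>. The bound \<open>R / 2\<close> is the \<rho> of the chart.\<close>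
    obtain s b where s: "s \<ge> 0" "\<bar>b\<bar> < R/2" "y2 s = \<sigma> (0,b)"
      using cross[OF y2(1), of 0 "R/2" 0] z\<omega> \<sigma>0 R by auto
    obtain s' b' where s': "s' \<ge> s + 1" "\<bar>b'\<bar> < R/2" "y2 s' = \<sigma> (0,b')"
      using cross[OF y2(1), of 0 "R/2" "s + 1"] z\<omega> \<sigma>0 R by auto
    show thesis
    proof (cases "b = b'")
      case True
      have "\<not> inj_on y2 {0..}"
      proof
        assume "inj_on y2 {0..}"
        then have "s = s'" by (rule inj_onD) (use s s' True in auto)
        then show False using s' by simp
      qed
      then show thesis using y2(2) om1 by (intro finish[OF y2(1)]) auto
    next
      case False
      have "\<not> inj_on y1 {0..}"
      proof
        assume inj: "inj_on y1 {0..}"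
        interpret transversal_trajectory "sphere 0 1" U \<sigma> g R "R/2" y1
        proof
          fix s t :: real assume "0 \<le> s" "s < t" "y1 ` {s..t} \<subseteq> U"
          moreover then have "c * (t - s) > 0" using c by simp
          ultimately show "fst (g (y1 s)) < fst (g (y1 t))" using mono[OF y1(1), of s t] by (simp add: gv)
        qed (use conty[OF y1(1)] yS[OF y1(1)] in auto)
        have rec: "\<exists>t\<ge>T. \<exists>b. t \<ge> 0 \<and> \<bar>b - \<beta>\<bar> < \<delta> \<and> y1 t = \<sigma> (0,b)" if "\<delta> > 0" "\<beta> \<in> {b, b'}" for \<delta> T \<beta>
        proof (rule cross[OF y1(1) _ _ that(1)])
          show "\<bar>\<beta>\<bar> < R" using that(2) s(2) s'(2) R by auto
          show "\<sigma> (0,\<beta>) \<in> omega_limit y1" using that(2) s s' y2(2)[of s] y2(2)[of s'] by auto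
        qed
        show False
          by (rule no_two_recurrent_crossings[OF inj, of "min b b'" "max b b'"])
             (use s(2) s'(2) False rec in \<open>auto simp: min_def max_def split: if_splits\<close>)
      qed
      then show thesis using y1(2) by (intro finish[OF y1(1)]) auto
    qed
  qed
qed

section \<open>Controls of periodic weak solutions\<close>

text \<open>Strict separation from a finite set persists under small changes of the direction, so a
  dense set of directions suffices; a countable one turns membership into a measurable
  condition.\<close>

lemma mem_convex_hull_iff_dense:
  fixes z :: "'a::euclidean_space"
  assumes K: "finite K" "K \<noteq> {}" and D: "\<And>X::'a set. open X \<Longrightarrow> X \<noteq> {} \<Longrightarrow> \<exists>d\<in>D. d \<in> X"
  shows "z \<in> convex hull K \<longleftrightarrow> (\<forall>d\<in>D. \<exists>k\<in>K. d \<bullet> z \<le> d \<bullet> k)"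
proof
  assume z: "z \<in> convex hull K"
  show "\<forall>d\<in>D. \<exists>k\<in>K. d \<bullet> z \<le> d \<bullet> k"
  proof (rule ballI, rule ccontr)
    fix d assume "\<not> (\<exists>k\<in>K. d \<bullet> z \<le> d \<bullet> k)"
    then have "convex hull K \<subseteq> {x. d \<bullet> x < d \<bullet> z}"
      by (intro hull_minimal) (auto simp: convex_halfspace_lt not_le)
    then show False using z by auto
  qed
next
  assume R: "\<forall>d\<in>D. \<exists>k\<in>K. d \<bullet> z \<le> d \<bullet> k"
  show "z \<in> convex hull K"
  proof (rule ccontr)
    assume "z \<notin> convex hull K"
    moreover have "closed (convex hull K)" by (simp add: K(1) finite_imp_compact_convex_hull compact_imp_closed)
    ultimately obtain a b where ab: "a \<bullet> z < b" "\<forall>x\<in>convex hull K. b < a \<bullet> x"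
      using separating_hyperplane_closed_point[of "convex hull K" z] by auto
    let ?X = "\<Inter>k\<in>K. {d. d \<bullet> (z - k) > 0}"
    have "open {d. d \<bullet> c > 0}" for c :: 'a using open_halfspace_gt[of 0 c] by (simp add: inner_commute)
    then have "open ?X" using K(1) by (intro open_INT) auto
    moreover have "- a \<in> ?X" using ab hull_inc[of _ K convex] by (fastforce simp: inner_diff_right)
    ultimately obtain d where "d \<in> D" "d \<in> ?X" using D by blast
    then show False using R by (force simp: inner_diff_right)
  qed
qed

lemma sets_mem_convex_hull:
  fixes F :: "'i \<Rightarrow> 'm \<Rightarrow> 'a::euclidean_space"
  assumes I: "finite I" "I \<noteq> {}" and F: "\<And>i. i \<in> I \<Longrightarrow> F i \<in> borel_measurable M"
    and w: "w \<in> borel_measurable M"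
  shows "{m\<in>space M. w m \<in> convex hull ((\<lambda>i. F i m) ` I)} \<in> sets M"
proof -
  obtain D :: "'a set" where D: "countable D" "\<And>X. open X \<Longrightarrow> X \<noteq> {} \<Longrightarrow> \<exists>d\<in>D. d \<in> X"
    using countable_dense_exists by blast
  have "{m\<in>space M. w m \<in> convex hull ((\<lambda>i. F i m) ` I)} =
        {m\<in>space M. \<forall>d\<in>D. \<exists>i\<in>I. d \<bullet> w m \<le> d \<bullet> F i m}"
    using mem_convex_hull_iff_dense[OF _ _ D(2)] I by simp
  also have "\<dots> \<in> sets M"
  proof (rule sets.sets_Collect_countable_All'[OF _ D(1)], rule sets.sets_Collect_finite_Ex[OF _ I(1)])
    fix d i assume i: "i \<in> I"
    note [measurable] = F[OF i] w
    show "{m\<in>space M. d \<bullet> w m \<le> d \<bullet> F i m} \<in> sets M" by measurable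
  qed
  finally show ?thesis .
qed

text \<open>Describes \<open>l \<le> c\<close> for the least weight \<open>l\<close> of the last point as membership in a convex hull,
  which makes this weight measurable.\<close>
lemma convex_hull_partial_join:
  fixes A :: "'a::real_vector set"
  assumes c: "0 \<le> c" "c < 1"
  shows "convex hull (A \<union> (\<lambda>a. (1 - c) *\<^sub>R a + c *\<^sub>R b) ` A) =
         {(1 - l) *\<^sub>R a + l *\<^sub>R b |a l. a \<in> convex hull A \<and> 0 \<le> l \<and> l \<le> c}" (is "?H = ?T")
proof
  show "?H \<subseteq> ?T"
  proof (rule hull_minimal)
    show "A \<union> (\<lambda>a. (1 - c) *\<^sub>R a + c *\<^sub>R b) ` A \<subseteq> ?T"
    proof (intro Un_least subsetI)
      fix a assume "a \<in> A"
      then have "a \<in> convex hull A" by (rule hull_inc)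
      then show "a \<in> ?T" using c by (intro CollectI exI[of _ a] exI[of _ 0]) auto
    next
      fix z assume "z \<in> (\<lambda>a. (1 - c) *\<^sub>R a + c *\<^sub>R b) ` A"
      then obtain a where "a \<in> A" "z = (1 - c) *\<^sub>R a + c *\<^sub>R b" by blast
      moreover then have "a \<in> convex hull A" by (simp add: hull_inc)
      ultimately show "z \<in> ?T" using c by (intro CollectI exI[of _ a] exI[of _ c]) auto
    qed
    show "convex ?T"
    proof (rule convexI)
      fix x y \<mu> \<nu> assume "x \<in> ?T" "y \<in> ?T" and \<mu>\<nu>: "0 \<le> (\<mu>::real)" "0 \<le> \<nu>" "\<mu> + \<nu> = 1"
      then obtain a l a' l' where x: "x = (1 - l) *\<^sub>R a + l *\<^sub>R b" "a \<in> convex hull A" "0 \<le> l" "l \<le> c"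
        and y: "y = (1 - l') *\<^sub>R a' + l' *\<^sub>R b" "a' \<in> convex hull A" "0 \<le> l'" "l' \<le> c" by blast
      define l'' where "l'' = \<mu> * l + \<nu> * l'"
      have "l'' \<le> \<mu> * c + \<nu> * c" unfolding l''_def using x y \<mu>\<nu> by (intro add_mono mult_left_mono) auto
      also have "\<dots> = c" using \<mu>\<nu> by (simp add: distrib_right[symmetric])
      finally have l'': "0 \<le> l''" "l'' \<le> c" using x y \<mu>\<nu> by (auto simp: l''_def)
      have pos: "1 - l'' > 0" using l'' c by simp
      \<comment> \<open>The weights of the two hull points after division by \<open>1 - l''\<close>,
        which is positive because \<open>c < 1\<close>.\<close>
      define a'' where "a'' = (\<mu> * (1 - l) / (1 - l'')) *\<^sub>R a + (\<nu> * (1 - l') / (1 - l'')) *\<^sub>R a'"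
      have eq1: "\<mu> * (1 - l) + \<nu> * (1 - l') = 1 - l''" using \<mu>\<nu>(3) by (simp add: l''_def algebra_simps)
      have "a'' \<in> convex hull A" unfolding a''_def
      proof (rule convexD[OF convex_convex_hull x(2) y(2)])
        show "\<mu> * (1 - l) / (1 - l'') + \<nu> * (1 - l') / (1 - l'') = 1"
          using eq1 pos by (simp add: add_divide_distrib[symmetric])
      qed (use \<mu>\<nu> x y c pos in \<open>auto intro!: divide_nonneg_pos mult_nonneg_nonneg\<close>)
      moreover have "(1 - l'') *\<^sub>R a'' = (\<mu> * (1 - l)) *\<^sub>R a + (\<nu> * (1 - l')) *\<^sub>R a'"
        using pos unfolding a''_def by (simp add: scaleR_add_right)
      then have "\<mu> *\<^sub>R x + \<nu> *\<^sub>R y = (1 - l'') *\<^sub>R a'' + l'' *\<^sub>R b"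
        unfolding x(1) y(1) l''_def by (simp add: algebra_simps)
      ultimately show "\<mu> *\<^sub>R x + \<nu> *\<^sub>R y \<in> ?T" using l'' by blast
    qed
  qed
  show "?T \<subseteq> ?H"
  proof clarify
    fix a l assume a: "a \<in> convex hull A" and l: "0 \<le> l" "l \<le> c"
    have aH: "a \<in> ?H" by (rule subsetD[OF hull_mono a]) blast
    have "convex hull A \<subseteq> {a. (1 - c) *\<^sub>R a + c *\<^sub>R b \<in> ?H}"
    proof (rule hull_minimal)
      show "A \<subseteq> {a. (1 - c) *\<^sub>R a + c *\<^sub>R b \<in> ?H}" by (auto intro!: hull_inc)
      show "convex {a. (1 - c) *\<^sub>R a + c *\<^sub>R b \<in> ?H}"
      proof (rule convexI)
        fix x y \<mu> \<nu> assume h: "x \<in> {a. (1 - c) *\<^sub>R a + c *\<^sub>R b \<in> ?H}" "y \<in> {a. (1 - c) *\<^sub>R a + c *\<^sub>R b \<in> ?H}"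
          and \<mu>\<nu>: "0 \<le> (\<mu>::real)" "0 \<le> \<nu>" "\<mu> + \<nu> = 1"
        have "\<mu> *\<^sub>R ((1 - c) *\<^sub>R x + c *\<^sub>R b) + \<nu> *\<^sub>R ((1 - c) *\<^sub>R y + c *\<^sub>R b) \<in> ?H"
          by (rule convexD[OF convex_convex_hull]) (use h \<mu>\<nu> in auto)
        moreover have "\<mu> *\<^sub>R ((1 - c) *\<^sub>R x + c *\<^sub>R b) + \<nu> *\<^sub>R ((1 - c) *\<^sub>R y + c *\<^sub>R b) =
          (1 - c) *\<^sub>R (\<mu> *\<^sub>R x + \<nu> *\<^sub>R y) + ((\<mu> + \<nu>) * c) *\<^sub>R b"
          by (simp add: algebra_simps)
        ultimately show "\<mu> *\<^sub>R x + \<nu> *\<^sub>R y \<in> {a. (1 - c) *\<^sub>R a + c *\<^sub>R b \<in> ?H}" using \<mu>\<nu>(3) by simp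
      qed
    qed
    then have bH: "(1 - c) *\<^sub>R a + c *\<^sub>R b \<in> ?H" using a by blast
    show "(1 - l) *\<^sub>R a + l *\<^sub>R b \<in> ?H"
    proof (cases "c = 0")
      case True
      then show ?thesis using aH l by simp
    next
      case False
      then have "c > 0" using c by simp
      \<comment> \<open>A weight \<open>l \<le> c\<close> is reached on the segment from
        \<open>a\<close> to the point that carries weight \<open>c\<close>, at parameter
        \<open>l / c\<close>.\<close>
      have "(1 - l / c) *\<^sub>R a + (l / c) *\<^sub>R ((1 - c) *\<^sub>R a + c *\<^sub>R b) \<in> ?H"
        by (rule convexD[OF convex_convex_hull aH bH]) (use l \<open>c > 0\<close> in auto)
      moreover have "(1 - l / c) *\<^sub>R a + (l / c) *\<^sub>R ((1 - c) *\<^sub>R a + c *\<^sub>R b) = (1 - l) *\<^sub>R a + l *\<^sub>R b"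
      proof -
        have "(1 - l / c) *\<^sub>R a + (l / c) *\<^sub>R ((1 - c) *\<^sub>R a + c *\<^sub>R b) =
          ((1 - l / c) + (l / c) * (1 - c)) *\<^sub>R a + ((l / c) * c) *\<^sub>R b"
          by (simp only: scaleR_add_left scaleR_add_right scaleR_scaleR add.assoc)
        moreover have "(1 - l / c) + (l / c) * (1 - c) = 1 - l" "(l / c) * c = l"
          using \<open>c > 0\<close> by (auto simp: field_simps)
        ultimately show ?thesis by simp
      qed
      ultimately show ?thesis by simp
    qed
  qed
qed

text \<open>Induction on the number of vectors: the last one receives its least possible weight,
  which is uniquely determined and measurable, and the rescaled remainder is expressed by the
  others.\<close>

lemma measurable_convex_combination:
  fixes F :: "nat \<Rightarrow> 'm \<Rightarrow> 'a::euclidean_space"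
  assumes "1 \<le> N" "\<And>i. i \<in> {1..N} \<Longrightarrow> F i \<in> borel_measurable M" "w \<in> borel_measurable M"
    "\<And>m. m \<in> space M \<Longrightarrow> w m \<in> convex hull ((\<lambda>i. F i m) ` {1..N})"
  shows "\<exists>V. (\<forall>i\<in>{1..N}. V i \<in> borel_measurable M \<and> (\<forall>m\<in>space M. (0::real) \<le> V i m)) \<and>
     (\<forall>m\<in>space M. (\<Sum>i=1..N. V i m) = 1 \<and> (\<Sum>i=1..N. V i m *\<^sub>R F i m) = w m)"
  using assms
proof (induction N arbitrary: w rule: nat_induct_at_least)
  case base
  then show ?case by (intro exI[of _ "\<lambda>_ _. 1"]) auto
next
  case (Suc N w)
  note Fm = Suc.prems(1) and wm = Suc.prems(2)
  let ?A = "\<lambda>m. (\<lambda>i. F i m) ` {1..N}" and ?b = "F (Suc N)"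
  have A: "finite (?A m)" "?A m \<noteq> {}" for m using Suc.hyps by auto
  have compA: "compact (convex hull ?A m)" for m by (simp add: finite_imp_compact_convex_hull)
  define P where "P m l \<longleftrightarrow> 0 \<le> l \<and> l \<le> 1 \<and> (\<exists>a\<in>convex hull ?A m. w m = (1 - l) *\<^sub>R a + l *\<^sub>R ?b m)" for m l
  define \<Lambda> where "\<Lambda> m = {l. P m l}" for m
  have ins: "insert (?b m) (?A m) = (\<lambda>i. F i m) ` {1..Suc N}" for m
    by (auto simp: atLeastAtMostSuc_conv)
  have ne: "\<Lambda> m \<noteq> {}" if "m \<in> space M" for m
  proof -
    have "w m \<in> convex hull (insert (?b m) (?A m))" using Suc.prems(3)[OF that] ins by simp
    then obtain u v a where "u \<ge> 0" "v \<ge> 0" "u + v = 1" "a \<in> convex hull ?A m" "w m = u *\<^sub>R ?b m + v *\<^sub>R a"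
      unfolding convex_hull_insert[OF A(2)] by blast
    moreover then have "v = 1 - u" by simp
    ultimately have "P m u" unfolding P_def by (intro conjI bexI[of _ a]) (auto simp: add.commute)
    then show ?thesis by (auto simp: \<Lambda>_def)
  qed
  have comp: "compact (\<Lambda> m)" for m
  proof -
    let ?g = "\<lambda>q::real \<times> 'a. (1 - fst q) *\<^sub>R snd q + fst q *\<^sub>R ?b m"
    have "closed (({0..1} \<times> (convex hull ?A m)) \<inter> ?g -` {w m})"
      by (intro continuous_closed_preimage continuous_intros closed_Times compact_imp_closed[OF compA])
    then have "compact (({0..1} \<times> (convex hull ?A m)) \<inter> (({0..1} \<times> (convex hull ?A m)) \<inter> ?g -` {w m}))"
      by (intro compact_Int_closed compact_Times compA) auto
    then have "compact (fst ` (({0..1} \<times> (convex hull ?A m)) \<inter> (({0..1} \<times> (convex hull ?A m)) \<inter> ?g -` {w m})))"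
      by (rule compact_continuous_image[rotated]) (intro continuous_intros)
    moreover have "fst ` (({0..1} \<times> (convex hull ?A m)) \<inter> (({0..1} \<times> (convex hull ?A m)) \<inter> ?g -` {w m})) = \<Lambda> m"
    proof (intro set_eqI iffI)
      fix l assume "l \<in> \<Lambda> m"
      then obtain a where "a \<in> convex hull ?A m" "0 \<le> l" "l \<le> 1" "w m = (1 - l) *\<^sub>R a + l *\<^sub>R ?b m"
        unfolding \<Lambda>_def P_def by blast
      then have "(l, a) \<in> ({0..1} \<times> (convex hull ?A m)) \<inter> (({0..1} \<times> (convex hull ?A m)) \<inter> ?g -` {w m})" by simp
      then show "l \<in> fst ` (({0..1} \<times> (convex hull ?A m)) \<inter> (({0..1} \<times> (convex hull ?A m)) \<inter> ?g -` {w m}))"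
        by (rule image_eqI[rotated]) simp
    next
      fix l assume "l \<in> fst ` (({0..1} \<times> (convex hull ?A m)) \<inter> (({0..1} \<times> (convex hull ?A m)) \<inter> ?g -` {w m}))"
      then obtain q where q: "l = fst q" "q \<in> {0..1} \<times> (convex hull ?A m)" "?g q = w m" by blast
      then have "snd q \<in> convex hull ?A m" "0 \<le> l" "l \<le> 1" by auto
      then show "l \<in> \<Lambda> m" unfolding \<Lambda>_def P_def mem_Collect_eq using q(3)[symmetric] q(1)
        by (intro conjI bexI[of _ "snd q"]) simp_all
    qed
    ultimately show ?thesis by simp
  qed
  \<comment> \<open>The infimum is attained: the admissible weights are a projection of a compact
    set of pairs of a weight and a hull point.\<close>
  define lam where "lam m = (if m \<in> space M then Inf (\<Lambda> m) else 0)" for m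
  have bdd: "bdd_below (\<Lambda> m)" for m by (rule bounded_imp_bdd_below[OF compact_imp_bounded[OF comp]])
  have lamP: "P m (lam m)" if m: "m \<in> space M" for m
  proof -
    have "Inf (\<Lambda> m) \<in> \<Lambda> m" by (rule closed_contains_Inf[OF ne[OF m] bdd compact_imp_closed[OF comp]])
    then show ?thesis using m by (simp add: lam_def \<Lambda>_def)
  qed
  have lam_le: "lam m \<le> l" if "m \<in> space M" "P m l" for m l
  proof -
    have "l \<in> \<Lambda> m" using that(2) by (simp add: \<Lambda>_def)
    then have "Inf (\<Lambda> m) \<le> l" by (rule cInf_lower[OF _ bdd])
    then show ?thesis using that(1) by (simp add: lam_def)
  qed
  have lam_meas: "lam \<in> borel_measurable M"
    unfolding borel_measurable_iff_le
  proof
    fix c :: real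
    consider "c < 0" | "c \<ge> 1" | "0 \<le> c" "c < 1" by linarith
    then show "{m\<in>space M. lam m \<le> c} \<in> sets M"
    proof cases
      case 1
      then have "{m\<in>space M. lam m \<le> c} = {}" using lamP by (force simp: P_def)
      then show ?thesis by (simp only: sets.empty_sets)
    next
      case 2
      then have "{m\<in>space M. lam m \<le> c} = space M" using lamP by (force simp: P_def)
      then show ?thesis by (simp only: sets.top)
    next
      case 3
      \<comment> \<open>The tag True marks a vector moved towards \<open>?b\<close> by the fraction
        \<open>c\<close>; the hull of the doubled family consists of the points that admit a weight
        at most \<open>c\<close>.\<close>
      let ?I = "{1..N} \<times> {False, True}"
      let ?G = "\<lambda>(i,j) m. if j then (1 - c) *\<^sub>R F i m + c *\<^sub>R ?b m else F i m"
      have "lam m \<le> c \<longleftrightarrow> w m \<in> convex hull ((\<lambda>q. ?G q m) ` ?I)" if m: "m \<in> space M" for m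
      proof -
        have "?I = (\<lambda>i. (i, False)) ` {1..N} \<union> (\<lambda>i. (i, True)) ` {1..N}" by auto
        then have "(\<lambda>q. ?G q m) ` ?I = ?A m \<union> (\<lambda>a. (1 - c) *\<^sub>R a + c *\<^sub>R ?b m) ` ?A m"
          by (simp only: image_Un image_image prod.case if_True if_False)
        then have "w m \<in> convex hull ((\<lambda>q. ?G q m) ` ?I) \<longleftrightarrow> (\<exists>l\<le>c. P m l)"
          using convex_hull_partial_join[OF 3, of "?A m" "?b m"] 3 by (auto simp: P_def)
        also have "\<dots> \<longleftrightarrow> lam m \<le> c" using lamP[OF m] lam_le[OF m] by force
        finally show ?thesis by simp
      qed
      then have "{m\<in>space M. lam m \<le> c} = {m\<in>space M. w m \<in> convex hull ((\<lambda>q. ?G q m) ` ?I)}" by blast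
      also have "\<dots> \<in> sets M"
      proof (rule sets_mem_convex_hull)
        fix q assume q: "q \<in> ?I"
        have [measurable]: "F (fst q) \<in> borel_measurable M" "?b \<in> borel_measurable M" using Fm q Suc.hyps by auto
        show "?G q \<in> borel_measurable M" unfolding case_prod_beta by (cases "snd q") simp_all
      qed (use Suc.hyps wm in auto)
      finally show ?thesis .
    qed
  qed
  note [measurable] = lam_meas wm
  have [measurable]: "?b \<in> borel_measurable M" "F 1 \<in> borel_measurable M" using Fm Suc.hyps by auto
  \<comment> \<open>If the last vector takes the whole weight, the remainder is multiplied by 0, and
    \<open>F 1\<close> serves as a measurable default inside the hull.\<close>
  define w' where "w' m = (if lam m < 1 then (1 / (1 - lam m)) *\<^sub>R (w m - lam m *\<^sub>R ?b m) else F 1 m)" for m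
  have w'm: "w' \<in> borel_measurable M" unfolding w'_def by measurable
  have w'A: "w' m \<in> convex hull ?A m" and ww': "w m = (1 - lam m) *\<^sub>R w' m + lam m *\<^sub>R ?b m" if m: "m \<in> space M" for m
  proof -
    obtain a where a: "0 \<le> lam m" "lam m \<le> 1" "a \<in> convex hull ?A m" "w m = (1 - lam m) *\<^sub>R a + lam m *\<^sub>R ?b m"
      using lamP[OF m] by (auto simp: P_def)
    have "w' m \<in> convex hull ?A m \<and> w m = (1 - lam m) *\<^sub>R w' m + lam m *\<^sub>R ?b m"
    proof (cases "lam m < 1")
      case True
      then have "w' m = a" using a by (simp add: w'_def)
      then show ?thesis using a by simp
    next
      case False
      then have "lam m = 1" using a by simp
      moreover have "F 1 m \<in> convex hull ?A m" using Suc.hyps by (intro hull_inc) auto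
      ultimately show ?thesis using a by (simp add: w'_def)
    qed
    then show "w' m \<in> convex hull ?A m" "w m = (1 - lam m) *\<^sub>R w' m + lam m *\<^sub>R ?b m" by auto
  qed
  have "\<exists>V. (\<forall>i\<in>{1..N}. V i \<in> borel_measurable M \<and> (\<forall>m\<in>space M. (0::real) \<le> V i m)) \<and>
     (\<forall>m\<in>space M. (\<Sum>i=1..N. V i m) = 1 \<and> (\<Sum>i=1..N. V i m *\<^sub>R F i m) = w' m)"
    by (rule Suc.IH[OF _ w'm w'A]) (use Fm in auto)
  then obtain V where V: "\<And>i. i \<in> {1..N} \<Longrightarrow> V i \<in> borel_measurable M \<and> (\<forall>m\<in>space M. (0::real) \<le> V i m)"
     "\<And>m. m \<in> space M \<Longrightarrow> (\<Sum>i=1..N. V i m) = 1 \<and> (\<Sum>i=1..N. V i m *\<^sub>R F i m) = w' m" by blast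
  define V' where "V' i m = (if i = Suc N then lam m else (1 - lam m) * V i m)" for i m
  show ?case
  proof (intro exI[of _ V'] conjI ballI)
    fix i assume i: "i \<in> {1..Suc N}"
    show "V' i \<in> borel_measurable M"
    proof (cases "i = Suc N")
      case False
      then have [measurable]: "V i \<in> borel_measurable M" using V(1) i by auto
      show ?thesis unfolding V'_def using False by simp
    qed (use lam_meas in \<open>simp add: V'_def[abs_def]\<close>)
    fix m assume m: "m \<in> space M"
    then show "0 \<le> V' i m" using lamP[OF m] V(1)[of i] i by (auto simp: V'_def P_def)
  next
    fix m assume m: "m \<in> space M"
    have "(\<Sum>i=1..N. V' i m) = (\<Sum>i=1..N. (1 - lam m) * V i m)" by (intro sum.cong) (auto simp: V'_def)
    then show "(\<Sum>i=1..Suc N. V' i m) = 1" using V(2)[OF m] by (simp add: V'_def sum_distrib_left[symmetric])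
    have "(\<Sum>i=1..N. V' i m *\<^sub>R F i m) = (\<Sum>i=1..N. (1 - lam m) *\<^sub>R (V i m *\<^sub>R F i m))"
      by (intro sum.cong) (auto simp: V'_def)
    also have "\<dots> = (1 - lam m) *\<^sub>R w' m" using V(2)[OF m] by (simp only: scaleR_sum_right[symmetric])
    finally have "(\<Sum>i=1..N. V' i m *\<^sub>R F i m) = (1 - lam m) *\<^sub>R w' m" .
    moreover have "V' (Suc N) m = lam m" by (simp add: V'_def)
    ultimately show "(\<Sum>i=1..Suc N. V' i m *\<^sub>R F i m) = w m" using ww'[OF m] by simp
  qed
qed

text \<open>Otherwise a half space would contain all field values along \<open>y\<close> near time
  \<open>t\<close> but not \<open>w\<close>. The integrated inequality puts the right difference
  quotients at \<open>t\<close>, and hence their limit \<open>w\<close>, into that half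
  space.\<close>

lemma weak_sol_derivative_in_hull:
  assumes N: "1 \<le> N" and \<Psi>: "\<And>i. i \<in> {1..N} \<Longrightarrow> continuous_on Z (\<Psi> i)"
    and y: "weak_sol Z N \<Psi> y" and cont: "continuous_on {0..} y" and t: "t \<ge> 0"
    and der: "(y has_vector_derivative w) (at t within {0..})"
  shows "w \<in> convex hull ((\<lambda>i. \<Psi> i (y t)) ` {1..N})"
proof (rule ccontr)
  let ?H = "convex hull ((\<lambda>i. \<Psi> i (y t)) ` {1..N})"
  assume "w \<notin> ?H"
  moreover have "closed ?H" by (simp add: finite_imp_compact_convex_hull compact_imp_closed)
  ultimately obtain a b where ab: "a \<bullet> w < b" "\<forall>x\<in>?H. b < a \<bullet> x"
    using separating_hyperplane_closed_point[of ?H w] by auto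
  have "\<forall>\<^sub>F \<tau> in at t within {0..}. \<forall>i\<in>{1..N}. b < a \<bullet> \<Psi> i (y \<tau>)"
  proof (intro eventually_ball_finite ballI)
    fix i assume i: "i \<in> {1..N}"
    have "continuous_on {0..} (\<lambda>\<tau>. a \<bullet> \<Psi> i (y \<tau>))"
      by (intro continuous_intros continuous_on_compose2[OF \<Psi>[OF i] cont]) (use weak_solD1[OF y] in auto)
    then have "((\<lambda>\<tau>. a \<bullet> \<Psi> i (y \<tau>)) \<longlongrightarrow> a \<bullet> \<Psi> i (y t)) (at t within {0..})"
      using t by (simp add: continuous_on_def)
    moreover have "\<Psi> i (y t) \<in> ?H" using i by (intro hull_inc) auto
    then have "b < a \<bullet> \<Psi> i (y t)" using ab(2) by blast
    ultimately show "\<forall>\<^sub>F \<tau> in at t within {0..}. b < a \<bullet> \<Psi> i (y \<tau>)" by (rule order_tendstoD)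
  qed auto
  then obtain d where d: "d > 0" "\<And>\<tau> i. \<lbrakk>\<tau> \<ge> 0; \<tau> \<noteq> t; dist \<tau> t < d; i \<in> {1..N}\<rbrakk> \<Longrightarrow> b < a \<bullet> \<Psi> i (y \<tau>)"
    unfolding eventually_at by auto
  have bt: "b \<le> a \<bullet> \<Psi> i (y \<tau>)" if "\<tau> \<in> {t..<t+d}" "i \<in> {1..N}" for \<tau> i
  proof (cases "\<tau> = t")
    case True
    have "\<Psi> i (y t) \<in> ?H" using that by (intro hull_inc) auto
    then show ?thesis using ab(2) True by force
  next
    case False
    then show ?thesis using d(2)[of \<tau> i] that t by (auto simp: dist_real_def)
  qed
  have "((\<lambda>\<tau>. a \<bullet> y \<tau>) has_vector_derivative a \<bullet> w) (at t within {0..})"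
    by (rule bounded_linear.has_vector_derivative[OF bounded_linear_inner_right der])
  then have "((\<lambda>\<tau>. a \<bullet> y \<tau>) has_field_derivative a \<bullet> w) (at t within {t..})"
    using t by (intro has_field_derivative_subset[where t = "{t..}" and s = "{0..}"]) (auto simp: has_real_derivative_iff_has_vector_derivative)
  then have lim: "((\<lambda>\<tau>. (a \<bullet> y \<tau> - a \<bullet> y t) / (\<tau> - t)) \<longlongrightarrow> a \<bullet> w) (at_right t)"
    unfolding has_field_derivative_iff by (rule tendsto_within_subset) auto
  have "\<forall>\<^sub>F \<tau> in at_right t. b \<le> (a \<bullet> y \<tau> - a \<bullet> y t) / (\<tau> - t)"
    unfolding eventually_at_right_field
  proof (intro exI[of _ "t + d"] conjI allI impI)
    fix \<tau> assume \<tau>: "t < \<tau>" "\<tau> < t + d"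
    have "b * (\<tau> - t) \<le> a \<bullet> (y \<tau> - y t)"
      by (rule weak_solD2[OF y t]) (use \<tau> bt in auto)
    then show "b \<le> (a \<bullet> y \<tau> - a \<bullet> y t) / (\<tau> - t)" using \<tau> by (simp add: inner_diff_right pos_le_divide_eq)
  qed (use d in auto)
  then have "b \<le> a \<bullet> w" using lim by (intro tendsto_lowerbound[OF lim]) auto
  then show False using ab(1) by simp
qed

lemma lipschitz_AE_vector_differentiable:
  fixes y :: "real \<Rightarrow> 'a::euclidean_space"
  assumes lip: "\<And>s t. norm (y t - y s) \<le> L * \<bar>t - s\<bar>"
  shows "AE t in lebesgue. y differentiable (at t)"
proof -
  have "AE t in lebesgue. \<forall>b\<in>Basis. (\<lambda>t. y t \<bullet> b) differentiable (at t)"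
  proof (rule AE_finite_allI[OF finite_Basis])
    fix b :: 'a assume "b \<in> Basis"
    have "\<bar>y t \<bullet> b - y s \<bullet> b\<bar> \<le> L * \<bar>t - s\<bar>" for s t
      using Basis_le_norm[OF \<open>b \<in> Basis\<close>, of "y t - y s"] lip[of t s] by (simp add: inner_diff_left)
    then show "AE t in lebesgue. (\<lambda>t. y t \<bullet> b) differentiable (at t)" by (rule lipschitz_AE_differentiable)
  qed
  then show ?thesis by eventually_elim (simp add: differentiable_componentwise_within[of y])
qed

text \<open>Position and velocity are periodic, so coefficients chosen as Borel functions of this
  pair are periodic at every nonnegative time, not just almost everywhere.\<close>

lemma periodic_weak_sol_controls:
  fixes Z :: "'a::euclidean_space set"
  assumes Z: "compact Z" and N: "1 \<le> N" and \<Psi>: "\<And>i. i \<in> {1..N} \<Longrightarrow> continuous_on Z (\<Psi> i)"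
    and y: "weak_sol Z N \<Psi> y" and p: "p > 0" and per: "\<And>t. t \<ge> 0 \<Longrightarrow> y (t + p) = y t"
  shows "abs_cont_halfline y"
    and "\<exists>v. (\<forall>i\<in>{1..N}. control_fun (v i) \<and> periodic_halfline (v i)) \<and>
          (AE t in lebesgue. t \<ge> 0 \<longrightarrow> (\<Sum>i=1..N. v i t) = 1) \<and>
          (AE t in lebesgue. t \<ge> 0 \<longrightarrow>
             (y has_vector_derivative (\<Sum>i=1..N. v i t *\<^sub>R \<Psi> i (y t))) (at t within {0..}))"
proof -
  obtain L where L: "L > 0" "\<And>s t. \<lbrakk>0 \<le> s; 0 \<le> t\<rbrakk> \<Longrightarrow> norm (y t - y s) \<le> L * \<bar>t - s\<bar>"
    using weak_sol_lipschitz[of Z N \<Psi>, OF Z \<Psi>] y by metis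
  show "abs_cont_halfline y" unfolding abs_cont_halfline_def
    by (intro allI impI lipschitz_imp_absolutely_continuous_on[of L]) (use L in auto)
  have cont: "continuous_on {0..} y"
    by (rule lipschitz_on_continuous_on[of L], rule lipschitz_onI)
       (use L in \<open>auto simp: dist_norm norm_minus_commute abs_minus_commute\<close>)
  \<comment> \<open>The constant extension to negative times preserves the Lipschitz bound and puts
    the solution on the whole line, where differentiability almost everywhere is available.\<close>
  define Y where "Y t = y (max t 0)" for t
  have contY: "continuous_on UNIV Y"
    unfolding Y_def by (intro continuous_on_compose2[OF cont] continuous_intros) auto
  have lipY: "norm (Y t - Y s) \<le> L * \<bar>t - s\<bar>" for s t
  proof -
    have "norm (Y t - Y s) \<le> L * \<bar>max t 0 - max s 0\<bar>" unfolding Y_def by (rule L(2)) auto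
    also have "\<dots> \<le> L * \<bar>t - s\<bar>" using L(1) by (intro mult_left_mono) auto
    finally show ?thesis .
  qed
  \<comment> \<open>A velocity that is defined at every time, Borel and periodic by its formula.
    Where the sequence diverges, \<open>lim\<close> has an unspecified value that still depends on
    nothing but the sequence.\<close>
  define W where "W t = lim (\<lambda>n. real (Suc n) *\<^sub>R (Y (t + 1 / real (Suc n)) - Y t))" for t
  have Ym: "Y \<in> borel_measurable borel" by (rule borel_measurable_continuous_onI[OF contY])
  have Wm: "W \<in> borel_measurable borel"
    unfolding W_def
  proof (rule borel_measurable_lim_metric)
    fix n
    have "continuous_on UNIV (\<lambda>t. real (Suc n) *\<^sub>R (Y (t + 1 / real (Suc n)) - Y t))"
      by (intro continuous_intros continuous_on_compose2[OF contY]) auto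
    then show "(\<lambda>t. real (Suc n) *\<^sub>R (Y (t + 1 / real (Suc n)) - Y t)) \<in> borel_measurable borel"
      by (rule borel_measurable_continuous_onI)
  qed
  define M where "M = restrict_space (borel :: ('a \<times> 'a) measure) (Z \<times> UNIV)"
  have spM: "space M = Z \<times> UNIV" by (simp add: M_def space_restrict_space)
  have \<Psi>m: "(\<lambda>m. \<Psi> i (fst m)) \<in> borel_measurable M" if "i \<in> {1..N}" for i
    unfolding M_def
    by (intro borel_measurable_continuous_on_restrict continuous_on_compose2[OF \<Psi>[OF that]] continuous_intros) auto
  have sm: "snd \<in> borel_measurable M"
    unfolding M_def by (intro borel_measurable_continuous_on_restrict continuous_intros)
  define hullset where "hullset m = convex hull ((\<lambda>i. \<Psi> i (fst m)) ` {1..N})" for m :: "'a \<times> 'a"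
  have G: "{m\<in>space M. snd m \<in> hullset m} \<in> sets M"
    unfolding hullset_def by (rule sets_mem_convex_hull) (use N \<Psi>m sm in auto)
  \<comment> \<open>A pair whose second entry is off the hull receives the default
    \<open>\<Psi> 1\<close>, so that coefficients exist on all of \<open>M\<close>; among
    nonnegative times this affects only a null set.\<close>
  define w where "w m = (if snd m \<in> hullset m then snd m else \<Psi> 1 (fst m))" for m
  have "w \<in> borel_measurable M" unfolding w_def
    by (rule measurable_If[OF sm _ G]) (use \<Psi>m N in auto)
  moreover have "w m \<in> convex hull ((\<lambda>i. \<Psi> i (fst m)) ` {1..N})" for m
  proof -
    have "\<Psi> 1 (fst m) \<in> hullset m" unfolding hullset_def using N by (intro hull_inc) auto
    then show ?thesis by (auto simp: w_def hullset_def)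
  qed
  ultimately obtain V where V: "\<And>i. i \<in> {1..N} \<Longrightarrow> V i \<in> borel_measurable M"
      "\<And>i m. i \<in> {1..N} \<Longrightarrow> m \<in> space M \<Longrightarrow> (0::real) \<le> V i m"
      "\<And>m. m \<in> space M \<Longrightarrow> (\<Sum>i=1..N. V i m) = 1"
      "\<And>m. m \<in> space M \<Longrightarrow> (\<Sum>i=1..N. V i m *\<^sub>R \<Psi> i (fst m)) = w m"
    using measurable_convex_combination[of N "\<lambda>i m. \<Psi> i (fst m)" M w] N \<Psi>m by blast
  define v where "v i t = V i (Y t, W t)" for i t
  have YZ: "Y t \<in> Z" for t unfolding Y_def by (rule weak_solD1[OF y]) simp
  then have inM: "(Y t, W t) \<in> space M" for t by (simp add: spM)
  have "(\<lambda>t. (Y t, W t)) \<in> measurable borel M" unfolding M_def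
    by (rule measurable_restrict_space2) (use YZ Ym Wm in \<open>auto intro: borel_measurable_Pair\<close>)
  then have vm: "v i \<in> borel_measurable borel" if "i \<in> {1..N}" for i
    unfolding v_def using measurable_compose V(1)[OF that] by blast
  have v1: "(\<Sum>i=1..N. v i t) = 1" for t unfolding v_def using V(3) inM by blast
  have v0: "0 \<le> v i t" if "i \<in> {1..N}" for i t unfolding v_def using V(2)[OF that] inM by blast
  have vle: "v i t \<le> 1" if "i \<in> {1..N}" for i t
  proof -
    have "v i t \<le> (\<Sum>i=1..N. v i t)" by (rule member_le_sum) (use that v0 in auto)
    then show ?thesis using v1 by simp
  qed
  have ctrl: "control_fun (v i)" if "i \<in> {1..N}" for i
  proof -
    have "v i \<in> borel_measurable lebesgue" using vm[OF that] by (simp add: measurable_completion)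
    then show ?thesis using v0[OF that] vle[OF that] by (auto simp: control_fun_def measurable_restrict_space1)
  qed
  have perY: "Y (t + p) = Y t" if "t \<ge> 0" for t using that per p by (simp add: Y_def)
  have perv: "periodic_halfline (v i)" for i
    unfolding periodic_halfline_def
  proof (intro exI[of _ p] conjI allI impI p)
    fix t :: real assume t: "t \<ge> 0"
    have "Y (t + p + 1 / real (Suc n)) = Y (t + 1 / real (Suc n))" for n
      using perY[of "t + 1 / real (Suc n)"] t by (simp add: algebra_simps)
    then have "W (t + p) = W t" unfolding W_def using perY[OF t] by simp
    then show "v i (t + p) = v i t" unfolding v_def using perY[OF t] by simp
  qed
  have "AE t in lebesgue. Y differentiable (at t)" by (rule lipschitz_AE_vector_differentiable[OF lipY])
  \<comment> \<open>At positive times the two-sided derivative of \<open>Y\<close> is the derivative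
    of the solution; time 0, where the constant extension is attached, is discarded.\<close>
  moreover have "AE t in lebesgue. t \<noteq> (0::real)"
    using AE_completion[OF AE_lborel_singleton[of 0]] by simp
  ultimately have "AE t in lebesgue. t \<ge> 0 \<longrightarrow>
             (y has_vector_derivative (\<Sum>i=1..N. v i t *\<^sub>R \<Psi> i (y t))) (at t within {0..})"
  proof eventually_elim
    case (elim t)
    show ?case
    proof
      assume "t \<ge> 0"
      then have t: "t > 0" using elim by simp
      obtain D where D: "(Y has_vector_derivative D) (at t)" using elim(1) by (meson vector_derivative_works)
      have Yy: "Y s = y s" if "s \<ge> 0" for s using that by (simp add: Y_def)
      have yD: "(y has_vector_derivative D) (at t within {0..})"
        by (rule has_vector_derivative_transform[where f = Y])
           (use t Yy has_vector_derivative_at_within[OF D] in auto)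
      have "(\<lambda>n. real (Suc n) *\<^sub>R (Y (t + 1 / real (Suc n)) - Y t)) \<longlonglongrightarrow> D"
      proof -
        have "((\<lambda>h. (1 / h) *\<^sub>R (Y (t + h) - Y t)) \<longlongrightarrow> D) (at 0)"
        proof -
          have "((\<lambda>h. norm (Y (t + h) - Y t - h *\<^sub>R D) / norm h) \<longlongrightarrow> 0) (at 0)"
            using D by (simp add: has_vector_derivative_def has_derivative_at)
          moreover have "\<forall>\<^sub>F h in at 0. norm (Y (t + h) - Y t - h *\<^sub>R D) / norm h = norm ((1 / h) *\<^sub>R (Y (t + h) - Y t) - D)"
          proof (rule eventually_at_filter[THEN iffD2], intro always_eventually allI impI)
            fix h :: real assume "h \<noteq> 0"
            then have "(1 / h) *\<^sub>R (Y (t + h) - Y t) - D = (1 / h) *\<^sub>R (Y (t + h) - Y t - h *\<^sub>R D)"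
              by (simp add: scaleR_diff_right)
            then show "norm (Y (t + h) - Y t - h *\<^sub>R D) / norm h = norm ((1 / h) *\<^sub>R (Y (t + h) - Y t) - D)"
              by simp
          qed
          ultimately have "((\<lambda>h. norm ((1 / h) *\<^sub>R (Y (t + h) - Y t) - D)) \<longlongrightarrow> 0) (at 0)"
            by (rule Lim_transform_eventually)
          then show ?thesis by (simp add: Lim_null[symmetric] tendsto_norm_zero_iff LIM_zero_iff)
        qed
        moreover have "filterlim (\<lambda>n. 1 / real (Suc n)) (at 0) sequentially"
          unfolding filterlim_at using LIMSEQ_Suc[OF lim_inverse_n'] by auto
        ultimately have "(\<lambda>n. (1 / (1 / real (Suc n))) *\<^sub>R (Y (t + 1 / real (Suc n)) - Y t)) \<longlonglongrightarrow> D"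
          by (rule filterlim_compose)
        then show ?thesis by simp
      qed
      then have WD: "W t = D" unfolding W_def by (rule limI)
      have "D \<in> hullset (Y t, W t)"
        unfolding hullset_def using weak_sol_derivative_in_hull[OF N \<Psi> y cont _ yD] t Yy by simp
      then have "w (Y t, W t) = D" by (simp add: w_def WD)
      then have "(\<Sum>i=1..N. v i t *\<^sub>R \<Psi> i (y t)) = D"
        using V(4)[OF inM[of t]] t Yy by (simp add: v_def)
      then show "(y has_vector_derivative (\<Sum>i=1..N. v i t *\<^sub>R \<Psi> i (y t))) (at t within {0..})"
        using yD by simp
    qed
  qed
  then show "\<exists>v. (\<forall>i\<in>{1..N}. control_fun (v i) \<and> periodic_halfline (v i)) \<and>
          (AE t in lebesgue. t \<ge> 0 \<longrightarrow> (\<Sum>i=1..N. v i t) = 1) \<and>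
          (AE t in lebesgue. t \<ge> 0 \<longrightarrow>
             (y has_vector_derivative (\<Sum>i=1..N. v i t *\<^sub>R \<Psi> i (y t))) (at t within {0..}))"
    using ctrl perv v1 by (intro exI[of _ v]) auto
qed

section \<open>The sphere and the projective plane\<close>

text \<open>Excludes \<open>N = 0\<close>, for which an empty sum would have to equal 1 almost
  everywhere.\<close>

lemma AE_lebesgue_halfline_nontrivial:
  "\<not> (AE t in lebesgue. t \<ge> (0::real) \<longrightarrow> False)"
proof
  assume "AE t in lebesgue. t \<ge> (0::real) \<longrightarrow> False"
  then have "AE t in lebesgue. t \<notin> {0..1::real}" by eventually_elim auto
  then have "{0..1::real} \<in> null_sets lebesgue" by (subst (asm) AE_iff_null_sets[symmetric]) auto
  then show False by auto
qed

theorem periodic_limit_property_S2: "periodic_limit_property S2 T_S2"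
  unfolding periodic_limit_property_def
proof (intro allI impI, elim conjE)
  fix Z :: "(real^3) set" and N :: nat and \<Psi> :: "nat \<Rightarrow> real^3 \<Rightarrow> real^3"
    and x :: "real \<Rightarrow> real^3" and u :: "nat \<Rightarrow> real \<Rightarrow> real"
  assume Z: "Z \<subseteq> S2" "compact Z"
    and \<Psi>: "\<forall>i\<in>{1..N}. continuous_on Z (\<Psi> i) \<and> (\<forall>z\<in>Z. \<Psi> i z \<in> T_S2 z)"
    and x: "\<forall>t\<ge>0. x t \<in> Z" "abs_cont_halfline x" and u: "\<forall>i\<in>{1..N}. control_fun (u i)"
    and u1: "AE t in lebesgue. t \<ge> 0 \<longrightarrow> (\<Sum>i=1..N. u i t) = 1"
    and der: "AE t in lebesgue. t \<ge> 0 \<longrightarrow>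
          (x has_vector_derivative (\<Sum>i=1..N. u i t *\<^sub>R \<Psi> i (x t))) (at t within {0..})"
  have N: "1 \<le> N"
  proof (rule ccontr)
    assume "\<not> 1 \<le> N"
    then show False using u1 AE_lebesgue_halfline_nontrivial by simp
  qed
  have cont: "\<And>i. i \<in> {1..N} \<Longrightarrow> continuous_on Z (\<Psi> i)" using \<Psi> by blast
  have wx: "weak_sol Z N \<Psi> x"
    by (rule weak_sol_of_solution[OF _ x(2) _ u1 der]) (use x(1) u in \<open>auto simp: control_fun_def\<close>)
  have Zs: "Z \<subseteq> sphere 0 1" using Z(1) by (simp add: S2_def)
  have tang: "\<Psi> i z \<bullet> z = 0" if "i \<in> {1..N}" "z \<in> Z" for i z using \<Psi> that by (auto simp: T_S2_def)
  obtain p y where y: "p > 0" "weak_sol Z N \<Psi> y" "\<And>t. t \<ge> 0 \<Longrightarrow> y (t + p) = y t"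
    "\<And>t. t \<ge> 0 \<Longrightarrow> y t \<in> omega_limit x"
  proof (rule weak_poincare_bendixson[of Z N \<Psi> x])
    show "Z \<subseteq> sphere 0 1" "compact Z" "1 \<le> N" "weak_sol Z N \<Psi> x" by fact+
    show "continuous_on Z (\<Psi> i)" if "i \<in> {1..N}" for i by (rule cont[OF that])
    show "\<Psi> i z \<bullet> z = 0" if "i \<in> {1..N}" "z \<in> Z" for i z by (rule tang[OF that])
  qed (rule that)
  have "periodic_halfline y" using y(1,3) by (auto simp: periodic_halfline_def)
  then show "\<exists>v y. (\<forall>i\<in>{1..N}. control_fun (v i) \<and> periodic_halfline (v i)) \<and>
          (AE t in lebesgue. t \<ge> 0 \<longrightarrow> (\<Sum>i=1..N. v i t) = 1) \<and>
          periodic_halfline y \<and> abs_cont_halfline y \<and> (\<forall>t\<ge>0. y t \<in> omega_limit x) \<and>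
          (AE t in lebesgue. t \<ge> 0 \<longrightarrow>
             (y has_vector_derivative (\<Sum>i=1..N. v i t *\<^sub>R \<Psi> i (y t))) (at t within {0..}))"
    using periodic_weak_sol_controls[OF Z(2) N cont y(2,1,3)] y(4) by blast
qed

section \<open>The Veronese embedding and the double cover of RP^2\<close>

lemma outer_vec_nth: "outer_vec a b $ i $ j = a $ i * b $ j"
  by (simp add: outer_vec_def)

lemma bounded_bilinear_outer_vec: "bounded_bilinear outer_vec"
  unfolding bilinear_conv_bounded_bilinear[symmetric] bilinear_def
  by (auto intro!: linearI simp: vec_eq_iff outer_vec_nth algebra_simps)

lemma bounded_bilinear_matrix_vector_mult: "bounded_bilinear ((*v) :: real^'n^'m \<Rightarrow> real^'n \<Rightarrow> real^'m)"
  unfolding bilinear_conv_bounded_bilinear[symmetric] bilinear_def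
  by (auto intro!: linearI simp: vec_eq_iff matrix_vector_mult_def sum.distrib sum_distrib_left algebra_simps)

interpretation outer: bounded_bilinear outer_vec by (rule bounded_bilinear_outer_vec)
interpretation mv: bounded_bilinear "(*v) :: real^3^3 \<Rightarrow> real^3 \<Rightarrow> real^3"
  by (rule bounded_bilinear_matrix_vector_mult)

lemma outer_vec_mult: "outer_vec a b *v c = (b \<bullet> c) *\<^sub>R a"
  by (simp add: vec_eq_iff matrix_vector_mult_def outer_vec_nth inner_vec_def sum_distrib_left mult_ac)

lemma inner_outer_vec: "outer_vec a b \<bullet> outer_vec c d = (a \<bullet> c) * (b \<bullet> d)"
  by (simp add: inner_vec_def outer_vec_nth sum_product mult_ac)

lemma norm_outer_diff:
  assumes "norm a = 1" "norm b = 1"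
  shows "(norm (outer_vec a a - outer_vec b b))\<^sup>2 = 2 - 2 * (a \<bullet> b)\<^sup>2" and "(norm (a - b))\<^sup>2 = 2 - 2 * (a \<bullet> b)"
    and "\<bar>a \<bullet> b\<bar> \<le> 1"
proof -
  have "a \<bullet> a = 1" "b \<bullet> b = 1" using assms by (simp_all add: norm_eq_1)
  then show "(norm (outer_vec a a - outer_vec b b))\<^sup>2 = 2 - 2 * (a \<bullet> b)\<^sup>2" "(norm (a - b))\<^sup>2 = 2 - 2 * (a \<bullet> b)"
    unfolding power2_norm_eq_inner inner_diff_left inner_diff_right inner_outer_vec
    by (simp_all add: inner_commute power2_eq_square)
  show "\<bar>a \<bullet> b\<bar> \<le> 1" using Cauchy_Schwarz_ineq2[of a b] assms by simp
qed

text \<open>With r = a \<bullet> b the squared distances are 2 - 2 r and 2 - 2 r^2, and r^2 \<le> r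
  for r between 0 and 1. Through this estimate the lift of an absolutely continuous curve remains
  absolutely continuous.\<close>

lemma norm_diff_le_outer_diff:
  assumes "norm a = 1" "norm b = 1" "a \<bullet> b \<ge> 0"
  shows "norm (a - b) \<le> norm (outer_vec a a - outer_vec b b)"
proof (rule power2_le_imp_le)
  have "(a \<bullet> b)\<^sup>2 \<le> a \<bullet> b"
    using norm_outer_diff(3)[OF assms(1,2)] assms(3) by (simp add: power2_eq_square mult_left_le)
  then show "(norm (a - b))\<^sup>2 \<le> (norm (outer_vec a a - outer_vec b b))\<^sup>2"
    using norm_outer_diff(1,2)[OF assms(1,2)] by simp
qed simp

lemma norm_outer_diff_le:
  assumes "norm a = 1" "norm b = 1"
  shows "norm (outer_vec a a - outer_vec b b) \<le> 2 * norm (a - b)"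
proof (rule power2_le_imp_le)
  have "0 \<le> (1 - a \<bullet> b) * (1 - a \<bullet> b) + 2 * (1 - a \<bullet> b)"
    using norm_outer_diff(3)[OF assms] by (intro add_nonneg_nonneg mult_nonneg_nonneg) auto
  then have "2 - 2 * (a \<bullet> b)\<^sup>2 \<le> 4 * (2 - 2 * (a \<bullet> b))"
    using norm_outer_diff(3)[OF assms] by (simp add: power2_eq_square algebra_simps)
  then show "(norm (outer_vec a a - outer_vec b b))\<^sup>2 \<le> (2 * norm (a - b))\<^sup>2"
    using norm_outer_diff(1,2)[OF assms] by (simp add: power_mult_distrib)
qed simp

lemma outer_vec_self_eq:
  assumes "norm a = 1" "norm b = 1" "outer_vec a a = outer_vec b b"
  shows "a = b \<or> a = - b"
proof -
  have "(a \<bullet> b)\<^sup>2 = 1" using norm_outer_diff(1)[OF assms(1,2)] assms(3) by simp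
  then have "a \<bullet> b = 1 \<or> a \<bullet> b = - 1" by (simp add: power2_eq_1_iff)
  moreover have "a = b" if "a \<bullet> b = 1" using norm_outer_diff(2)[OF assms(1,2)] that by simp
  moreover have "a = - b" if "a \<bullet> b = - 1"
    using norm_outer_diff(2)[of a "- b"] assms(1,2) that by (simp add: eq_neg_iff_add_eq_0)
  ultimately show ?thesis by blast
qed

text \<open>\<open>K *v a\<close> inverts the differential of the projection from the sphere: if K =
  a w^T + w a^T with w orthogonal to the unit vector a, then K a = w. The unit vector in the
  definition of the tangent space may be -a, and then w changes its sign as well.\<close>

lemma T_RP2_eq:
  assumes "norm a = 1" "K \<in> T_RP2 (outer_vec a a)"
  shows "(K *v a) \<bullet> a = 0" "outer_vec a (K *v a) + outer_vec (K *v a) a = K"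
proof -
  obtain b w where bw: "K = outer_vec b w + outer_vec w b" "norm b = 1" "outer_vec a a = outer_vec b b" "w \<bullet> b = 0"
    using assms(2) by (auto simp: T_RP2_def)
  obtain w' where w': "K = outer_vec a w' + outer_vec w' a" "w' \<bullet> a = 0"
  proof (cases "a = b")
    case False
    then have "b = - a" using outer_vec_self_eq[OF assms(1) bw(2,3)] by auto
    then show thesis using that[of "- w"] bw by (simp add: outer.minus_left outer.minus_right)
  qed (use that bw in auto)
  have "a \<bullet> a = 1" using assms(1) by (simp add: norm_eq_1)
  then have "K *v a = w'" using w' by (simp add: mv.add_left outer_vec_mult)
  then show "(K *v a) \<bullet> a = 0" "outer_vec a (K *v a) + outer_vec (K *v a) a = K" using w' by auto
qed

text \<open>The evenly covered neighbourhood consists of the lines not orthogonal to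
  \<open>a\<close>, and its sheets are the two open half spheres. Since
  \<open>outer_vec b b *v a\<close> is b multiplied by a \<bullet> b, normalising
  \<open>K *v a\<close> and fixing its sign inverts the projection on either sheet.\<close>

lemma covering_space_RP2: "covering_space (sphere 0 1) (\<lambda>a. outer_vec a a) RP2"
proof
  let ?q = "\<lambda>a. outer_vec a a" and ?S = "sphere (0::real^3) 1"
  show cq: "continuous_on ?S ?q" by (intro outer.continuous_on continuous_intros)
  show qS: "?q ` ?S = RP2" by (auto simp: RP2_def)
  fix P assume "P \<in> RP2"
  then obtain a where a: "norm a = 1" "P = outer_vec a a" by (auto simp: RP2_def)
  have aa: "a \<bullet> a = 1" using a by (simp add: norm_eq_1)
  define T where "T = RP2 \<inter> {K. outer_vec a a \<bullet> K > 0}"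
  have qT: "?q b \<in> T \<longleftrightarrow> a \<bullet> b \<noteq> 0" if "norm b = 1" for b
    using that by (auto simp: T_def RP2_def inner_outer_vec zero_less_mult_iff)
  define H where "H \<epsilon> = ?S \<inter> {b. \<epsilon> * (a \<bullet> b) > 0}" for \<epsilon> :: real
  have oH: "openin (top_of_set ?S) (H \<epsilon>)" for \<epsilon>
  proof -
    have "open {b. \<epsilon> * (a \<bullet> b) > 0}" using open_halfspace_gt[of 0 "\<epsilon> *\<^sub>R a"] by simp
    then show ?thesis unfolding H_def by (rule openin_open_Int)
  qed
  define h where "h \<epsilon> K = (\<epsilon> / norm (K *v a)) *\<^sub>R (K *v a)" for \<epsilon> and K :: "real^3^3"
  have hq: "h \<epsilon> (?q b) = b" if "b \<in> H \<epsilon>" "\<epsilon> = 1 \<or> \<epsilon> = -1" for b \<epsilon>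
  proof -
    have b: "norm b = 1" "\<epsilon> * (a \<bullet> b) > 0" using that by (auto simp: H_def)
    have "?q b *v a = (a \<bullet> b) *\<^sub>R b" by (simp add: outer_vec_mult inner_commute)
    then have "h \<epsilon> (?q b) = (\<epsilon> * (a \<bullet> b) / \<bar>a \<bullet> b\<bar>) *\<^sub>R b" using b by (simp add: h_def)
    also have "\<epsilon> * (a \<bullet> b) / \<bar>a \<bullet> b\<bar> = 1" using b(2) that(2) by (auto simp: abs_if field_simps)
    finally show ?thesis by simp
  qed
  have TqH: "\<exists>b\<in>H \<epsilon>. K = ?q b" if K: "K \<in> T" and \<epsilon>: "\<epsilon> = 1 \<or> \<epsilon> = -1" for K \<epsilon>
  proof -
    have "K \<in> RP2" using K by (simp add: T_def)
    then obtain b where b: "norm b = 1" "K = ?q b" by (auto simp: RP2_def)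
    then have "a \<bullet> b \<noteq> 0" using qT K by blast
    then have "b \<in> H \<epsilon> \<or> - b \<in> H \<epsilon>" using b \<epsilon> by (auto simp: H_def)
    moreover have "?q (- b) = ?q b" by (simp add: outer.minus_left outer.minus_right)
    ultimately show ?thesis using b(2) by metis
  qed
  have hom: "homeomorphism (H \<epsilon>) T ?q (h \<epsilon>)" if \<epsilon>: "\<epsilon> = 1 \<or> \<epsilon> = -1" for \<epsilon>
  proof (rule homeomorphismI)
    show "continuous_on (H \<epsilon>) ?q" by (rule continuous_on_subset[OF cq]) (auto simp: H_def)
    have "K *v a \<noteq> 0" if K: "K \<in> T" for K
    proof -
      obtain b where b: "b \<in> H 1" "K = ?q b" using TqH[OF K, of 1] by auto
      then have "norm b = 1" "a \<bullet> b \<noteq> 0" by (auto simp: H_def)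
      moreover from this have "b \<noteq> 0" by auto
      ultimately show ?thesis using b by (simp add: outer_vec_mult inner_commute)
    qed
    then show "continuous_on T (h \<epsilon>)" unfolding h_def
      by (intro continuous_intros mv.continuous_on) auto
    show "?q ` H \<epsilon> \<subseteq> T" using qT by (auto simp: H_def)
    show "h \<epsilon> ` T \<subseteq> H \<epsilon>" using TqH[OF _ \<epsilon>] hq[OF _ \<epsilon>] by fastforce
    show "\<And>b. b \<in> H \<epsilon> \<Longrightarrow> h \<epsilon> (?q b) = b" using hq \<epsilon> by blast
    show "\<And>K. K \<in> T \<Longrightarrow> ?q (h \<epsilon> K) = K" using TqH[OF _ \<epsilon>] hq[OF _ \<epsilon>] by fastforce
  qed
  show "\<exists>T. P \<in> T \<and> openin (top_of_set RP2) T \<and>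
     (\<exists>v. \<Union>v = ?S \<inter> ?q -` T \<and> (\<forall>u\<in>v. openin (top_of_set ?S) u) \<and> pairwise disjnt v \<and>
        (\<forall>u\<in>v. \<exists>h. homeomorphism u T ?q h))"
  proof (intro exI[of _ T] conjI exI[of _ "{H 1, H (-1)}"])
    show "P \<in> T" using qT[OF a(1)] a aa by simp
    show "openin (top_of_set RP2) T" unfolding T_def by (intro openin_open_Int open_halfspace_gt)
    show "\<Union>{H 1, H (-1)} = ?S \<inter> ?q -` T" using qT by (auto simp: H_def not_less)
    show "pairwise disjnt {H 1, H (-1)}" by (auto simp: pairwise_def disjnt_def H_def)
    show "\<forall>u\<in>{H 1, H (-1)}. openin (top_of_set ?S) u" using oH by blast
    show "\<forall>u\<in>{H 1, H (-1)}. \<exists>h. homeomorphism u T ?q h" using hom[of 1] hom[of "-1"] by blast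
  qed
qed

text \<open>Near \<open>t\<close> the lift is an explicit function of \<open>x\<close>: for a = X t,
  the vector A = x *v a equals X multiplied by X \<bullet> a, so X is A divided by the square root
  of a \<bullet> A. At \<open>t\<close> this radicand is 1 and, by the orthogonality hypothesis, has
  derivative 0, so that only the derivative of A remains.\<close>

lemma has_vector_derivative_RP2_lift:
  fixes X :: "real \<Rightarrow> real^3"
  assumes cont: "continuous_on {0..} X" and n1: "\<And>s. s \<ge> 0 \<Longrightarrow> norm (X s) = 1"
    and x: "\<And>s. s \<ge> 0 \<Longrightarrow> x s = outer_vec (X s) (X s)" and t: "t \<ge> 0"
    and der: "(x has_vector_derivative D) (at t within {0..})" and D: "(D *v X t) \<bullet> X t = 0"
  shows "(X has_vector_derivative D *v X t) (at t within {0..})"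
proof -
  let ?a = "X t"
  have aa: "?a \<bullet> ?a = 1" using n1[OF t] by (simp add: norm_eq_1)
  define A where "A s = x s *v ?a" for s
  have A: "A s = (X s \<bullet> ?a) *\<^sub>R X s" if "s \<ge> 0" for s using x[OF that] by (simp add: A_def outer_vec_mult)
  have dA: "(A has_vector_derivative D *v ?a) (at t within {0..})"
    unfolding A_def by (rule bounded_linear.has_vector_derivative[OF mv.bounded_linear_left der])
  then have "((\<lambda>s. ?a \<bullet> A s) has_vector_derivative ?a \<bullet> (D *v ?a)) (at t within {0..})"
    by (rule bounded_linear.has_vector_derivative[OF bounded_linear_inner_right])
  then have h: "((\<lambda>s. ?a \<bullet> A s) has_field_derivative 0) (at t within {0..})"
    using D inner_commute[of ?a "D *v ?a"] by (simp only: has_real_derivative_iff_has_vector_derivative)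
  have ht: "?a \<bullet> A t = 1" using A[OF t] aa by simp
  have "((\<lambda>s. inverse (sqrt (?a \<bullet> A s))) has_field_derivative 0) (at t within {0..})"
  proof -
    have "((\<lambda>r. inverse (sqrt r)) has_field_derivative - (1 / 2)) (at 1)"
      by (auto intro!: derivative_eq_intros)
    then have "((\<lambda>r. inverse (sqrt r)) has_field_derivative - (1 / 2)) (at (?a \<bullet> A t))" by (simp only: ht)
    from DERIV_chain2[OF this h] show ?thesis by simp
  qed
  from has_vector_derivative_scaleR[OF this dA]
  have main: "((\<lambda>s. inverse (sqrt (?a \<bullet> A s)) *\<^sub>R A s) has_vector_derivative D *v ?a) (at t within {0..})"
    using ht by simp
  \<comment> \<open>Continuity of the lift decides the sign: near \<open>t\<close> its inner product
    with \<open>?a\<close> is positive, hence equal to the square root of its square.\<close>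
  obtain d where d: "d > 0" "\<And>s. s \<ge> 0 \<Longrightarrow> dist s t < d \<Longrightarrow> dist (X s) ?a < 1"
    using cont[unfolded continuous_on_iff, rule_format, of t 1] t by auto
  have eq: "inverse (sqrt (?a \<bullet> A s)) *\<^sub>R A s = X s" if s: "s \<ge> 0" "dist s t < d" for s
  proof -
    have "(norm (X s - ?a))\<^sup>2 < 1\<^sup>2" using d(2)[OF s] by (intro power_strict_mono) (auto simp: dist_norm)
    then have pos: "X s \<bullet> ?a > 0" using norm_outer_diff(2)[OF n1[OF s(1)] n1[OF t]] by simp
    have "?a \<bullet> A s = (X s \<bullet> ?a)\<^sup>2" using A[OF s(1)] by (simp add: power2_eq_square inner_commute)
    then have "sqrt (?a \<bullet> A s) = X s \<bullet> ?a" using pos by simp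
    then show ?thesis using A[OF s(1)] pos by simp
  qed
  show ?thesis
    by (rule has_vector_derivative_transform_within[OF main d(1)]) (use t eq in auto)
qed

theorem periodic_limit_property_RP2: "periodic_limit_property RP2 T_RP2"
  unfolding periodic_limit_property_def
proof (intro allI impI, elim conjE)
  fix Z :: "(real^3^3) set" and N :: nat and \<Psi> :: "nat \<Rightarrow> real^3^3 \<Rightarrow> real^3^3"
    and x :: "real \<Rightarrow> real^3^3" and u :: "nat \<Rightarrow> real \<Rightarrow> real"
  assume Z: "Z \<subseteq> RP2" "compact Z"
    and \<Psi>: "\<forall>i\<in>{1..N}. continuous_on Z (\<Psi> i) \<and> (\<forall>z\<in>Z. \<Psi> i z \<in> T_RP2 z)"
    and x: "\<forall>t\<ge>0. x t \<in> Z" "abs_cont_halfline x" and u: "\<forall>i\<in>{1..N}. control_fun (u i)"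
    and u1: "AE t in lebesgue. t \<ge> 0 \<longrightarrow> (\<Sum>i=1..N. u i t) = 1"
    and der: "AE t in lebesgue. t \<ge> 0 \<longrightarrow>
          (x has_vector_derivative (\<Sum>i=1..N. u i t *\<^sub>R \<Psi> i (x t))) (at t within {0..})"
  let ?q = "\<lambda>a. outer_vec a a" and ?S = "sphere (0::real^3) 1"
  define Z' where "Z' = ?S \<inter> ?q -` Z"
  \<comment> \<open>The tangent vector at \<open>?q a\<close> lifted to the sphere at
    \<open>a\<close>. The two preimages of a point carry opposite vectors, as they must for both to
    project to the same field.\<close>
  define \<Psi>' where "\<Psi>' i a = \<Psi> i (?q a) *v a" for i a
  have cq: "continuous_on UNIV ?q" by (intro outer.continuous_on continuous_intros)
  have compZ': "compact Z'"
  proof -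
    have "closed Z'" unfolding Z'_def
      by (rule continuous_closed_preimage) (use Z(2) in \<open>auto intro: continuous_on_subset[OF cq] compact_imp_closed\<close>)
    then have "compact (?S \<inter> Z')" by (intro compact_Int_closed) auto
    moreover have "?S \<inter> Z' = Z'" by (auto simp: Z'_def)
    ultimately show ?thesis by simp
  qed
  have \<Psi>T: "\<Psi>' i a \<bullet> a = 0" "outer_vec a (\<Psi>' i a) + outer_vec (\<Psi>' i a) a = \<Psi> i (?q a)"
    if "i \<in> {1..N}" "a \<in> Z'" for i a
    using T_RP2_eq[of a "\<Psi> i (?q a)"] \<Psi> that by (auto simp: Z'_def \<Psi>'_def)
  have c\<Psi>': "continuous_on Z' (\<Psi>' i)" if "i \<in> {1..N}" for i
    unfolding \<Psi>'_def using \<Psi> that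
    by (intro mv.continuous_on continuous_intros continuous_on_compose2[of Z "\<Psi> i" Z' ?q] continuous_on_subset[OF cq])
       (auto simp: Z'_def)
  have AC_x: "absolutely_continuous_on {0..T} x" if "T \<ge> 0" for T using x(2) that by (simp add: abs_cont_halfline_def)
  \<comment> \<open>A family consisting of one short interval in the definition of absolute
    continuity gives continuity, which the lifting theorem requires.\<close>
  have contx: "continuous_on {0..} x"
    unfolding continuous_on_iff
  proof (intro ballI allI impI)
    fix t e :: real assume t: "t \<in> {0..}" and e: "e > 0"
    obtain \<delta> where \<delta>: "\<delta> > 0" "\<forall>(n::nat) a b. (\<forall>k<n. a k \<le> b k \<and> {a k..b k} \<subseteq> {0..t+1}) \<and>
        (\<forall>j<n. \<forall>k<n. j \<noteq> k \<longrightarrow> {a j<..<b j} \<inter> {a k<..<b k} = {}) \<and>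
        (\<Sum>k<n. b k - a k) < \<delta> \<longrightarrow> (\<Sum>k<n. norm (x (b k) - x (a k))) < e"
      using AC_x[of "t + 1"] t e unfolding absolutely_continuous_on_def by auto
    have small: "norm (x b - x a) < e" if "0 \<le> a" "a \<le> b" "b \<le> t + 1" "b - a < \<delta>" for a b
      using \<delta>(2)[rule_format, of 1 "\<lambda>_. a" "\<lambda>_. b"] that by auto
    show "\<exists>d>0. \<forall>s\<in>{0..}. dist s t < d \<longrightarrow> dist (x s) (x t) < e"
    proof (intro exI[of _ "min \<delta> 1"] conjI ballI impI)
      fix s assume "s \<in> {0..}" "dist s t < min \<delta> 1"
      then show "dist (x s) (x t) < e" using small[of s t] small[of t s] t
        by (cases "s \<le> t") (auto simp: dist_real_def dist_norm norm_minus_commute)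
    qed (use \<delta> in auto)
  qed
  obtain X where contX: "continuous_on {0..} X" and XS: "X \<in> {0..} \<rightarrow> ?S" and qX: "\<And>t. t \<in> {0..} \<Longrightarrow> ?q (X t) = x t"
  proof (rule covering_space_lift[OF covering_space_RP2])
    show "simply_connected {0::real..}" "locally path_connected {0::real..}"
      by (auto intro: convex_imp_simply_connected convex_imp_locally_path_connected)
    show "continuous_on {0..} x" by (rule contx)
    show "x \<in> {0..} \<rightarrow> RP2" using x(1) Z(1) by auto
  qed blast
  have n1: "norm (X t) = 1" if "t \<ge> 0" for t using XS that by auto
  have XZ': "X t \<in> Z'" if "t \<ge> 0" for t using n1[OF that] qX[of t] x(1) that by (auto simp: Z'_def)
  have acX: "abs_cont_halfline X"
    unfolding abs_cont_halfline_def
  proof (intro allI impI)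
    fix T :: real assume T: "T \<ge> 0"
    \<comment> \<open>For times closer than \<eta> the lifted points have distance below 1 and hence
      positive inner product, so their distance is bounded by that of their images.\<close>
    have "uniformly_continuous_on {0..T} X"
      by (intro compact_uniformly_continuous continuous_on_subset[OF contX]) auto
    then obtain \<eta> where \<eta>: "\<eta> > 0" "\<And>s t. \<lbrakk>s \<in> {0..T}; t \<in> {0..T}; dist t s < \<eta>\<rbrakk> \<Longrightarrow> dist (X t) (X s) < 1"
      unfolding uniformly_continuous_on_def by (metis zero_less_one)
    show "absolutely_continuous_on {0..T} X"
    proof (rule absolutely_continuous_on_dominated[OF AC_x[OF T], of 1 \<eta>])
      fix s t assume st: "s \<le> t" "{s..t} \<subseteq> {0..T}" "t - s < \<eta>"
      then have m: "s \<in> {0..T}" "t \<in> {0..T}" by auto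
      then have n: "norm (X t) = 1" "norm (X s) = 1" using n1 by auto
      have "dist (X t) (X s) < 1" by (rule \<eta>(2)[OF m]) (use st in \<open>auto simp: dist_real_def\<close>)
      then have "(norm (X t - X s))\<^sup>2 < 1\<^sup>2" by (intro power_strict_mono) (auto simp: dist_norm)
      then have "X t \<bullet> X s \<ge> 0" using norm_outer_diff(2)[OF n] by simp
      from norm_diff_le_outer_diff[OF n this]
      show "norm (X t - X s) \<le> 1 * norm (x t - x s)" using qX m by auto
    qed (use \<eta> in auto)
  qed
  have derX: "AE t in lebesgue. t \<ge> 0 \<longrightarrow>
          (X has_vector_derivative (\<Sum>i=1..N. u i t *\<^sub>R \<Psi>' i (X t))) (at t within {0..})"
    using der
  proof eventually_elim
    case (elim t)
    show ?case
    proof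
      assume t: "t \<ge> 0"
      let ?D = "\<Sum>i=1..N. u i t *\<^sub>R \<Psi> i (x t)"
      have D: "?D *v X t = (\<Sum>i=1..N. u i t *\<^sub>R \<Psi>' i (X t))"
        unfolding mv.sum_left mv.scaleR_left \<Psi>'_def using qX[of t] t by simp
      have "(\<Sum>i=1..N. u i t *\<^sub>R \<Psi>' i (X t)) \<bullet> X t = 0"
        unfolding inner_sum_left by (rule sum.neutral) (use \<Psi>T(1)[OF _ XZ'[OF t]] in auto)
      then have "(?D *v X t) \<bullet> X t = 0" by (simp only: D)
      from has_vector_derivative_RP2_lift[OF contX n1 _ t elim[rule_format, OF t] this]
      show "(X has_vector_derivative (\<Sum>i=1..N. u i t *\<^sub>R \<Psi>' i (X t))) (at t within {0..})"
        using qX unfolding D by simp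
    qed
  qed
  have "Z' \<subseteq> S2" by (auto simp: Z'_def S2_def)
  moreover have "\<forall>i\<in>{1..N}. continuous_on Z' (\<Psi>' i) \<and> (\<forall>z\<in>Z'. \<Psi>' i z \<in> T_S2 z)"
    using c\<Psi>' \<Psi>T(1) by (auto simp: T_S2_def)
  ultimately obtain v Y where v: "\<forall>i\<in>{1..N}. control_fun (v i) \<and> periodic_halfline (v i)"
    "AE t in lebesgue. t \<ge> 0 \<longrightarrow> (\<Sum>i=1..N. v i t) = 1"
    and Y: "periodic_halfline Y" "abs_cont_halfline Y" "\<forall>t\<ge>0. Y t \<in> omega_limit X"
    and derY: "AE t in lebesgue. t \<ge> 0 \<longrightarrow>
             (Y has_vector_derivative (\<Sum>i=1..N. v i t *\<^sub>R \<Psi>' i (Y t))) (at t within {0..})"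
    using periodic_limit_property_S2[unfolded periodic_limit_property_def, rule_format, of Z' N \<Psi>' X u]
      compZ' XZ' acX u u1 derX by blast
  have "omega_limit X \<subseteq> Z'" by (rule omega_limit_subset[OF compact_imp_closed[OF compZ'] XZ'])
  then have YZ': "Y t \<in> Z'" if "t \<ge> 0" for t using Y(3) that by blast
  then have nY: "norm (Y t) = 1" if "t \<ge> 0" for t using that by (auto simp: Z'_def)
  define y where "y t = ?q (Y t)" for t
  have "periodic_halfline y" using Y(1) by (auto simp: periodic_halfline_def y_def)
  moreover have "abs_cont_halfline y"
    unfolding abs_cont_halfline_def
  proof (intro allI impI)
    fix T :: real assume "T \<ge> 0"
    then have "absolutely_continuous_on {0..T} Y" using Y(2) by (simp add: abs_cont_halfline_def)
    then show "absolutely_continuous_on {0..T} y"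
    proof (rule absolutely_continuous_on_dominated[of _ _ 2 1])
      fix s t :: real assume "s \<le> t" "{s..t} \<subseteq> {0..T}" "t - s < 1"
      then have "s \<ge> 0" "t \<ge> 0" by auto
      then show "norm (y t - y s) \<le> 2 * norm (Y t - Y s)" unfolding y_def by (intro norm_outer_diff_le nY)
    qed auto
  qed
  moreover have "y t \<in> omega_limit x" if t: "t \<ge> 0" for t
    unfolding omega_limit_def
  proof
    fix T :: real assume T: "T \<in> {0..}"
    have "Y t \<in> closure (X ` {T..})" using Y(3) t T by (auto simp: omega_limit_def)
    moreover have "?q ` closure (X ` {T..}) \<subseteq> closure (x ` {T..})"
    proof (rule image_closure_subset)
      show "continuous_on (closure (X ` {T..})) ?q" by (rule continuous_on_subset[OF cq]) simp
      have "?q ` X ` {T..} = x ` {T..}" unfolding image_image by (rule image_cong) (use qX T in auto)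
      then show "?q ` X ` {T..} \<subseteq> closure (x ` {T..})" using closure_subset by simp
    qed simp
    ultimately show "y t \<in> closure (x ` {T..})" unfolding y_def by blast
  qed
  moreover have "AE t in lebesgue. t \<ge> 0 \<longrightarrow>
             (y has_vector_derivative (\<Sum>i=1..N. v i t *\<^sub>R \<Psi> i (y t))) (at t within {0..})"
    using derY
  proof eventually_elim
    case (elim t)
    show ?case
    proof
      assume t: "t \<ge> 0"
      let ?D = "\<Sum>i=1..N. v i t *\<^sub>R \<Psi>' i (Y t)"
      \<comment> \<open>The product rule gives the differential of the projection, which by
        linearity takes the combination of lifted fields to the same combination of the original
        ones.\<close>
      have "(y has_vector_derivative outer_vec (Y t) ?D + outer_vec ?D (Y t)) (at t within {0..})"
        unfolding y_def using elim t by (intro outer.has_vector_derivative) auto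
      moreover have "outer_vec (Y t) ?D + outer_vec ?D (Y t) =
          (\<Sum>i=1..N. v i t *\<^sub>R (outer_vec (Y t) (\<Psi>' i (Y t)) + outer_vec (\<Psi>' i (Y t)) (Y t)))"
        by (simp only: outer.sum_left outer.sum_right outer.scaleR_left outer.scaleR_right scaleR_add_right sum.distrib)
      moreover have "\<dots> = (\<Sum>i=1..N. v i t *\<^sub>R \<Psi> i (y t))"
        by (intro sum.cong refl) (simp only: \<Psi>T(2)[OF _ YZ'[OF t]] y_def)
      ultimately show "(y has_vector_derivative (\<Sum>i=1..N. v i t *\<^sub>R \<Psi> i (y t))) (at t within {0..})" by simp
    qed
  qed
  ultimately show "\<exists>v y. (\<forall>i\<in>{1..N}. control_fun (v i) \<and> periodic_halfline (v i)) \<and>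
          (AE t in lebesgue. t \<ge> 0 \<longrightarrow> (\<Sum>i=1..N. v i t) = 1) \<and>
          periodic_halfline y \<and> abs_cont_halfline y \<and> (\<forall>t\<ge>0. y t \<in> omega_limit x) \<and>
          (AE t in lebesgue. t \<ge> 0 \<longrightarrow>
             (y has_vector_derivative (\<Sum>i=1..N. v i t *\<^sub>R \<Psi> i (y t))) (at t within {0..}))"
    using v by blast
qed

theorem theorem3p3:
  shows "periodic_limit_property S2 T_S2 \<and> periodic_limit_property RP2 T_RP2"
  using periodic_limit_property_S2 periodic_limit_property_RP2 by blast

end
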